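(* Let $(E,\mathcal E)$ be a measurable space such that $\mathcal E$ is countably generated and $\Delta:=\{(x,x):x\in E\}\in\mathcal E\otimes\mathcal E$. Let $P$ be a Markov kernel on $E$ which admits an invariant probability measure $\mu$ (not assumed to be unique). Consider the following conditions. (P$_3$) $P_n(x,\cdot)$ converges to $\mu$ in total variation as $n\to\infty$ for $\mu$-almost all $x\in E$. (A$_3$) For $\mu\otimes\mu$-almost all $(x,y)\in E\times E$ there exists some $n=n_{x,y}\in\mathbb N$ such that $P_n(x,\cdot)$ and $P_n(y,\cdot)$ are non-singular. (A$_3'$) $\mu\otimes\mu$-almost all $(x,y)\in E\times E$ are asymptotically equivalent. (B$_3$) $P$ is aperiodic and weakly irreducible. (C$_3$) For $\mu\otimes\mu$-almost every $(x,y)\in E\times E$ there exist some $k\in\mathbb N_0$ and a coupling $\zeta\in C(P_k(x,\cdot),P_k(y,\cdot))$ such that $\zeta(\Delta)>0$. (C$_3'$) For $\mu\otimes\mu$-almost every $(x,y)\in E\times E$ there exists a coupling $(X_k)_{k\in\mathbb N_0}$, $(Y_k)_{k\in\mathbb N_0}$ of $\mathbb P_x$ and $\mathbb P_y$ on some probability space $(\Omega,\mathcal F,\mathbb P)$ such that $\lim_{n\to\infty}\mathbb P(X_k=Y_k\text{ for all }k\ge n)=1$. (G$_3$) For $\mu\otimes\mu$-almost every $(x,y)\in E\times E$ there exist some $k\in\mathbb N$ and $\zeta\in\tilde C(P_k(x,\cdot),P_k(y,\cdot))$ such that $\zeta(\Delta)>0$. Then (A$_3$), (A$_3'$), (B$_3$),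 (C$_3$), (G$_3$) and (P$_3$) are equivalent, and they are implied by (C$_3'$). If $(E,\mathcal E)$ is a Borel space, then each of these equivalent conditions implies (C$_3'$).
   Context: $\mathbb N=\{1,2,\dots\}$, $\mathbb N_0=\mathbb N\cup\{0\}$. $P_n(\cdot,\cdot)$ is the $n$-step transition probability of $P$; $X=(X_n)_{n\in\mathbb N_0}$ is the Markov chain with kernel $P$, and $\mathbb P_x$ is its law on $(E^{\mathbb N_0},\mathcal E^{\otimes\mathbb N_0})$ when started at $x\in E$. The total variation metric is $d(\nu_1,\nu_2)=\sup_{A\in\mathcal E}|\nu_1(A)-\nu_2(A)|$. Two measures $\nu_1,\nu_2$ on $(E,\mathcal E)$ are non-singular if there is no $A\in\mathcal E$ with $\nu_1(A)=0$ and $\nu_2(A^c)=0$. Asymptotic equivalence: states $x,y\in E$ are asymptotically equivalent if for each $\varepsilon>0$ there exist $n\in\mathbb N$ and $A\in\mathcal E$ such that $P_n(x,A)\ge1-\varepsilon$, $P_n(y,A)\ge1-\varepsilon$, and the measures $P_n(x,\cdot)$ and $P_n(y,\cdot)$ restricted to $A$ are equivalent (mutually absolutely continuous). Aperiodicity (with respect to $\mu$): for an integer $d\ge2$, $P$ is $d$-periodic if there are disjoint sets $E_1,\dots,E_d\in\mathcal E$ with $\mu(E_1)>0$ such that $P(x,E_{i+1})=1$ for all $x\in E_i$, $1\le i\le d$, where $E_{d+1}:=E_1$. $P$ is aperiodic if it is not $d$-periodic for any $d\ge2$. Weak irreducibility (with respect to $\mu$): there exist a non-trivial $\sigma$-finite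 measure $\phi$ on $(E,\mathcal E)$ and a set $E_0\in\mathcal E$ with $\mu(E_0)=1$ such that for every $x\in E_0$ and every $A\in\mathcal E$ with $\phi(A)>0$, $\mathbb P_x\big(\bigcup_{n=1}^\infty\{X_n\in A\}\big)>0$. Couplings: for probability measures $\nu_1,\nu_2$ on a measurable space $(\bar E,\bar{\mathcal E})$, $C(\nu_1,\nu_2)$ is the set of probability measures on $(\bar E\times\bar E,\bar{\mathcal E}\otimes\bar{\mathcal E})$ with first marginal $\nu_1$ and second marginal $\nu_2$; a pair of $\bar E$-valued random variables on a common probability space is a coupling of $\nu_1,\nu_2$ if its joint law is in $C(\nu_1,\nu_2)$. $\tilde C(\nu_1,\nu_2)$ is the set of probability measures $\xi$ on $\bar E\times\bar E$ whose marginals $\xi^1,\xi^2$ satisfy $\xi^1\ll\nu_1$ and $\xi^2\ll\nu_2$. Borel space: a measurable space isomorphic (as a measurable space) to a Borel subset of $[0,1]$. *)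

theory Defs
  imports "HOL-Probability.Probability"
begin

definition countably_generated :: "'a measure \<Rightarrow> bool" where
  "countably_generated M \<longleftrightarrow>
     (\<exists>G. countable G \<and> G \<subseteq> Pow (space M) \<and> sets M = sigma_sets (space M) G)"

definition diagonal :: "'a measure \<Rightarrow> ('a \<times> 'a) set" where
  "diagonal M = {(x, x) | x. x \<in> space M}"

definition is_borel_space :: "'a measure \<Rightarrow> bool" where
  "is_borel_space M \<longleftrightarrow>
     (\<exists>B \<in> sets (borel :: real measure). B \<subseteq> {0..1} \<and>
       (\<exists>f \<in> M \<rightarrow>\<^sub>M restrict_space borel B. \<exists>g \<in> restrict_space borel B \<rightarrow>\<^sub>M M.
          (\<forall>x \<in> space M. g (f x) = x) \<and> (\<forall>b \<in> B. f (g b) = b)))"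

definition tv_dist :: "'a measure \<Rightarrow> 'a measure \<Rightarrow> 'a measure \<Rightarrow> real" where
  "tv_dist M \<nu>1 \<nu>2 = (SUP A \<in> sets M. \<bar>measure \<nu>1 A - measure \<nu>2 A\<bar>)"

definition non_singular :: "'a measure \<Rightarrow> 'a measure \<Rightarrow> 'a measure \<Rightarrow> bool" where
  "non_singular M \<nu>1 \<nu>2 \<longleftrightarrow>
     \<not> (\<exists>A \<in> sets M. emeasure \<nu>1 A = 0 \<and> emeasure \<nu>2 (space M - A) = 0)"

definition couplings :: "'a measure \<Rightarrow> 'a measure \<Rightarrow> ('a \<times> 'a) measure set" where
  "couplings \<nu>1 \<nu>2 =
     {\<xi> \<in> space (prob_algebra (\<nu>1 \<Otimes>\<^sub>M \<nu>2)). distr \<xi> \<nu>1 fst = \<nu>1 \<and> distr \<xi> \<nu>2 snd = \<nu>2}"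

text \<open>Beware of the argument order of the library predicate:
  \<open>absolutely_continuous \<nu> \<xi>\<close> means that \<open>\<xi>\<close> is absolutely continuous with respect to \<open>\<nu>\<close>.\<close>

definition generalized_couplings :: "'a measure \<Rightarrow> 'a measure \<Rightarrow> ('a \<times> 'a) measure set" where
  "generalized_couplings \<nu>1 \<nu>2 =
     {\<xi> \<in> space (prob_algebra (\<nu>1 \<Otimes>\<^sub>M \<nu>2)).
        absolutely_continuous \<nu>1 (distr \<xi> \<nu>1 fst) \<and> absolutely_continuous \<nu>2 (distr \<xi> \<nu>2 snd)}"

definition rv_coupling ::
    "'w measure \<Rightarrow> ('w \<Rightarrow> 'a) \<Rightarrow> ('w \<Rightarrow> 'a) \<Rightarrow> 'a measure \<Rightarrow> 'a measure \<Rightarrow> bool" where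
  "rv_coupling \<Omega> X Y \<nu>1 \<nu>2 \<longleftrightarrow>
     prob_space \<Omega> \<and> X \<in> \<Omega> \<rightarrow>\<^sub>M \<nu>1 \<and> Y \<in> \<Omega> \<rightarrow>\<^sub>M \<nu>2 \<and>
     distr \<Omega> (\<nu>1 \<Otimes>\<^sub>M \<nu>2) (\<lambda>\<omega>. (X \<omega>, Y \<omega>)) \<in> couplings \<nu>1 \<nu>2"

primrec nstep :: "'a measure \<Rightarrow> ('a \<Rightarrow> 'a measure) \<Rightarrow> nat \<Rightarrow> 'a \<Rightarrow> 'a measure" where
  "nstep M P 0 x = return M x"
| "nstep M P (Suc n) x = nstep M P n x \<bind> P"

definition invariant_prob :: "'a measure \<Rightarrow> ('a \<Rightarrow> 'a measure) \<Rightarrow> 'a measure \<Rightarrow> bool" where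
  "invariant_prob M P \<mu> \<longleftrightarrow> \<mu> \<in> space (prob_algebra M) \<and> \<mu> \<bind> P = \<mu>"

text \<open>The law of the chain is obtained from the Ionescu-Tulcea theorem of the library.
  The conditional law of the \<open>i\<close>-th coordinate given the previous ones \<open>\<omega>\<close> is the point mass
  at the starting state for \<open>i = 0\<close>, and \<open>P (\<omega> (i - 1))\<close> otherwise.\<close>

definition chain_step ::
    "'a measure \<Rightarrow> ('a \<Rightarrow> 'a measure) \<Rightarrow> 'a \<Rightarrow> nat \<Rightarrow> (nat \<Rightarrow> 'a) \<Rightarrow> 'a measure" where
  "chain_step M P x i \<omega> = (case i of 0 \<Rightarrow> return M x | Suc j \<Rightarrow> P (\<omega> j))"

definition chain_law :: "'a measure \<Rightarrow> ('a \<Rightarrow> 'a measure) \<Rightarrow> 'a \<Rightarrow> (nat \<Rightarrow> 'a) measure" where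
  "chain_law M P x =
     projective_family.lim UNIV (Ionescu_Tulcea.CI (chain_step M P x) (\<lambda>_. M)) (\<lambda>_. M)"

lemma Ionescu_Tulcea_chain:
  assumes P: "P \<in> M \<rightarrow>\<^sub>M prob_algebra M" and x: "x \<in> space M"
  shows "Ionescu_Tulcea (chain_step M P x) (\<lambda>_. M)"
proof (rule Ionescu_Tulcea.intro)
  have P': "P \<in> M \<rightarrow>\<^sub>M subprob_algebra M"
    using P by (rule measurable_prob_algebraD)
  fix i :: nat
  show "chain_step M P x i \<in> PiM {0..<i} (\<lambda>_. M) \<rightarrow>\<^sub>M subprob_algebra M"
  proof (cases i)
    case 0
    then show ?thesis
      using x by (simp add: chain_step_def[abs_def] space_subprob_algebra prob_space_return
          prob_space_imp_subprob_space)
  next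
    case (Suc j)
    have "(\<lambda>\<omega>. \<omega> j) \<in> PiM {0..<i} (\<lambda>_. M) \<rightarrow>\<^sub>M M"
      by (rule measurable_component_singleton) (simp add: Suc)
    from measurable_compose[OF this P'] show ?thesis
      by (simp add: chain_step_def[abs_def] Suc)
  qed
next
  fix i :: nat and \<omega> assume \<omega>: "\<omega> \<in> space (PiM {0..<i} (\<lambda>_. M))"
  show "prob_space (chain_step M P x i \<omega>)"
  proof (cases i)
    case 0
    then show ?thesis using x by (simp add: chain_step_def prob_space_return)
  next
    case (Suc j)
    with \<omega> have "\<omega> j \<in> space M" by (auto simp: space_PiM PiE_iff)
    then have "P (\<omega> j) \<in> space (prob_algebra M)"
      by (rule measurable_space[OF P])
    then show ?thesis by (simp add: chain_step_def Suc space_prob_algebra)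
  qed
qed

definition aperiodic :: "'a measure \<Rightarrow> ('a \<Rightarrow> 'a measure) \<Rightarrow> 'a measure \<Rightarrow> bool" where
  "aperiodic M P \<mu> \<longleftrightarrow>
     \<not> (\<exists>d \<ge> 2. \<exists>E :: nat \<Rightarrow> 'a set.
          (\<forall>i \<in> {1..d}. E i \<in> sets M) \<and> disjoint_family_on E {1..d} \<and> emeasure \<mu> (E 1) > 0 \<and>
          (\<forall>i \<in> {1..d}. \<forall>x \<in> E i. emeasure (P x) (E (if i = d then 1 else i + 1)) = 1))"

definition weakly_irreducible :: "'a measure \<Rightarrow> ('a \<Rightarrow> 'a measure) \<Rightarrow> 'a measure \<Rightarrow> bool" where
  "weakly_irreducible M P \<mu> \<longleftrightarrow>
     (\<exists>\<phi> E0. sigma_finite_measure \<phi> \<and> sets \<phi> = sets M \<and> emeasure \<phi> (space M) > 0 \<and>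
        E0 \<in> sets M \<and> emeasure \<mu> E0 = 1 \<and>
        (\<forall>x \<in> E0. \<forall>A \<in> sets M. emeasure \<phi> A > 0 \<longrightarrow>
           emeasure (chain_law M P x)
             (\<Union>n \<in> {1..}. {\<omega> \<in> space (PiM UNIV (\<lambda>_. M)). \<omega> n \<in> A}) > 0))"

definition asymptotically_equivalent ::
    "'a measure \<Rightarrow> ('a \<Rightarrow> 'a measure) \<Rightarrow> 'a \<Rightarrow> 'a \<Rightarrow> bool" where
  "asymptotically_equivalent M P x y \<longleftrightarrow>
     (\<forall>\<epsilon>>0. \<exists>n\<ge>1. \<exists>A \<in> sets M.
        measure (nstep M P n x) A \<ge> 1 - \<epsilon> \<and> measure (nstep M P n y) A \<ge> 1 - \<epsilon> \<and>
        absolutely_continuous (restrict_space (nstep M P n x) A) (restrict_space (nstep M P n y) A) \<and>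
        absolutely_continuous (restrict_space (nstep M P n y) A) (restrict_space (nstep M P n x) A))"

text \<open>The type argument fixes the type of the sample points of \<open>\<Omega>\<close>, since HOL
  cannot quantify over types inside a formula.\<close>

definition successfully_coupled ::
    "'w itself \<Rightarrow> 'a measure \<Rightarrow> ('a \<Rightarrow> 'a measure) \<Rightarrow> 'a \<Rightarrow> 'a \<Rightarrow> bool" where
  "successfully_coupled W M P x y \<longleftrightarrow>
     (\<exists>(\<Omega> :: 'w measure) X Y.
        rv_coupling \<Omega> X Y (chain_law M P x) (chain_law M P y) \<and>
        (\<lambda>n. measure \<Omega> {\<omega> \<in> space \<Omega>. \<forall>k\<ge>n. X \<omega> k = Y \<omega> k}) \<longlonglongrightarrow> 1)"

end

theory Submission
  imports Defs
begin

text \<open>Let \<open>D (x, y)\<close> be the limit of the total variation distances of \<open>P\<^sub>n x\<close> and \<open>P\<^sub>n y\<close>. It is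
  bounded and subharmonic for the product chain, hence almost surely constant along stationary
  trajectories of that chain: it is constant almost everywhere for the product of \<open>P\<^sub>n x\<close> and
  \<open>P\<^sub>n y\<close>. If these measures are not mutually singular, they have a coupling that charges the
  diagonal, where \<open>D\<close> vanishes, and is absolutely continuous with respect to their product elsewhere;
  as \<open>D (x, y)\<close> is at most the mean of \<open>D\<close> under any coupling, it must be zero.

  For condition (B), weak irreducibility forces \<open>D = 0\<close> on a set of positive measure. The
  equivalence classes of positive measure are then permuted by the chain, so finiteness of \<open>\<mu>\<close>
  produces a cycle; aperiodicity makes it a single class and irreducibility makes this class have
  full measure. Successful couplings on Borel spaces come from Goldstein's greedy construction.\<close>

subsection \<open>Measure-theoretic preliminaries\<close>

text \<open>Mutual singularity is the common currency: couplings, generalised couplings, asymptotic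
  equivalence and successful couplings each exclude a separating set at some time. That time may
  vary with the pair, so constancy of D is proved for all n outside a single null set. Countable
  generation makes total variation a supremum over a countable algebra, hence D measurable, and it
  lets densities of kernels be compared for almost every state at once. In (B) the irreducibility
  measure has no given relation to the invariant one. The link is that a state whose n-step laws are
  all singular to the invariant measure is confined from time 1 on to one null set; this set is
  charged by the irreducibility measure although almost no state reaches it. The classes with D = 0
  move into each other only up to null sets, whereas periodicity speaks of every state, so the cycle
  is first thinned to the states that follow it forever. The Borel assumption serves to rebuild the
  beginning of a path from its later part and independent randomness: the greedy construction
  matches shifted laws only, and the pasts are attached afterwards.\<close>

datatype set_term = Gen_Term nat | Compl_Term set_term | Union_Term set_term set_term

instance set_term :: countable
  by countable_datatype

primrec set_of_term :: "'a set \<Rightarrow> (nat \<Rightarrow> 'a set) \<Rightarrow> set_term \<Rightarrow> 'a set" where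
  "set_of_term \<Omega> G (Gen_Term n) = G n"
| "set_of_term \<Omega> G (Compl_Term t) = \<Omega> - set_of_term \<Omega> G t"
| "set_of_term \<Omega> G (Union_Term s t) = set_of_term \<Omega> G s \<union> set_of_term \<Omega> G t"

text \<open>Boolean terms over an enumeration of the generators are countably many, and the sets
  they denote are closed under complements and finite unions.\<close>

lemma countably_generated_algebra:
  assumes "countably_generated M"
  obtains \<A> where "countable \<A>" "algebra (space M) \<A>" "sets M = sigma_sets (space M) \<A>"
proof -
  obtain G0 where G0: "countable G0" "G0 \<subseteq> Pow (space M)" "sets M = sigma_sets (space M) G0"
    using assms by (auto simp: countably_generated_def)
  \<comment> \<open>Adding the empty set makes the family non-empty, hence the range of a sequence,
    and supplies the empty set of the algebra.\<close>
  define G where "G = from_nat_into (insert {} G0)"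
  have range_G: "range G = insert {} G0"
    unfolding G_def using G0(1) by (intro range_from_nat_into) auto
  define \<A> where "\<A> = range (set_of_term (space M) G)"
  have sub: "set_of_term (space M) G t \<subseteq> space M" for t
  proof (induction t)
    case (Gen_Term n)
    have "G n \<in> insert {} G0" using range_G by blast
    then show ?case using G0(2) by auto
  qed auto
  have alg: "algebra (space M) \<A>"
    unfolding algebra_iff_Un
  proof (intro conjI ballI)
    show "\<A> \<subseteq> Pow (space M)" using sub by (auto simp: \<A>_def)
    have "{} \<in> range G" using range_G by simp
    then obtain n where "G n = {}" by auto
    then show "{} \<in> \<A>" unfolding \<A>_def by (metis rangeI set_of_term.simps(1))
    show "space M - a \<in> \<A>" if "a \<in> \<A>" for a
      using that unfolding \<A>_def by (auto simp: set_of_term.simps(2)[symmetric] simp del: set_of_term.simps)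
    show "a \<union> b \<in> \<A>" if "a \<in> \<A>" "b \<in> \<A>" for a b
      using that unfolding \<A>_def by (auto simp: set_of_term.simps(3)[symmetric] simp del: set_of_term.simps)
  qed
  have in_sets: "set_of_term (space M) G t \<in> sets M" for t
  proof (induction t)
    case (Gen_Term n)
    have "G n \<in> insert {} G0" using range_G by blast
    then show ?case using G0(3) by auto
  qed auto
  have "sigma_sets (space M) \<A> \<subseteq> sets M"
    using in_sets by (intro sets.sigma_sets_subset) (auto simp: \<A>_def)
  moreover have "sets M \<subseteq> sigma_sets (space M) \<A>"
    unfolding G0(3)
  proof (rule sigma_sets_mono')
    have "range G \<subseteq> \<A>" unfolding \<A>_def by (metis image_subsetI rangeI set_of_term.simps(1))
    then show "G0 \<subseteq> \<A>" using range_G by auto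
  qed
  ultimately show ?thesis
    using that[of \<A>] alg by (auto simp: \<A>_def)
qed

text \<open>The sets that the algebra approximates to every precision form a sigma-algebra; the work
  is in the countable unions.\<close>

lemma (in finite_measure) algebra_approximation:
  assumes alg: "algebra (space M) \<A>" and sets: "sets M = sigma_sets (space M) \<A>"
    and A: "A \<in> sets M" and "e > 0"
  shows "\<exists>B\<in>\<A>. measure M (sym_diff A B) < e"
proof -
  interpret A: algebra "space M" \<A> by fact
  have sub: "\<A> \<subseteq> sets M" unfolding sets by auto
  have "A \<in> sigma_sets (space M) \<A>" using A sets by simp
  then show ?thesis using \<open>e > 0\<close>
  proof (induction arbitrary: e)
    case (Basic a)
    then show ?case by (intro bexI[of _ a]) auto
  next
    case Empty
    then show ?case by (intro bexI[of _ "{}"]) auto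
  next
    case (Compl a)
    then obtain B where B: "B \<in> \<A>" "measure M (sym_diff a B) < e" by blast
    have "a \<subseteq> space M" using Compl.hyps sets sets.sets_into_space by blast
    then have "sym_diff (space M - a) (space M - B) = sym_diff a B"
      using A.sets_into_space[OF B(1)] by auto
    then show ?case using B by (intro bexI[of _ "space M - B"]) auto
  next
    case (Union a)
    have a: "a i \<in> sets M" for i using Union.hyps sets by simp
    \<comment> \<open>One half of \<open>e\<close> pays for cutting the union at a finite stage, the
      other half is shared geometrically among the approximations of the \<open>a i\<close>.\<close>
    have "\<exists>B\<in>\<A>. measure M (sym_diff (a i) B) < e / 2 * (1/2) ^ Suc i" for i
      using Union.IH[of "e / 2 * (1/2) ^ Suc i" i] Union.prems by simp
    then obtain B where B: "\<And>i. B i \<in> \<A>" "\<And>i. measure M (sym_diff (a i) (B i)) < e / 2 * (1/2) ^ Suc i"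
      by metis
    have Bs: "B i \<in> sets M" for i using B(1) sub by auto
    have "(\<lambda>n. measure M (\<Union>i<n. a i)) \<longlonglongrightarrow> measure M (\<Union>n. \<Union>i<n. a i)"
      using a by (intro finite_Lim_measure_incseq) (auto simp: incseq_def intro: less_le_trans)
    moreover have UN: "(\<Union>n. \<Union>i<n. a i) = (\<Union>i. a i)" by auto
    ultimately have "eventually (\<lambda>n. measure M (\<Union>i<n. a i) > measure M (\<Union>i. a i) - e / 2) sequentially"
      using Union.prems by (intro order_tendstoD(1)) auto
    then obtain n where n: "measure M (\<Union>i<n. a i) > measure M (\<Union>i. a i) - e / 2"
      by (auto simp: eventually_sequentially)
    have "measure M ((\<Union>i. a i) - (\<Union>i<n. a i)) = measure M (\<Union>i. a i) - measure M (\<Union>i<n. a i)"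
      using a by (intro finite_measure_Diff) auto
    with n have 1: "measure M ((\<Union>i. a i) - (\<Union>i<n. a i)) < e / 2" by simp
    have "measure M (\<Union>i<n. sym_diff (a i) (B i)) \<le> (\<Sum>i<n. measure M (sym_diff (a i) (B i)))"
      using a Bs by (intro finite_measure_subadditive_finite) auto
    also have "\<dots> \<le> (\<Sum>i<n. e / 2 * (1/2) ^ Suc i)"
      using B(2) by (intro sum_mono less_imp_le) auto
    also have "\<dots> = e / 2 * (\<Sum>i<n. (1/2) ^ Suc i)" by (simp add: sum_distrib_left)
    also have "(\<Sum>i<n. (1/2) ^ Suc i) \<le> (1::real)"
      using sum_le_suminf[of "\<lambda>i. (1/2::real) ^ Suc i" "{..<n}"] power_half_series
      by (auto simp: sums_iff)
    finally have 2: "measure M (\<Union>i<n. sym_diff (a i) (B i)) \<le> e / 2"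
      using Union.prems by simp
    have "measure M (sym_diff (\<Union>i. a i) (\<Union>i<n. B i))
        \<le> measure M (((\<Union>i. a i) - (\<Union>i<n. a i)) \<union> (\<Union>i<n. sym_diff (a i) (B i)))"
      using a Bs by (intro finite_measure_mono) auto
    also have "\<dots> \<le> measure M ((\<Union>i. a i) - (\<Union>i<n. a i)) + measure M (\<Union>i<n. sym_diff (a i) (B i))"
      using a Bs by (intro measure_Un_le) auto
    also have "\<dots> < e" using 1 2 by simp
    finally show ?case using B(1) by (intro bexI[of _ "\<Union>i<n. B i"]) auto
  qed
qed

text \<open>The sum of the measures \<open>K i\<close>. Writing the sum as an integral against
  counting measure turns countable additivity into an exchange of integral and series. It is used
  with two indices for \<open>sum_measure\<close> and with all naturals to assemble the stages of
  the successful coupling.\<close>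

definition mix_measure :: "'a measure \<Rightarrow> ('i \<Rightarrow> 'a measure) \<Rightarrow> 'a measure" where
  "mix_measure M K = measure_of (space M) (sets M) (\<lambda>A. \<integral>\<^sup>+i. emeasure (K i) A \<partial>count_space UNIV)"

lemma sets_mix_measure[simp, measurable_cong]: "sets (mix_measure M K) = sets M"
  by (simp add: mix_measure_def)

lemma space_mix_measure[simp]: "space (mix_measure M K) = space M"
  by (simp add: mix_measure_def)

lemma emeasure_mix_measure:
  assumes K: "\<And>i. sets (K i) = sets M" and A: "A \<in> sets M"
  shows "emeasure (mix_measure M K) A = (\<integral>\<^sup>+i. emeasure (K i) A \<partial>count_space UNIV)"
  unfolding mix_measure_def
proof (rule emeasure_measure_of_sigma[OF _ _ _ A])
  show "sigma_algebra (space M) (sets M)" by (rule sets.sigma_algebra_axioms)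
  show "positive (sets M) (\<lambda>A. \<integral>\<^sup>+i. emeasure (K i) A \<partial>count_space UNIV)"
    by (auto simp: positive_def)
  show "countably_additive (sets M) (\<lambda>A. \<integral>\<^sup>+i. emeasure (K i) A \<partial>count_space UNIV)"
  proof (rule countably_additiveI)
    fix A :: "nat \<Rightarrow> _" assume "range A \<subseteq> sets M" "disjoint_family A" "(\<Union>i. A i) \<in> sets M"
    then show "(\<Sum>n. \<integral>\<^sup>+i. emeasure (K i) (A n) \<partial>count_space UNIV) =
        (\<integral>\<^sup>+i. emeasure (K i) (\<Union>n. A n) \<partial>count_space UNIV)"
      using K by (subst nn_integral_suminf[symmetric]) (auto intro!: nn_integral_cong suminf_emeasure)
  qed
qed

definition sum_measure :: "'a measure \<Rightarrow> 'a measure \<Rightarrow> 'a measure" where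
  "sum_measure M N = mix_measure M (\<lambda>b. if b then M else N)"

lemma sets_sum_measure[simp, measurable_cong]: "sets (sum_measure M N) = sets M"
  by (simp add: sum_measure_def)

lemma space_sum_measure[simp]: "space (sum_measure M N) = space M"
  by (simp add: sum_measure_def)

lemma emeasure_sum_measure:
  assumes N: "sets N = sets M" and A: "A \<in> sets M"
  shows "emeasure (sum_measure M N) A = emeasure M A + emeasure N A"
  unfolding sum_measure_def using N A
  by (subst emeasure_mix_measure) (auto simp: nn_integral_count_space_finite UNIV_bool add.commute)

lemma finite_measure_sum_measure:
  assumes N: "sets N = sets M" and "finite_measure M" "finite_measure N"
  shows "finite_measure (sum_measure M N)"
proof (rule finite_measureI)
  have "space N = space M" using N by (rule sets_eq_imp_space_eq)
  then show "emeasure (sum_measure M N) (space (sum_measure M N)) \<noteq> \<infinity>"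
    using assms finite_measure.emeasure_finite by (auto simp: emeasure_sum_measure)
qed

text \<open>Both measures are dominated by their sum. Real versions that are non-negative everywhere
  let minima and differences of densities be formed pointwise.\<close>

lemma common_density:
  assumes \<nu>: "finite_measure \<nu>1" "finite_measure \<nu>2" "sets \<nu>1 = sets M" "sets \<nu>2 = sets M"
  obtains \<rho> and f g :: "'a \<Rightarrow> real" where "finite_measure \<rho>" "sets \<rho> = sets M"
    "f \<in> borel_measurable M" "g \<in> borel_measurable M" "\<And>x. 0 \<le> f x" "\<And>x. 0 \<le> g x"
    "\<nu>1 = density \<rho> (\<lambda>x. ennreal (f x))" "\<nu>2 = density \<rho> (\<lambda>x. ennreal (g x))"
proof -
  define \<rho> where "\<rho> = sum_measure \<nu>1 \<nu>2"
  have sets: "sets \<rho> = sets M" by (simp add: \<rho>_def \<nu>)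
  interpret finite_measure \<rho>
    unfolding \<rho>_def using \<nu> by (intro finite_measure_sum_measure) auto
  have *: "\<exists>f::'a \<Rightarrow> real. f \<in> borel_measurable M \<and> (\<forall>x. 0 \<le> f x) \<and> \<nu> = density \<rho> (\<lambda>x. ennreal (f x))"
    if fin: "finite_measure \<nu>" and s: "sets \<nu> = sets M" and le: "\<And>A. A \<in> sets M \<Longrightarrow> emeasure \<nu> A \<le> emeasure \<rho> A" for \<nu>
  proof -
    have ac: "absolutely_continuous \<rho> \<nu>"
      unfolding absolutely_continuous_def null_sets_def using le s sets by fastforce
    obtain D where D: "D \<in> borel_measurable \<rho>" "AE x in \<rho>. RN_deriv \<rho> \<nu> x = ennreal (D x)"
      "\<And>x. 0 \<le> D x"
      using real_RN_deriv[OF fin ac] s sets by metis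
    have "\<nu> = density \<rho> (RN_deriv \<rho> \<nu>)"
      using ac s sets by (simp add: density_RN_deriv)
    also have "\<dots> = density \<rho> (\<lambda>x. ennreal (D x))"
      using D by (intro density_cong) auto
    finally show ?thesis using D sets by (auto intro!: exI[of _ D] simp: measurable_cong_sets[OF sets refl])
  qed
  have "emeasure \<nu>1 A \<le> emeasure \<rho> A" "emeasure \<nu>2 A \<le> emeasure \<rho> A" if "A \<in> sets M" for A
    using that \<nu> by (auto simp: \<rho>_def emeasure_sum_measure)
  then show ?thesis
    using *[OF \<nu>(1,3)] *[OF \<nu>(2,4)] that[OF _ sets] finite_measure_axioms by metis
qed

lemma prob_algebraD:
  assumes "\<nu> \<in> space (prob_algebra M)"
  shows "prob_space \<nu>" "sets \<nu> = sets M" "space \<nu> = space M" "finite_measure \<nu>"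
  using assms by (auto simp: space_prob_algebra prob_space_def dest: sets_eq_imp_space_eq)

section \<open>Total variation distance\<close>

lemma tv_dist_bdd_above:
  assumes "\<nu>1 \<in> space (prob_algebra M)" "\<nu>2 \<in> space (prob_algebra M)"
  shows "bdd_above ((\<lambda>A. \<bar>measure \<nu>1 A - measure \<nu>2 A\<bar>) ` \<A>)"
proof (rule bdd_aboveI2)
  fix A
  have "measure \<nu>1 A \<le> 1" "measure \<nu>2 A \<le> 1"
    using assms[THEN prob_algebraD(1)] by (auto intro: prob_space.prob_le_1)
  then show "\<bar>measure \<nu>1 A - measure \<nu>2 A\<bar> \<le> 1"
    using measure_nonneg[of \<nu>1 A] measure_nonneg[of \<nu>2 A] by linarith
qed

lemma tv_dist_upper:
  assumes "\<nu>1 \<in> space (prob_algebra M)" "\<nu>2 \<in> space (prob_algebra M)" "A \<in> sets M"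
  shows "\<bar>measure \<nu>1 A - measure \<nu>2 A\<bar> \<le> tv_dist M \<nu>1 \<nu>2"
  unfolding tv_dist_def using assms by (intro cSUP_upper tv_dist_bdd_above)

lemma tv_dist_least:
  assumes "\<And>A. A \<in> sets M \<Longrightarrow> \<bar>measure \<nu>1 A - measure \<nu>2 A\<bar> \<le> c"
  shows "tv_dist M \<nu>1 \<nu>2 \<le> c"
  unfolding tv_dist_def using assms by (intro cSUP_least) auto

lemma tv_dist_nonneg:
  assumes "\<nu>1 \<in> space (prob_algebra M)" "\<nu>2 \<in> space (prob_algebra M)"
  shows "0 \<le> tv_dist M \<nu>1 \<nu>2"
  using tv_dist_upper[OF assms sets.empty_sets] by simp

lemma tv_dist_le_1:
  assumes "\<nu>1 \<in> space (prob_algebra M)" "\<nu>2 \<in> space (prob_algebra M)"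
  shows "tv_dist M \<nu>1 \<nu>2 \<le> 1"
proof (rule tv_dist_least)
  fix A
  have "measure \<nu>1 A \<le> 1" "measure \<nu>2 A \<le> 1"
    using assms[THEN prob_algebraD(1)] by (auto intro: prob_space.prob_le_1)
  then show "\<bar>measure \<nu>1 A - measure \<nu>2 A\<bar> \<le> 1"
    using measure_nonneg[of \<nu>1 A] measure_nonneg[of \<nu>2 A] by linarith
qed

lemma tv_dist_commute: "tv_dist M \<nu>1 \<nu>2 = tv_dist M \<nu>2 \<nu>1"
  unfolding tv_dist_def by (simp add: abs_minus_commute)

lemma tv_dist_triangle:
  assumes "\<nu>1 \<in> space (prob_algebra M)" "\<nu>2 \<in> space (prob_algebra M)" "\<nu>3 \<in> space (prob_algebra M)"
  shows "tv_dist M \<nu>1 \<nu>3 \<le> tv_dist M \<nu>1 \<nu>2 + tv_dist M \<nu>2 \<nu>3"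
proof (rule tv_dist_least)
  fix A assume "A \<in> sets M"
  from tv_dist_upper[OF assms(1,2) this] tv_dist_upper[OF assms(2,3) this]
  show "\<bar>measure \<nu>1 A - measure \<nu>3 A\<bar> \<le> tv_dist M \<nu>1 \<nu>2 + tv_dist M \<nu>2 \<nu>3" by linarith
qed

text \<open>Approximating a set in the sum of the two measures approximates it under both of them at
  once.\<close>

lemma tv_dist_algebra:
  assumes \<nu>: "\<nu>1 \<in> space (prob_algebra M)" "\<nu>2 \<in> space (prob_algebra M)"
    and alg: "algebra (space M) \<A>" and sets: "sets M = sigma_sets (space M) \<A>"
  shows "tv_dist M \<nu>1 \<nu>2 = (SUP A\<in>\<A>. \<bar>measure \<nu>1 A - measure \<nu>2 A\<bar>)"
proof (rule antisym)
  interpret A: algebra "space M" \<A> by fact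
  have sub: "\<A> \<subseteq> sets M" unfolding sets by auto
  show "(SUP A\<in>\<A>. \<bar>measure \<nu>1 A - measure \<nu>2 A\<bar>) \<le> tv_dist M \<nu>1 \<nu>2"
    using sub A.top \<nu> by (intro cSUP_least tv_dist_upper) auto
  note s = \<nu>[THEN prob_algebraD(2)]
  interpret N1: prob_space \<nu>1 using prob_algebraD \<nu> by auto
  interpret N2: prob_space \<nu>2 using prob_algebraD \<nu> by auto
  interpret L: finite_measure "sum_measure \<nu>1 \<nu>2"
    using s by (intro finite_measure_sum_measure) (auto intro: N1.finite_measure_axioms N2.finite_measure_axioms)
  have sp: "space \<nu>1 = space M" using s sets_eq_imp_space_eq by blast
  show "tv_dist M \<nu>1 \<nu>2 \<le> (SUP A\<in>\<A>. \<bar>measure \<nu>1 A - measure \<nu>2 A\<bar>)"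
  proof (rule tv_dist_least, rule field_le_epsilon)
    fix A and e :: real assume A: "A \<in> sets M" and "e > 0"
    then obtain B where B: "B \<in> \<A>" and m: "measure (sum_measure \<nu>1 \<nu>2) (sym_diff A B) < e"
      using L.algebra_approximation[of \<A> A e] alg sets s sp by auto
    have Bs: "B \<in> sets M" using B sub by auto
    have "measure (sum_measure \<nu>1 \<nu>2) (sym_diff A B) = measure \<nu>1 (sym_diff A B) + measure \<nu>2 (sym_diff A B)"
      using s A Bs unfolding measure_def
      by (subst emeasure_sum_measure) (auto simp: enn2real_plus N1.emeasure_eq_measure N2.emeasure_eq_measure)
    then have m': "measure \<nu>1 (sym_diff A B) + measure \<nu>2 (sym_diff A B) < e" using m by simp
    have *: "\<bar>measure \<nu> A - measure \<nu> B\<bar> \<le> measure \<nu> (sym_diff A B)" 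
      if "finite_measure \<nu>" "sets \<nu> = sets M" for \<nu>
    proof -
      interpret finite_measure \<nu> by fact
      have "measure \<nu> A \<le> measure \<nu> (B \<union> sym_diff A B)" "measure \<nu> B \<le> measure \<nu> (A \<union> sym_diff A B)"
        using that A Bs by (auto intro!: finite_measure_mono)
      moreover have "measure \<nu> (B \<union> sym_diff A B) \<le> measure \<nu> B + measure \<nu> (sym_diff A B)"
        "measure \<nu> (A \<union> sym_diff A B) \<le> measure \<nu> A + measure \<nu> (sym_diff A B)"
        using that A Bs by (auto intro!: measure_Un_le)
      ultimately show ?thesis by linarith
    qed
    have "\<bar>measure \<nu>1 B - measure \<nu>2 B\<bar> \<le> (SUP A\<in>\<A>. \<bar>measure \<nu>1 A - measure \<nu>2 A\<bar>)"
      using B \<nu> by (intro cSUP_upper tv_dist_bdd_above)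
    then show "\<bar>measure \<nu>1 A - measure \<nu>2 A\<bar> \<le> (SUP A\<in>\<A>. \<bar>measure \<nu>1 A - measure \<nu>2 A\<bar>) + e"
      using *[OF N1.finite_measure_axioms s(1)] *[OF N2.finite_measure_axioms s(2)] m' by linarith
  qed
qed

text \<open>Over a countable algebra the supremum is a countable one; this is the source of the
  measurability of \<open>dist_lim\<close>.\<close>

lemma measurable_tv_dist:
  assumes "countably_generated M" and [measurable]: "K \<in> N \<rightarrow>\<^sub>M prob_algebra M" "L \<in> N \<rightarrow>\<^sub>M prob_algebra M"
  shows "(\<lambda>x. tv_dist M (K x) (L x)) \<in> borel_measurable N"
proof -
  obtain \<A> where A: "countable \<A>" "algebra (space M) \<A>" "sets M = sigma_sets (space M) \<A>"
    using countably_generated_algebra[OF assms(1)] by blast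
  have sub: "\<A> \<subseteq> sets M" unfolding A(3) by auto
  have KL: "K x \<in> space (prob_algebra M)" "L x \<in> space (prob_algebra M)" if "x \<in> space N" for x
    using that assms(2,3)[THEN measurable_space] by auto
  have "(\<lambda>x. SUP A\<in>\<A>. \<bar>measure (K x) A - measure (L x) A\<bar>) \<in> borel_measurable N"
  proof (rule borel_measurable_cSUP[OF A(1)])
    fix A assume "A \<in> \<A>"
    then have [measurable]: "A \<in> sets M" using sub by auto
    show "(\<lambda>x. \<bar>measure (K x) A - measure (L x) A\<bar>) \<in> borel_measurable N" by measurable
  qed (rule tv_dist_bdd_above[OF KL])
  then show ?thesis
    using tv_dist_algebra[OF KL A(2,3)] by (subst measurable_cong) auto
qed

lemma integrable_prob_bounded:
  fixes f :: "'a \<Rightarrow> real"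
  assumes "\<nu> \<in> space (prob_algebra M)" "f \<in> borel_measurable M"
    and "\<And>x. x \<in> space M \<Longrightarrow> \<bar>f x\<bar> \<le> c"
  shows "integrable \<nu> f"
proof -
  note p = prob_algebraD[OF assms(1)]
  interpret prob_space \<nu> by (rule p)
  show ?thesis
    using assms p by (intro integrable_const_bound[where B=c]) 
      (auto simp: measurable_cong_sets[OF p(2) refl] intro!: AE_I2)
qed

text \<open>Among test functions with values in [0, 1], the difference of the integrals is largest
  for the indicator of the set where the first density exceeds the second.\<close>

lemma tv_dist_integral:
  assumes \<nu>: "\<nu>1 \<in> space (prob_algebra M)" "\<nu>2 \<in> space (prob_algebra M)"
    and h[measurable]: "h \<in> borel_measurable M" and h01: "\<And>x. x \<in> space M \<Longrightarrow> 0 \<le> h x \<and> h x \<le> 1"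
  shows "\<bar>(\<integral>x. h x \<partial>\<nu>1) - (\<integral>x. h x \<partial>\<nu>2)\<bar> \<le> tv_dist M \<nu>1 \<nu>2"
proof -
  have *: "(\<integral>x. h x \<partial>\<nu>1) - (\<integral>x. h x \<partial>\<nu>2) \<le> tv_dist M \<nu>1 \<nu>2"
    if \<nu>: "\<nu>1 \<in> space (prob_algebra M)" "\<nu>2 \<in> space (prob_algebra M)" for \<nu>1 \<nu>2
  proof -
    note p1 = prob_algebraD[OF \<nu>(1)] and p2 = prob_algebraD[OF \<nu>(2)]
    obtain \<rho> and f g :: "'a \<Rightarrow> real" where fin: "finite_measure \<rho>" and sets: "sets \<rho> = sets M"
      and [measurable]: "f \<in> borel_measurable M" "g \<in> borel_measurable M"
      and nn: "\<And>x. 0 \<le> f x" "\<And>x. 0 \<le> g x"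
      and d: "\<nu>1 = density \<rho> (\<lambda>x. ennreal (f x))" "\<nu>2 = density \<rho> (\<lambda>x. ennreal (g x))"
      using common_density[OF p1(4) p2(4) p1(2) p2(2)] by metis
    note [measurable_cong] = sets
    have sp: "space \<rho> = space M" using sets by (rule sets_eq_imp_space_eq)
    define A where "A = {x \<in> space M. g x < f x}"
    have [measurable]: "A \<in> sets M" unfolding A_def by measurable
    have int: "integrable \<rho> (\<lambda>x. f x * k x)" "integrable \<rho> (\<lambda>x. g x * k x)"
      "(\<integral>x. k x \<partial>\<nu>1) = (\<integral>x. f x * k x \<partial>\<rho>)" "(\<integral>x. k x \<partial>\<nu>2) = (\<integral>x. g x * k x \<partial>\<rho>)"
      if [measurable]: "k \<in> borel_measurable M" and "\<And>x. x \<in> space M \<Longrightarrow> 0 \<le> k x \<and> k x \<le> 1" for k :: "'a \<Rightarrow> real"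
    proof -
      have "integrable \<nu>1 k" "integrable \<nu>2 k"
        using that \<nu> by (auto intro!: integrable_prob_bounded[where c=1])
      then show "integrable \<rho> (\<lambda>x. f x * k x)" "integrable \<rho> (\<lambda>x. g x * k x)"
        unfolding d by (auto simp: integrable_density nn)
      show "(\<integral>x. k x \<partial>\<nu>1) = (\<integral>x. f x * k x \<partial>\<rho>)" "(\<integral>x. k x \<partial>\<nu>2) = (\<integral>x. g x * k x \<partial>\<rho>)"
        unfolding d by (auto simp: integral_density nn)
    qed
    have "(\<integral>x. h x \<partial>\<nu>1) - (\<integral>x. h x \<partial>\<nu>2) = (\<integral>x. f x * h x - g x * h x \<partial>\<rho>)"
      using h01 by (subst int(3), simp, simp, subst int(4)) (auto simp: int)
    also have "\<dots> \<le> (\<integral>x. f x * indicator A x - g x * indicator A x \<partial>\<rho>)"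
    proof (rule integral_mono)
      show "f x * h x - g x * h x \<le> f x * indicator A x - g x * indicator A x" if "x \<in> space \<rho>" for x
      proof (cases "x \<in> A")
        case True
        then have "(f x - g x) * h x \<le> (f x - g x) * 1"
          using h01 that sp by (intro mult_left_mono) (auto simp: A_def)
        then show ?thesis using True by (simp add: algebra_simps)
      next
        case False
        then have "f x - g x \<le> 0" using that sp by (auto simp: A_def)
        then have "(f x - g x) * h x \<le> 0" using h01 that sp by (intro mult_nonpos_nonneg) auto
        then show ?thesis using False by (simp add: algebra_simps)
      qed
    qed (use h01 in \<open>auto intro!: int Bochner_Integration.integrable_diff split: split_indicator\<close>)
    also have "\<dots> = measure \<nu>1 A - measure \<nu>2 A"
      using int[of "indicator A"] p1 p2 \<open>A \<in> sets M\<close> sets.sets_into_space[OF \<open>A \<in> sets M\<close>] by (auto split: split_indicator simp: Int_absorb2)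
    also have "\<dots> \<le> tv_dist M \<nu>1 \<nu>2"
      using tv_dist_upper[OF \<nu>, of A] by auto
    finally show ?thesis .
  qed
  show ?thesis
    using *[OF \<nu>] *[OF \<nu>(2,1)] tv_dist_commute[of M \<nu>1 \<nu>2] by linarith
qed

section \<open>Couplings and mutual singularity\<close>

lemma non_singular_of_diagonal:
  assumes z: "sets \<zeta> = sets (M \<Otimes>\<^sub>M M)" and D: "emeasure \<zeta> (diagonal M) > 0"
    and 1: "\<And>A. A \<in> sets M \<Longrightarrow> emeasure \<nu>1 A = 0 \<Longrightarrow> emeasure \<zeta> (A \<times> space M) = 0"
    and 2: "\<And>A. A \<in> sets M \<Longrightarrow> emeasure \<nu>2 A = 0 \<Longrightarrow> emeasure \<zeta> (space M \<times> A) = 0"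
  shows "non_singular M \<nu>1 \<nu>2"
  unfolding non_singular_def
proof safe
  fix A assume A: "A \<in> sets M" "emeasure \<nu>1 A = 0" "emeasure \<nu>2 (space M - A) = 0"
  \<comment> \<open>As x lies in \<open>A\<close> or in its complement, (x, x) lies in one of two
    strips, each of which is null because of one marginal.\<close>
  have "emeasure \<zeta> (diagonal M) \<le> emeasure \<zeta> (A \<times> space M \<union> space M \<times> (space M - A))"
    using A z by (intro emeasure_mono) (auto simp: diagonal_def)
  also have "\<dots> \<le> emeasure \<zeta> (A \<times> space M) + emeasure \<zeta> (space M \<times> (space M - A))"
    using A z by (intro emeasure_subadditive) auto
  also have "\<dots> = 0" using 1[OF A(1,2)] 2[OF _ A(3)] A by simp
  finally show False using D by simp
qed

lemma generalized_couplings_non_singular: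
  assumes \<nu>: "\<nu>1 \<in> space (prob_algebra M)" "\<nu>2 \<in> space (prob_algebra M)"
    and z: "\<zeta> \<in> generalized_couplings \<nu>1 \<nu>2" and D: "emeasure \<zeta> (diagonal M) > 0"
  shows "non_singular M \<nu>1 \<nu>2"
proof (rule non_singular_of_diagonal)
  note p = prob_algebraD[OF \<nu>(1)] prob_algebraD[OF \<nu>(2)]
  have z': "sets \<zeta> = sets (\<nu>1 \<Otimes>\<^sub>M \<nu>2)" "absolutely_continuous \<nu>1 (distr \<zeta> \<nu>1 fst)"
    "absolutely_continuous \<nu>2 (distr \<zeta> \<nu>2 snd)"
    using z by (auto simp: generalized_couplings_def space_prob_algebra)
  note [measurable_cong] = z'(1) p(2) p(6)
  show s: "sets \<zeta> = sets (M \<Otimes>\<^sub>M M)" using z'(1) p by (simp cong: sets_pair_measure_cong)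
  have sp: "space \<zeta> = space M \<times> space M" using sets_eq_imp_space_eq[OF s] by (simp add: space_pair_measure)
  show "emeasure \<zeta> (A \<times> space M) = 0" if "A \<in> sets M" "emeasure \<nu>1 A = 0" for A
  proof -
    have "A \<in> null_sets (distr \<zeta> \<nu>1 fst)"
      using z'(2) that p unfolding absolutely_continuous_def null_sets_def by blast
    then have "0 = emeasure (distr \<zeta> \<nu>1 fst) A" by auto
    also have "\<dots> = emeasure \<zeta> (fst -` A \<inter> space \<zeta>)"
      using that by (intro emeasure_distr) (auto simp: p)
    also have "fst -` A \<inter> space \<zeta> = A \<times> space M"
      using sets.sets_into_space[OF that(1)] by (auto simp: sp)
    finally show ?thesis by simp
  qed
  show "emeasure \<zeta> (space M \<times> A) = 0" if "A \<in> sets M" "emeasure \<nu>2 A = 0" for A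
  proof -
    have "A \<in> null_sets (distr \<zeta> \<nu>2 snd)"
      using z'(3) that p unfolding absolutely_continuous_def null_sets_def by blast
    then have "0 = emeasure (distr \<zeta> \<nu>2 snd) A" by auto
    also have "\<dots> = emeasure \<zeta> (snd -` A \<inter> space \<zeta>)"
      using that by (intro emeasure_distr) (auto simp: p)
    also have "snd -` A \<inter> space \<zeta> = space M \<times> A"
      using sets.sets_into_space[OF that(1)] by (auto simp: sp)
    finally show ?thesis by simp
  qed
qed (use D in simp)

lemma couplings_subset_generalized_couplings: "couplings \<nu>1 \<nu>2 \<subseteq> generalized_couplings \<nu>1 \<nu>2"
  by (auto simp: couplings_def generalized_couplings_def absolutely_continuous_def)

lemma couplings_non_singular:
  assumes "\<nu>1 \<in> space (prob_algebra M)" "\<nu>2 \<in> space (prob_algebra M)"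
    and "\<zeta> \<in> couplings \<nu>1 \<nu>2" "emeasure \<zeta> (diagonal M) > 0"
  shows "non_singular M \<nu>1 \<nu>2"
  using assms couplings_subset_generalized_couplings
  by (intro generalized_couplings_non_singular[of \<nu>1 M \<nu>2 \<zeta>]) blast+

text \<open>The common part m = min(f, g), of mass a, is put on the diagonal with weight a; the rest
  gets the product density f(x) g(y) - m(x) m(y). Compared with the normalised maximal coupling,
  this involves no division by 1 - a, and the second part stays below the product measure, which
  yields the last property.\<close>

lemma non_singular_coupling:
  assumes \<nu>: "\<nu>1 \<in> space (prob_algebra M)" "\<nu>2 \<in> space (prob_algebra M)"
    and diag[measurable]: "diagonal M \<in> sets (M \<Otimes>\<^sub>M M)" and ns: "non_singular M \<nu>1 \<nu>2"
  obtains \<zeta> where "\<zeta> \<in> couplings \<nu>1 \<nu>2" "emeasure \<zeta> (diagonal M) > 0"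
    "\<And>B. B \<in> sets (M \<Otimes>\<^sub>M M) \<Longrightarrow> emeasure (\<nu>1 \<Otimes>\<^sub>M \<nu>2) B = 0 \<Longrightarrow> B \<inter> diagonal M = {} \<Longrightarrow> emeasure \<zeta> B = 0"
proof -
  note p1 = prob_algebraD[OF \<nu>(1)] and p2 = prob_algebraD[OF \<nu>(2)]
  interpret N1: prob_space \<nu>1 by (rule p1)
  interpret N2: prob_space \<nu>2 by (rule p2)
  obtain \<rho> and f g :: "'a \<Rightarrow> real" where fin: "finite_measure \<rho>" and sets: "sets \<rho> = sets M"
    and [measurable]: "f \<in> borel_measurable M" "g \<in> borel_measurable M"
    and nn: "\<And>x. 0 \<le> f x" "\<And>x. 0 \<le> g x"
    and d: "\<nu>1 = density \<rho> (\<lambda>x. ennreal (f x))" "\<nu>2 = density \<rho> (\<lambda>x. ennreal (g x))"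
    using common_density[OF p1(4) p2(4) p1(2) p2(2)] by metis
  interpret R: finite_measure \<rho> by (rule fin)
  interpret RR: pair_sigma_finite \<rho> \<rho> by standard
  note [measurable_cong] = sets
  have sp: "space \<rho> = space M" using sets by (rule sets_eq_imp_space_eq)
  have spp: "space (M \<Otimes>\<^sub>M M) = space M \<times> space M" by (simp add: space_pair_measure)
  have If: "(\<integral>\<^sup>+x. ennreal (f x) \<partial>\<rho>) = 1" "(\<integral>\<^sup>+x. ennreal (g x) \<partial>\<rho>) = 1"
    using N1.emeasure_space_1 N2.emeasure_space_1 unfolding d
    by (simp_all add: emeasure_density)
  have int_f: "integrable \<rho> f" and int_g: "integrable \<rho> g"
    using If nn by (auto intro!: integrableI_nonneg)
  have If': "(\<integral>x. f x \<partial>\<rho>) = 1" "(\<integral>x. g x \<partial>\<rho>) = 1"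
    using If nn by (auto simp: integral_eq_nn_integral)
  define m where "m x = min (f x) (g x)" for x
  have [measurable]: "m \<in> borel_measurable M" unfolding m_def by measurable
  have m: "0 \<le> m x" "m x \<le> f x" "m x \<le> g x" for x using nn by (auto simp: m_def)
  have int_m: "integrable \<rho> m" using m nn by (intro Bochner_Integration.integrable_bound[OF int_f]) auto
  define a where "a = (\<integral>x. m x \<partial>\<rho>)"
  have a0: "0 \<le> a" unfolding a_def using m by (intro integral_nonneg_AE) auto
  have a1: "a \<le> 1" unfolding a_def If'(1)[symmetric] using int_m int_f m by (intro integral_mono)
  \<comment> \<open>If \<open>a\<close> were zero, \<open>f\<close> and \<open>g\<close> would have
    essentially disjoint supports and the zero set of \<open>f\<close> would separate the two
    measures.\<close>
  have a_pos: "a > 0"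
  proof (rule ccontr)
    assume "\<not> a > 0"
    then have "a = 0" using a0 by simp
    then have ae: "AE x in \<rho>. m x = 0"
      unfolding a_def using integral_nonneg_eq_0_iff_AE[OF int_m] m by auto
    define A where "A = {x\<in>space M. f x = 0}"
    have A: "A \<in> sets M" unfolding A_def by measurable
    have "emeasure \<nu>1 A = 0"
      using A unfolding d by (subst emeasure_density) (auto simp: A_def intro!: nn_integral_zero' AE_I2 split: split_indicator)
    moreover have "emeasure \<nu>2 (space M - A) = 0"
    proof -
      have "AE x in \<rho>. ennreal (g x) * indicator (space M - A) x = 0"
        using ae by eventually_elim (auto simp: A_def m_def min_def split: split_indicator if_splits)
      then show ?thesis
        using A unfolding d by (subst emeasure_density) (auto intro!: nn_integral_zero')
    qed
    ultimately show False using ns A by (auto simp: non_singular_def)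
  qed
  define u where "u = (\<lambda>(x, y). f x * g y - m x * m y)"
  have [measurable]: "u \<in> borel_measurable (M \<Otimes>\<^sub>M M)" unfolding u_def by measurable
  have u0: "0 \<le> u z" for z unfolding u_def using m nn by (auto split: prod.split intro!: mult_mono)
  define z1 where "z1 = density (\<rho> \<Otimes>\<^sub>M \<rho>) (\<lambda>z. ennreal (u z))"
  define z2 where "z2 = distr (density \<rho> (\<lambda>x. ennreal (a * m x))) (M \<Otimes>\<^sub>M M) (\<lambda>x. (x, x))"
  define \<zeta> where "\<zeta> = sum_measure z1 z2"
  have s1: "sets z1 = sets (M \<Otimes>\<^sub>M M)" unfolding z1_def by (simp add: sets cong: sets_pair_measure_cong)
  have s2: "sets z2 = sets (M \<Otimes>\<^sub>M M)" unfolding z2_def by simp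
  have s: "sets \<zeta> = sets (M \<Otimes>\<^sub>M M)" unfolding \<zeta>_def by (simp add: s1)
  have sz: "space \<zeta> = space M \<times> space M" using sets_eq_imp_space_eq[OF s] spp by simp
  have em: "emeasure \<zeta> B = emeasure z1 B + emeasure z2 B" if "B \<in> sets (M \<Otimes>\<^sub>M M)" for B
    unfolding \<zeta>_def using that s1 s2 by (subst emeasure_sum_measure) auto
  have e2: "emeasure z2 B = (\<integral>\<^sup>+x. ennreal (a * m x) * indicator B (x, x) \<partial>\<rho>)" if [measurable]: "B \<in> sets (M \<Otimes>\<^sub>M M)" for B
    unfolding z2_def by (subst emeasure_distr) (auto simp: emeasure_density sp intro!: nn_integral_cong split: split_indicator)
  have e1: "emeasure z1 B = (\<integral>\<^sup>+x. \<integral>\<^sup>+y. ennreal (u (x, y)) * indicator B (x, y) \<partial>\<rho> \<partial>\<rho>)"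
    if [measurable]: "B \<in> sets (M \<Otimes>\<^sub>M M)" for B
    unfolding z1_def by (subst emeasure_density) (auto simp: R.nn_integral_fst[symmetric])
  have marg1: "emeasure \<zeta> (A \<times> space M) = emeasure \<nu>1 A" if [measurable]: "A \<in> sets M" for A
  proof -
    have "(\<integral>\<^sup>+y. ennreal (u (x, y)) * indicator (A \<times> space M) (x, y) \<partial>\<rho>) = ennreal (f x - a * m x) * indicator A x" for x
    proof -
      have "(\<integral>\<^sup>+y. ennreal (u (x, y)) * indicator (A \<times> space M) (x, y) \<partial>\<rho>)
          = (\<integral>\<^sup>+y. ennreal (u (x, y)) * indicator A x \<partial>\<rho>)"
        by (intro nn_integral_cong) (auto simp: sp split: split_indicator)
      also have "\<dots> = (\<integral>\<^sup>+y. ennreal (u (x, y)) \<partial>\<rho>) * indicator A x"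
        by (cases "x \<in> A") auto
      also have "(\<integral>\<^sup>+y. ennreal (u (x, y)) \<partial>\<rho>) = ennreal (\<integral>y. u (x, y) \<partial>\<rho>)"
        using u0 int_g int_m by (intro nn_integral_eq_integral) (auto simp: u_def)
      also have "(\<integral>y. u (x, y) \<partial>\<rho>) = f x - a * m x"
        using int_g int_m by (simp add: u_def If' a_def)
      finally show ?thesis .
    qed
    then have "emeasure \<zeta> (A \<times> space M) = (\<integral>\<^sup>+x. ennreal (f x - a * m x) * indicator A x \<partial>\<rho>)
        + (\<integral>\<^sup>+x. ennreal (a * m x) * indicator (A \<times> space M) (x, x) \<partial>\<rho>)"
      by (simp add: em e1 e2)
    also have "(\<integral>\<^sup>+x. ennreal (a * m x) * indicator (A \<times> space M) (x, x) \<partial>\<rho>) = (\<integral>\<^sup>+x. ennreal (a * m x) * indicator A x \<partial>\<rho>)"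
      by (intro nn_integral_cong) (auto simp: sp split: split_indicator)
    also have "(\<integral>\<^sup>+x. ennreal (f x - a * m x) * indicator A x \<partial>\<rho>) + (\<integral>\<^sup>+x. ennreal (a * m x) * indicator A x \<partial>\<rho>)
        = (\<integral>\<^sup>+x. ennreal (f x) * indicator A x \<partial>\<rho>)"
    proof (subst nn_integral_add[symmetric])
      have "a * m x \<le> f x" for x using mult_mono[of a 1 "m x" "f x"] a0 a1 m nn by auto
      then show "(\<integral>\<^sup>+x. ennreal (f x - a * m x) * indicator A x + ennreal (a * m x) * indicator A x \<partial>\<rho>)
        = (\<integral>\<^sup>+x. ennreal (f x) * indicator A x \<partial>\<rho>)"
        using m a0 by (intro nn_integral_cong) (auto split: split_indicator simp: ennreal_plus[symmetric] simp del: ennreal_plus)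
    qed auto
    also have "\<dots> = emeasure \<nu>1 A" unfolding d by (simp add: emeasure_density)
    finally show ?thesis .
  qed
  have marg2: "emeasure \<zeta> (space M \<times> A) = emeasure \<nu>2 A" if [measurable]: "A \<in> sets M" for A
  proof -
    have "emeasure z1 (space M \<times> A) = (\<integral>\<^sup>+y. \<integral>\<^sup>+x. ennreal (u (x, y)) * indicator (space M \<times> A) (x, y) \<partial>\<rho> \<partial>\<rho>)"
      unfolding z1_def by (subst emeasure_density) (auto simp: RR.nn_integral_snd[symmetric])
    also have "\<dots> = (\<integral>\<^sup>+y. ennreal (g y - a * m y) * indicator A y \<partial>\<rho>)"
    proof (intro nn_integral_cong)
      fix y
      have "(\<integral>\<^sup>+x. ennreal (u (x, y)) * indicator (space M \<times> A) (x, y) \<partial>\<rho>)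
          = (\<integral>\<^sup>+x. ennreal (u (x, y)) * indicator A y \<partial>\<rho>)"
        by (intro nn_integral_cong) (auto simp: sp split: split_indicator)
      also have "\<dots> = (\<integral>\<^sup>+x. ennreal (u (x, y)) \<partial>\<rho>) * indicator A y"
        by (cases "y \<in> A") auto
      also have "(\<integral>\<^sup>+x. ennreal (u (x, y)) \<partial>\<rho>) = ennreal (\<integral>x. u (x, y) \<partial>\<rho>)"
        using u0 int_f int_m by (intro nn_integral_eq_integral) (auto simp: u_def)
      also have "(\<integral>x. u (x, y) \<partial>\<rho>) = g y - a * m y"
        using int_f int_m by (simp add: u_def If' a_def)
      finally show "(\<integral>\<^sup>+x. ennreal (u (x, y)) * indicator (space M \<times> A) (x, y) \<partial>\<rho>) = ennreal (g y - a * m y) * indicator A y" .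
    qed
    finally have "emeasure \<zeta> (space M \<times> A) = (\<integral>\<^sup>+x. ennreal (g x - a * m x) * indicator A x \<partial>\<rho>)
        + (\<integral>\<^sup>+x. ennreal (a * m x) * indicator (space M \<times> A) (x, x) \<partial>\<rho>)"
      by (simp add: em e2)
    also have "(\<integral>\<^sup>+x. ennreal (a * m x) * indicator (space M \<times> A) (x, x) \<partial>\<rho>) = (\<integral>\<^sup>+x. ennreal (a * m x) * indicator A x \<partial>\<rho>)"
      by (intro nn_integral_cong) (auto simp: sp split: split_indicator)
    also have "(\<integral>\<^sup>+x. ennreal (g x - a * m x) * indicator A x \<partial>\<rho>) + (\<integral>\<^sup>+x. ennreal (a * m x) * indicator A x \<partial>\<rho>)
        = (\<integral>\<^sup>+x. ennreal (g x) * indicator A x \<partial>\<rho>)"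
    proof (subst nn_integral_add[symmetric])
      have "a * m x \<le> g x" for x using mult_mono[of a 1 "m x" "g x"] a0 a1 m nn by auto
      then show "(\<integral>\<^sup>+x. ennreal (g x - a * m x) * indicator A x + ennreal (a * m x) * indicator A x \<partial>\<rho>)
        = (\<integral>\<^sup>+x. ennreal (g x) * indicator A x \<partial>\<rho>)"
        using m a0 by (intro nn_integral_cong) (auto split: split_indicator simp: ennreal_plus[symmetric] simp del: ennreal_plus)
    qed auto
    also have "\<dots> = emeasure \<nu>2 A" unfolding d by (simp add: emeasure_density)
    finally show ?thesis .
  qed
  note [measurable_cong] = s
  have prob: "prob_space \<zeta>"
    using marg1[of "space M"] N1.emeasure_space_1 p1(3) sz by (intro prob_spaceI) auto
  have "distr \<zeta> \<nu>1 fst = \<nu>1"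
  proof (rule measure_eqI)
    fix A assume "A \<in> sets (distr \<zeta> \<nu>1 fst)"
    then have A: "A \<in> sets M" using p1 by simp
    have "fst -` A \<inter> space \<zeta> = A \<times> space M" using sets.sets_into_space[OF A] by (auto simp: sz)
    then show "emeasure (distr \<zeta> \<nu>1 fst) A = emeasure \<nu>1 A"
      using A p1(2) marg1[OF A] by (subst emeasure_distr) (auto simp: measurable_cong_sets[OF s p1(2)])
  qed simp
  moreover have "distr \<zeta> \<nu>2 snd = \<nu>2"
  proof (rule measure_eqI)
    fix A assume "A \<in> sets (distr \<zeta> \<nu>2 snd)"
    then have A: "A \<in> sets M" using p2 by simp
    have "snd -` A \<inter> space \<zeta> = space M \<times> A" using sets.sets_into_space[OF A] by (auto simp: sz)
    then show "emeasure (distr \<zeta> \<nu>2 snd) A = emeasure \<nu>2 A"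
      using A p2(2) marg2[OF A] by (subst emeasure_distr) (auto simp: measurable_cong_sets[OF s p2(2)])
  qed simp
  ultimately have coup: "\<zeta> \<in> couplings \<nu>1 \<nu>2"
    using prob s p1(2) p2(2) by (auto simp: couplings_def space_prob_algebra cong: sets_pair_measure_cong)
  have "emeasure z2 (diagonal M) = (\<integral>\<^sup>+x. ennreal (a * m x) \<partial>\<rho>)"
    unfolding e2[OF diag] by (intro nn_integral_cong) (auto simp: sp diagonal_def)
  also have "\<dots> = ennreal (a * a)"
    using a0 m int_m by (subst nn_integral_eq_integral) (auto simp: a_def)
  finally have pos: "emeasure \<zeta> (diagonal M) > 0"
    using a_pos by (simp add: em add_nonneg_pos)
  have null: "emeasure \<zeta> B = 0" if B[measurable]: "B \<in> sets (M \<Otimes>\<^sub>M M)" and 0: "emeasure (\<nu>1 \<Otimes>\<^sub>M \<nu>2) B = 0"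
      and dj: "B \<inter> diagonal M = {}" for B
  proof -
    have "emeasure z2 B = 0"
    proof -
      have "(x, x) \<notin> B" if "x \<in> space M" for x using dj that by (auto simp: diagonal_def)
      then show ?thesis unfolding e2[OF B] by (auto intro!: nn_integral_zero' AE_I2 simp: sp)
    qed
    moreover have "emeasure z1 B \<le> emeasure (\<nu>1 \<Otimes>\<^sub>M \<nu>2) B"
    proof -
      have B': "B \<in> sets (\<nu>1 \<Otimes>\<^sub>M \<nu>2)" using B p1 p2 by (simp cong: sets_pair_measure_cong)
      have "emeasure (\<nu>1 \<Otimes>\<^sub>M \<nu>2) B = (\<integral>\<^sup>+x. \<integral>\<^sup>+y. indicator B (x, y) \<partial>\<nu>2 \<partial>\<nu>1)"
        using B' by (subst N2.emeasure_pair_measure) auto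
      also have "\<dots> = (\<integral>\<^sup>+x. ennreal (f x) * (\<integral>\<^sup>+y. ennreal (g y) * indicator B (x, y) \<partial>\<rho>) \<partial>\<rho>)"
      proof -
        have "(\<integral>\<^sup>+x. \<integral>\<^sup>+y. indicator B (x, y) \<partial>\<nu>2 \<partial>\<nu>1) = (\<integral>\<^sup>+x. \<integral>\<^sup>+y. ennreal (g y) * indicator B (x, y) \<partial>\<rho> \<partial>\<nu>1)"
          unfolding d(2) using p1(3) by (intro nn_integral_cong) (auto simp: nn_integral_density sp)
        then show ?thesis
          unfolding d(1) by (simp add: nn_integral_density)
      qed
      also have "\<dots> \<ge> (\<integral>\<^sup>+x. \<integral>\<^sup>+y. ennreal (u (x, y)) * indicator B (x, y) \<partial>\<rho> \<partial>\<rho>)"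
      proof (rule nn_integral_mono)
        fix x assume x: "x \<in> space \<rho>"
        have "ennreal (f x) * (\<integral>\<^sup>+y. ennreal (g y) * indicator B (x, y) \<partial>\<rho>)
            = (\<integral>\<^sup>+y. ennreal (f x) * (ennreal (g y) * indicator B (x, y)) \<partial>\<rho>)"
          using x by (subst nn_integral_cmult) (auto simp: sp)
        also have "\<dots> \<ge> (\<integral>\<^sup>+y. ennreal (u (x, y)) * indicator B (x, y) \<partial>\<rho>)"
          using m nn by (intro nn_integral_mono) (auto simp: u_def ennreal_mult[symmetric] split: split_indicator intro!: ennreal_leI)
        finally show "(\<integral>\<^sup>+y. ennreal (u (x, y)) * indicator B (x, y) \<partial>\<rho>) \<le> ennreal (f x) * (\<integral>\<^sup>+y. ennreal (g y) * indicator B (x, y) \<partial>\<rho>)" .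
      qed
      finally show ?thesis unfolding e1[OF B] .
    qed
    ultimately show ?thesis using 0 em[OF B] by simp
  qed
  show ?thesis using that[OF coup pos] null by blast
qed

text \<open>Where both densities are positive the measures are equivalent. Outside that set the
  first measure charges only the zero set of the second density, whose mass is at most the distance
  because the second measure vanishes there; then the roles are exchanged.\<close>

lemma tv_dist_equivalent_set:
  assumes \<nu>: "\<nu>1 \<in> space (prob_algebra M)" "\<nu>2 \<in> space (prob_algebra M)"
    and tv: "tv_dist M \<nu>1 \<nu>2 \<le> \<epsilon>"
  obtains A where "A \<in> sets M" "measure \<nu>1 A \<ge> 1 - \<epsilon>" "measure \<nu>2 A \<ge> 1 - \<epsilon>"
    "absolutely_continuous (restrict_space \<nu>1 A) (restrict_space \<nu>2 A)"
    "absolutely_continuous (restrict_space \<nu>2 A) (restrict_space \<nu>1 A)"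
proof -
  note p1 = prob_algebraD[OF \<nu>(1)] and p2 = prob_algebraD[OF \<nu>(2)]
  obtain \<rho> and f g :: "'a \<Rightarrow> real" where fin: "finite_measure \<rho>" and sets: "sets \<rho> = sets M"
    and [measurable]: "f \<in> borel_measurable M" "g \<in> borel_measurable M"
    and nn: "\<And>x. 0 \<le> f x" "\<And>x. 0 \<le> g x"
    and d: "\<nu>1 = density \<rho> (\<lambda>x. ennreal (f x))" "\<nu>2 = density \<rho> (\<lambda>x. ennreal (g x))"
    using common_density[OF p1(4) p2(4) p1(2) p2(2)] by metis
  note [measurable_cong] = sets
  have sp: "space \<rho> = space M" using sets by (rule sets_eq_imp_space_eq)
  define A where "A = {x\<in>space M. f x > 0 \<and> g x > 0}"
  have A[measurable]: "A \<in> sets M" unfolding A_def by measurable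
  have large: "measure \<nu>1 A \<ge> 1 - \<epsilon>"
    if \<nu>: "\<nu>1 \<in> space (prob_algebra M)" "\<nu>2 \<in> space (prob_algebra M)"
    and tv: "tv_dist M \<nu>1 \<nu>2 \<le> \<epsilon>" and [measurable]: "f \<in> borel_measurable M" "g \<in> borel_measurable M"
    and nn: "\<And>x. 0 \<le> f x" "\<And>x. 0 \<le> g x"
    and d: "\<nu>1 = density \<rho> (\<lambda>x. ennreal (f x))" "\<nu>2 = density \<rho> (\<lambda>x. ennreal (g x))"
    and A: "A = {x\<in>space M. f x > 0 \<and> g x > 0}" for \<nu>1 \<nu>2 f g
  proof -
    note p1 = prob_algebraD[OF \<nu>(1)] and p2 = prob_algebraD[OF \<nu>(2)]
    interpret N1: prob_space \<nu>1 by (rule p1)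
    define B where "B = {x\<in>space M. g x = 0}"
    define B' where "B' = {x\<in>space M. f x = 0}"
    have [measurable]: "B \<in> sets M" "B' \<in> sets M" unfolding B_def B'_def by measurable
    have 0: "emeasure \<nu>2 B = 0" "emeasure \<nu>1 B' = 0"
      unfolding d by (auto simp: emeasure_density B_def B'_def intro!: nn_integral_zero' AE_I2 split: split_indicator)
    have "\<bar>measure \<nu>1 B - measure \<nu>2 B\<bar> \<le> \<epsilon>"
      using tv_dist_upper[OF \<nu>, of B] tv by simp
    moreover have "measure \<nu>2 B = 0" using 0(1) by (simp only: measure_def enn2real_0)
    ultimately have "measure \<nu>1 B \<le> \<epsilon>" by linarith
    have "measure \<nu>1 (space M - A) \<le> measure \<nu>1 (B \<union> B')"
      using nn p1 by (intro N1.finite_measure_mono) (auto simp: A B_def B'_def less_le)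
    also have "\<dots> \<le> measure \<nu>1 B + measure \<nu>1 B'" using p1 by (intro measure_Un_le) auto
    also have "measure \<nu>1 B' = 0" using 0(2) by (simp only: measure_def enn2real_0)
    also have "measure \<nu>1 (space M - A) = 1 - measure \<nu>1 A"
      using N1.prob_compl[of A] p1 \<open>A \<in> sets M\<close> by simp
    finally show ?thesis using \<open>measure \<nu>1 B \<le> \<epsilon>\<close> by simp
  qed
  have ac: "absolutely_continuous (restrict_space (density \<rho> (\<lambda>x. ennreal (f x))) A) (restrict_space (density \<rho> (\<lambda>x. ennreal (g x))) A)"
    if [measurable]: "f \<in> borel_measurable M" "g \<in> borel_measurable M"
    and A: "A = {x\<in>space M. f x > 0 \<and> g x > 0}" for f g :: "'a \<Rightarrow> real"
    unfolding absolutely_continuous_def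
  proof
    fix B assume B: "B \<in> null_sets (restrict_space (density \<rho> (\<lambda>x. ennreal (f x))) A)"
    have A': "A \<in> sets M" by fact
    have BA: "B \<subseteq> A" "B \<in> sets M"
      using B A' sets null_sets_restrict_space[of A "density \<rho> (\<lambda>x. ennreal (f x))" B] by (auto dest: null_setsD2)
    note [measurable] = BA(2)
    have "emeasure (density \<rho> (\<lambda>x. ennreal (f x))) B = 0"
      using B BA A' sets by (subst (asm) null_sets_restrict_space) auto
    then have "AE x in \<rho>. ennreal (f x) * indicator B x = 0"
      by (auto simp: emeasure_density nn_integral_0_iff_AE)
    then have "AE x in \<rho>. x \<notin> B"
      by eventually_elim (use BA in \<open>auto simp: A split: split_indicator_asm\<close>)
    then have "AE x in \<rho>. ennreal (g x) * indicator B x = 0" by eventually_elim auto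
    then have "emeasure (density \<rho> (\<lambda>x. ennreal (g x))) B = 0"
      by (subst emeasure_density) (auto simp: nn_integral_0_iff_AE)
    then show "B \<in> null_sets (restrict_space (density \<rho> (\<lambda>x. ennreal (g x))) A)"
      using BA A' sets by (subst null_sets_restrict_space) auto
  qed
  show ?thesis
  proof (rule that[OF A])
    show "measure \<nu>1 A \<ge> 1 - \<epsilon>" by (rule large[OF \<nu> tv _ _ nn d A_def]) auto
    show "measure \<nu>2 A \<ge> 1 - \<epsilon>"
      using tv by (intro large[OF \<nu>(2,1) _ _ _ nn(2,1) d(2,1)]) (auto simp: A_def tv_dist_commute)
    show "absolutely_continuous (restrict_space \<nu>1 A) (restrict_space \<nu>2 A)"
      unfolding d by (rule ac) (auto simp: A_def)
    show "absolutely_continuous (restrict_space \<nu>2 A) (restrict_space \<nu>1 A)"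
      unfolding d by (rule ac) (auto simp: A_def)
  qed
qed

text \<open>A separating set \<open>B\<close> would cut \<open>A\<close> into
  \<open>A \<inter> B\<close>, null for the first measure and hence for the second, and
  \<open>A - B\<close>, null for the second.\<close>

lemma equivalent_set_non_singular:
  assumes \<nu>: "\<nu>1 \<in> space (prob_algebra M)" "\<nu>2 \<in> space (prob_algebra M)" and A: "A \<in> sets M"
    and m: "measure \<nu>1 A > 0" "measure \<nu>2 A > 0"
    and ac: "absolutely_continuous (restrict_space \<nu>1 A) (restrict_space \<nu>2 A)"
  shows "non_singular M \<nu>1 \<nu>2"
  unfolding non_singular_def
proof safe
  note p1 = prob_algebraD[OF \<nu>(1)] and p2 = prob_algebraD[OF \<nu>(2)]
  fix B assume B: "B \<in> sets M" "emeasure \<nu>1 B = 0" "emeasure \<nu>2 (space M - B) = 0"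
  have "A \<inter> B \<in> null_sets (restrict_space \<nu>1 A)"
    using A B p1 null_sets_subset[of B \<nu>1 "A \<inter> B"] by (subst null_sets_restrict_space) (auto simp: null_sets_def)
  then have "A \<inter> B \<in> null_sets (restrict_space \<nu>2 A)" using ac by (auto simp: absolutely_continuous_def)
  then have "A \<inter> B \<in> null_sets \<nu>2" using A p2 by (subst (asm) null_sets_restrict_space) auto
  moreover have "A - B \<in> null_sets \<nu>2"
    using A B p2 sets.sets_into_space[OF A] null_sets_subset[of "space M - B" \<nu>2 "A - B"] by (auto simp: null_sets_def)
  ultimately have "A \<inter> B \<union> (A - B) \<in> null_sets \<nu>2" by (rule null_sets.Un)
  then have "emeasure \<nu>2 A = 0" by (simp add: Int_Diff_Un null_sets_def)
  then show False using m by (simp add: measure_def)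
qed

subsection \<open>Markov kernels and path laws\<close>

abbreviation path_space :: "'a measure \<Rightarrow> (nat \<Rightarrow> 'a) measure" where
  "path_space M \<equiv> PiM UNIV (\<lambda>_. M)"

lemma space_path_space: "space (path_space M) = {\<omega>. \<forall>i. \<omega> i \<in> space M}"
  by (auto simp: space_PiM PiE_iff)

lemma path_component_measurable: "(\<lambda>\<omega>. \<omega> n) \<in> path_space M \<rightarrow>\<^sub>M M"
  by (rule measurable_component_singleton) simp

lemma shift_measurable: "(\<lambda>\<omega> i. \<omega> (i + n)) \<in> path_space M \<rightarrow>\<^sub>M path_space M"
  by (rule measurable_PiM_single') (auto simp: space_PiM PiE_iff)

text \<open>Conditions on an initial segment of times suit a recursion on its length. Other finite
  sets of times reduce to this form by imposing the whole space in the gaps.\<close>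

definition cylinder :: "'a measure \<Rightarrow> nat \<Rightarrow> (nat \<Rightarrow> 'a set) \<Rightarrow> (nat \<Rightarrow> 'a) set" where
  "cylinder M n A = {\<omega> \<in> space (path_space M). \<forall>i\<le>n. \<omega> i \<in> A i}"

lemma prod_emb_cylinder:
  assumes "finite J" "\<And>i. i \<in> J \<Longrightarrow> E i \<in> sets M"
  obtains n A where "prod_emb UNIV (\<lambda>_. M) J (Pi\<^sub>E J E) = cylinder M n A" "\<And>i. A i \<in> sets M"
proof
  define A where "A i = (if i \<in> J then E i else space M)" for i
  show "A i \<in> sets M" for i using assms by (auto simp: A_def)
  show "prod_emb UNIV (\<lambda>_. M) J (Pi\<^sub>E J E) = cylinder M (Max (insert 0 J)) A"
  proof (intro set_eqI iffI)
    fix \<omega> assume "\<omega> \<in> prod_emb UNIV (\<lambda>_. M) J (Pi\<^sub>E J E)"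
    then have "\<forall>i. \<omega> i \<in> space M" "\<forall>i\<in>J. \<omega> i \<in> E i" by (auto simp: prod_emb_iff PiE_iff)
    then show "\<omega> \<in> cylinder M (Max (insert 0 J)) A" by (simp add: cylinder_def space_path_space A_def)
  next
    fix \<omega> assume *: "\<omega> \<in> cylinder M (Max (insert 0 J)) A"
    have "\<omega> i \<in> E i" if "i \<in> J" for i
    proof -
      have "i \<le> Max (insert 0 J)" using that assms(1) by (intro Max_ge) auto
      then have "\<omega> i \<in> A i" using * unfolding cylinder_def by blast
      then show ?thesis using that by (simp add: A_def)
    qed
    moreover have "\<forall>i. \<omega> i \<in> space M" using * by (simp add: cylinder_def space_path_space)
    ultimately show "\<omega> \<in> prod_emb UNIV (\<lambda>_. M) J (Pi\<^sub>E J E)"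
      by (simp add: prod_emb_iff PiE_iff)
  qed
qed

lemma cylinder_sets[measurable]:
  assumes "\<And>i. A i \<in> sets M" shows "cylinder M n A \<in> sets (path_space M)"
proof -
  note [measurable] = assms
  show ?thesis unfolding cylinder_def by measurable
qed

lemma measure_eqI_cylinder:
  assumes "sets \<mu> = sets (path_space M)" "sets \<nu> = sets (path_space M)" "finite_measure \<mu>"
    and "\<And>n A. (\<And>i. A i \<in> sets M) \<Longrightarrow> emeasure \<mu> (cylinder M n A) = emeasure \<nu> (cylinder M n A)"
  shows "\<mu> = \<nu>"
proof (rule measure_eqI_PiM_infinite[OF assms(1,2) _ assms(3)])
  fix A and J :: "nat set" assume "finite J" "J \<subseteq> UNIV" "\<And>i. i \<in> J \<Longrightarrow> A i \<in> sets M"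
  then show "emeasure \<mu> (prod_emb UNIV (\<lambda>_. M) J (Pi\<^sub>E J A)) = emeasure \<nu> (prod_emb UNIV (\<lambda>_. M) J (Pi\<^sub>E J A))"
    using assms(4) prod_emb_cylinder[of J A M] by metis
qed

lemma measurable_prob_algebra_path_space:
  fixes M :: "'b measure"
  assumes prob: "\<And>x. x \<in> space N \<Longrightarrow> prob_space (K x)"
    and sets: "\<And>x. x \<in> space N \<Longrightarrow> sets (K x) = sets (path_space M)"
    and meas: "\<And>n A. (\<And>i. A i \<in> sets M) \<Longrightarrow> (\<lambda>x. emeasure (K x) (cylinder M n A)) \<in> borel_measurable N"
  shows "K \<in> N \<rightarrow>\<^sub>M prob_algebra (path_space M)"
proof (rule measurable_prob_algebra_generated[OF sets_PiM Int_stable_prod_algebra prod_algebra_sets_into_space prob sets])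
  fix X :: "(nat \<Rightarrow> 'b) set" assume "X \<in> prod_algebra UNIV (\<lambda>_. M)"
  then obtain J :: "nat set" and E where "X = prod_emb UNIV (\<lambda>_. M) J (\<Pi>\<^sub>E j\<in>J. E j)" "finite J" "\<And>j. j \<in> J \<Longrightarrow> E j \<in> sets M"
    by (rule prod_algebraE) auto
  then show "(\<lambda>a. emeasure (K a) X) \<in> borel_measurable N"
    using meas by (metis prod_emb_cylinder)
qed auto

text \<open>For the chain started at \<open>x\<close>, this is the mean of h(X_n) on the event that
  X_i lies in \<open>A i\<close> for all i up to n, expanded along the first step. The parameter
  \<open>h\<close> makes an expansion along the last step possible as well.\<close>

primrec cylinder_integral ::
  "('a \<Rightarrow> 'a measure) \<Rightarrow> nat \<Rightarrow> (nat \<Rightarrow> 'a set) \<Rightarrow> ('a \<Rightarrow> ennreal) \<Rightarrow> 'a \<Rightarrow> ennreal" where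
  "cylinder_integral P 0 A h x = indicator (A 0) x * h x"
| "cylinder_integral P (Suc n) A h x = indicator (A 0) x * (\<integral>\<^sup>+z. cylinder_integral P n (\<lambda>i. A (Suc i)) h z \<partial>P x)"

text \<open>The recursive definition peels off the first time, while the Ionescu-Tulcea measures
  grow at the last one; this identity reconciles the two.\<close>

lemma cylinder_integral_step:
  "cylinder_integral P n A (\<lambda>w. \<integral>\<^sup>+z. indicator (A (Suc n)) z * h z \<partial>P w) x = cylinder_integral P (Suc n) A h x"
proof (induction n arbitrary: A x)
  case (Suc n)
  then show ?case using Suc.IH[of "\<lambda>i. A (Suc i)"] by (simp only: cylinder_integral.simps)
qed simp

section \<open>The law of the chain and its Markov property\<close>

locale markov_kernel =
  fixes M :: "'a measure" and P :: "'a \<Rightarrow> 'a measure"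
  assumes P[measurable]: "P \<in> M \<rightarrow>\<^sub>M prob_algebra M"
begin

lemma P_in: "x \<in> space M \<Longrightarrow> P x \<in> space (prob_algebra M)"
  using P by (rule measurable_space)

lemma nstep_measurable[measurable]: "nstep M P n \<in> M \<rightarrow>\<^sub>M prob_algebra M"
proof (induction n)
  case 0
  have "nstep M P 0 = return M" by (rule ext) simp
  then show ?case using measurable_return_prob_space by metis
next
  case (Suc n)
  have "nstep M P (Suc n) = (\<lambda>x. nstep M P n x \<bind> P)" by (rule ext) simp
  then show ?case using measurable_bind_prob_space[OF Suc P] by (simp only:)
qed

lemma P_subprob: "P \<in> M \<rightarrow>\<^sub>M subprob_algebra M"
  using P by (rule measurable_prob_algebraD)

lemma nstep_subprob: "nstep M P n \<in> M \<rightarrow>\<^sub>M subprob_algebra M"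
  using nstep_measurable by (rule measurable_prob_algebraD)

lemma nstep_in: "x \<in> space M \<Longrightarrow> nstep M P n x \<in> space (prob_algebra M)"
  using nstep_measurable by (rule measurable_space)

lemma nstep_add:
  assumes x: "x \<in> space M"
  shows "nstep M P (m + n) x = nstep M P m x \<bind> nstep M P n"
proof (induction n)
  case 0
  have "nstep M P 0 = return M" by (rule ext) simp
  then show ?case using bind_return''[OF prob_algebraD(2)[OF nstep_in[OF x]]] by simp
next
  case (Suc n)
  have "nstep M P (m + Suc n) x = (nstep M P m x \<bind> nstep M P n) \<bind> P" using Suc by simp
  also have "\<dots> = nstep M P m x \<bind> (\<lambda>y. nstep M P n y \<bind> P)"
    by (rule bind_assoc[OF _ P_subprob]) 
      (simp add: measurable_cong_sets[OF prob_algebraD(2)[OF nstep_in[OF x]] refl] nstep_subprob)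
  finally show ?case by simp
qed

lemma nstep_1: assumes "x \<in> space M" shows "nstep M P (Suc 0) x = P x"
  using bind_return[OF P_subprob assms] by simp

lemma cylinder_integral_measurable[measurable (raw)]:
  assumes "\<And>i. A i \<in> sets M" "h \<in> borel_measurable M"
  shows "cylinder_integral P n A h \<in> borel_measurable M"
  using assms
proof (induction n arbitrary: A)
  case 0
  then show ?case unfolding cylinder_integral.simps by measurable
next
  case (Suc n)
  note [measurable] = Suc.prems
  have [measurable]: "cylinder_integral P n (\<lambda>i. A (Suc i)) h \<in> borel_measurable M"
    using Suc by auto
  have "(\<lambda>x. \<integral>\<^sup>+z. cylinder_integral P n (\<lambda>i. A (Suc i)) h z \<partial>P x) \<in> borel_measurable M"
    by (rule measurable_compose[OF P_subprob nn_integral_measurable_subprob_algebra]) measurable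
  then show ?case using Suc.prems(1)[of 0] unfolding cylinder_integral.simps by measurable
qed

lemma chain_law_prob: "x \<in> space M \<Longrightarrow> chain_law M P x \<in> space (prob_algebra (path_space M))"
proof -
  assume x: "x \<in> space M"
  interpret IT: Ionescu_Tulcea "chain_step M P x" "\<lambda>_. M" using P x by (rule Ionescu_Tulcea_chain)
  show "chain_law M P x \<in> space (prob_algebra (path_space M))"
    unfolding chain_law_def space_prob_algebra
  proof (intro CollectI conjI IT.PF.sets_lim)
    have "prob_space (distr IT.PF.lim (PiM {} (\<lambda>_. M)) (\<lambda>\<omega>. restrict \<omega> {}))"
      using IT.distr_lim[of "{}"] IT.PF.prob_space_P[of "{}"] by simp
    then show "prob_space IT.PF.lim"
      by (rule prob_space_distrD[rotated]) (simp add: measurable_cong_sets[OF IT.PF.sets_lim refl] measurable_restrict)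
  qed
qed

lemma emeasure_chain_law_cylinder:
  assumes x: "x \<in> space M" and A[measurable]: "\<And>i. A i \<in> sets M"
  shows "emeasure (chain_law M P x) (cylinder M n A) = cylinder_integral P n A (\<lambda>_. 1) x"
proof -
  interpret IT: Ionescu_Tulcea "chain_step M P x" "\<lambda>_. M" using P x by (rule Ionescu_Tulcea_chain)
  have [measurable]: "P \<in> M \<rightarrow>\<^sub>M subprob_algebra M" using P by (rule measurable_prob_algebraD)
  \<comment> \<open>The claim is made for every \<open>h\<close> so that in the induction the newest
    coordinate can be integrated out and absorbed into the function of the previous one.\<close>
  have C: "(\<integral>\<^sup>+\<omega>. (\<Prod>i\<le>n. indicator (A i) (\<omega> i)) * h (\<omega> n) \<partial>IT.C 0 (Suc n) (\<lambda>_. undefined))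
      = cylinder_integral P n A h x" if [measurable]: "h \<in> borel_measurable M" for n h
    using that
  proof (induction n arbitrary: h)
    case 0
    note [measurable] = 0
    have u: "(\<lambda>_. undefined) \<in> space (PiM {0..<0::nat} (\<lambda>_. M))" by (simp add: space_PiM)
    have "IT.C 0 (Suc 0) (\<lambda>_. undefined) = IT.eP 0 (\<lambda>_. undefined)"
      using bind_return[OF IT.measurable_eP u] by simp
    then show ?case
      using u x by (simp only:) (simp add: IT.nn_integral_eP chain_step_def nn_integral_return del: IT.C.simps)
  next
    case (Suc n)
    note [measurable] = Suc.prems
    have u: "(\<lambda>_. undefined) \<in> space (PiM {0..<0::nat} (\<lambda>_. M))" by (simp add: space_PiM)
    have [measurable]: "(\<lambda>w. \<integral>\<^sup>+z. indicator (A (Suc n)) z * h z \<partial>P w) \<in> borel_measurable M" by simp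
    have spC: "space (IT.C 0 (Suc n) (\<lambda>_. undefined)) = space (PiM {0..<Suc n} (\<lambda>_. M))"
      using IT.space_C[OF u, of "Suc n"] by simp
    have fm: "(\<lambda>\<omega>. (\<Prod>i\<le>Suc n. indicator (A i) (\<omega> i)) * h (\<omega> (Suc n))) \<in> borel_measurable (PiM {0..<Suc (Suc n)} (\<lambda>_. M))"
      by (intro borel_measurable_times_ennreal borel_measurable_prod_ennreal measurable_compose[OF measurable_component_singleton] borel_measurable_indicator A Suc.prems) auto
    have "(\<integral>\<^sup>+\<omega>. (\<Prod>i\<le>Suc n. indicator (A i) (\<omega> i)) * h (\<omega> (Suc n)) \<partial>IT.C 0 (Suc (Suc n)) (\<lambda>_. undefined))
      = (\<integral>\<^sup>+\<omega>. \<integral>\<^sup>+\<omega>'. (\<Prod>i\<le>Suc n. indicator (A i) (\<omega>' i)) * h (\<omega>' (Suc n)) \<partial>IT.eP (Suc n) \<omega> \<partial>IT.C 0 (Suc n) (\<lambda>_. undefined))"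
      unfolding IT.C.simps(2)[of 0 "Suc n"] add_0
    proof (rule nn_integral_bind[where B="PiM {0..<Suc (Suc n)} (\<lambda>_. M)"])
      show "IT.eP (Suc n) \<in> IT.C 0 (Suc n) (\<lambda>_. undefined) \<rightarrow>\<^sub>M subprob_algebra (PiM {0..<Suc (Suc n)} (\<lambda>_. M))"
        using IT.measurable_eP[of "Suc n"] measurable_cong_sets[OF IT.sets_C[OF u, of "Suc n"] refl]
        unfolding add_0 by blast
    qed (rule fm)
    also have "\<dots> = (\<integral>\<^sup>+\<omega>. (\<Prod>i\<le>n. indicator (A i) (\<omega> i)) * (\<integral>\<^sup>+z. indicator (A (Suc n)) z * h z \<partial>P (\<omega> n)) \<partial>IT.C 0 (Suc n) (\<lambda>_. undefined))"
    proof (intro nn_integral_cong)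
      fix \<omega> assume "\<omega> \<in> space (IT.C 0 (Suc n) (\<lambda>_. undefined))"
      then have w: "\<omega> \<in> space (PiM {0..<Suc n} (\<lambda>_. M))" using spC by simp
      then have wn: "\<omega> n \<in> space M" by (auto simp: space_PiM PiE_iff)
      have "(\<lambda>z. indicator (A (Suc n)) z * h z) \<in> borel_measurable M" by measurable
      then have m: "(\<lambda>z. indicator (A (Suc n)) z * h z) \<in> borel_measurable (P (\<omega> n))"
        using measurable_cong_sets[OF prob_algebraD(2)[OF P_in[OF wn]] refl] by blast
      have "(\<integral>\<^sup>+\<omega>'. (\<Prod>i\<le>Suc n. indicator (A i) (\<omega>' i)) * h (\<omega>' (Suc n)) \<partial>IT.eP (Suc n) \<omega>)
        = (\<integral>\<^sup>+z. (\<Prod>i\<le>Suc n. indicator (A i) ((fun_upd \<omega> (Suc n) z) i)) * h ((fun_upd \<omega> (Suc n) z) (Suc n)) \<partial>P (\<omega> n))"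
        using w by (subst IT.nn_integral_eP[OF w fm]) (simp add: chain_step_def)
      also have "\<dots> = (\<integral>\<^sup>+z. (\<Prod>i\<le>n. indicator (A i) (\<omega> i)) * (indicator (A (Suc n)) z * h z) \<partial>P (\<omega> n))"
        by (intro nn_integral_cong) (auto simp: mult.assoc intro!: arg_cong2[where f="(*)"] prod.cong)
      finally show "(\<integral>\<^sup>+\<omega>'. (\<Prod>i\<le>Suc n. indicator (A i) (\<omega>' i)) * h (\<omega>' (Suc n)) \<partial>IT.eP (Suc n) \<omega>)
        = (\<Prod>i\<le>n. indicator (A i) (\<omega> i)) * (\<integral>\<^sup>+z. indicator (A (Suc n)) z * h z \<partial>P (\<omega> n))"
        by (simp only: nn_integral_cmult[OF m])
    qed
    also have "\<dots> = cylinder_integral P (Suc n) A h x"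
      using Suc.IH[of "\<lambda>w. \<integral>\<^sup>+z. indicator (A (Suc n)) z * h z \<partial>P w"] by (simp only: cylinder_integral_step) simp
    finally show ?case .
  qed
  have u: "(\<lambda>_. undefined) \<in> space (PiM {0..<0::nat} (\<lambda>_. M))" by (simp add: space_PiM)
  define X where "X = Pi\<^sub>E {0..<Suc n} A"
  have X[measurable]: "X \<in> sets (PiM {0..<Suc n} (\<lambda>_. M))" unfolding X_def by (intro sets_PiM_I_finite) auto
  have "cylinder M n A = prod_emb UNIV (\<lambda>_. M) {0..<Suc n} X"
    by (auto simp: cylinder_def prod_emb_def X_def space_path_space PiE_iff less_Suc_eq_le)
  then have "emeasure (chain_law M P x) (cylinder M n A) = emeasure (IT.CI {0..<Suc n}) X"
    unfolding chain_law_def using IT.lim[of "{0..<Suc n}" X] X by simp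
  also have "\<dots> = emeasure (IT.C 0 (Suc n) (\<lambda>_. undefined)) X"
    using IT.emeasure_CI[of "{0..<Suc n}" "Suc n" X] X sets.sets_into_space[OF X]
    by (simp add: prod_emb_id space_PiM del: IT.C.simps)
  also have "\<dots> = (\<integral>\<^sup>+\<omega>. indicator X \<omega> \<partial>IT.C 0 (Suc n) (\<lambda>_. undefined))"
    using IT.sets_C[OF u, of "Suc n"] X by (subst nn_integral_indicator) (auto simp del: IT.C.simps)
  also have "\<dots> = (\<integral>\<^sup>+\<omega>. (\<Prod>i\<le>n. indicator (A i) (\<omega> i)) * 1 \<partial>IT.C 0 (Suc n) (\<lambda>_. undefined))"
  proof (intro nn_integral_cong)
    fix \<omega> assume "\<omega> \<in> space (IT.C 0 (Suc n) (\<lambda>_. undefined))"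
    then have "\<omega> \<in> space (PiM {0..<Suc n} (\<lambda>_. M))" using IT.space_C[OF u, of "Suc n"] by simp
    then have X: "\<omega> \<in> X \<longleftrightarrow> (\<forall>i\<le>n. \<omega> i \<in> A i)"
      by (auto simp: X_def space_PiM PiE_iff less_Suc_eq_le)
    show "indicator X \<omega> = (\<Prod>i\<le>n. indicator (A i) (\<omega> i)) * (1::ennreal)"
    proof (cases "\<omega> \<in> X")
      case False
      then obtain i where "i \<le> n" "\<omega> i \<notin> A i" using X by blast
      then have "(\<Prod>i\<le>n. indicator (A i) (\<omega> i)) = (0::ennreal)"
        by (intro prod_zero) (auto intro!: bexI[of _ i])
      then show ?thesis using False by simp
    qed (use X in simp)
  qed
  also have "\<dots> = cylinder_integral P n A (\<lambda>_. 1) x" by (rule C) simp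
  finally show ?thesis .
qed

lemma chain_law_measurable[measurable]: "chain_law M P \<in> M \<rightarrow>\<^sub>M prob_algebra (path_space M)"
proof (rule measurable_prob_algebra_path_space)
  fix x assume "x \<in> space M"
  from prob_algebraD[OF chain_law_prob[OF this]]
  show "prob_space (chain_law M P x)" "sets (chain_law M P x) = sets (path_space M)" by auto
next
  fix n and A :: "nat \<Rightarrow> 'a set" assume [measurable]: "\<And>i. A i \<in> sets M"
  show "(\<lambda>x. emeasure (chain_law M P x) (cylinder M n A)) \<in> borel_measurable M"
    by (subst measurable_cong[OF emeasure_chain_law_cylinder]) (simp_all add: cylinder_integral_measurable)
qed

lemma chain_law_shift_1:
  assumes x: "x \<in> space M"
  shows "distr (chain_law M P x) (path_space M) (\<lambda>\<omega> i. \<omega> (Suc i)) = P x \<bind> chain_law M P"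
proof (rule measure_eqI_cylinder)
  note p = prob_algebraD[OF chain_law_prob[OF x]]
  interpret prob_space "chain_law M P x" by (rule p)
  note [measurable_cong] = p(2)
  have m[measurable]: "(\<lambda>\<omega> i. \<omega> (Suc i)) \<in> path_space M \<rightarrow>\<^sub>M path_space M"
    using shift_measurable[of 1 M] by simp
  show "sets (distr (chain_law M P x) (path_space M) (\<lambda>\<omega> i. \<omega> (Suc i))) = sets (path_space M)" by simp
  show "sets (P x \<bind> chain_law M P) = sets (path_space M)"
    using sets_bind'[OF P_in[OF x] chain_law_measurable] .
  show "finite_measure (distr (chain_law M P x) (path_space M) (\<lambda>\<omega> i. \<omega> (Suc i)))"
    by (rule finite_measure_distr) measurable
  fix n and A :: "nat \<Rightarrow> 'a set" assume A[measurable]: "\<And>i. A i \<in> sets M"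
  \<comment> \<open>Time 0 gets no condition, so that a cylinder for the shifted path is again a
    cylinder for the path.\<close>
  define B where "B = case_nat (space M) A"
  have B: "B i \<in> sets M" for i unfolding B_def by (auto split: nat.split)
  have "(\<lambda>\<omega> i. \<omega> (Suc i)) -` cylinder M n A \<inter> space (chain_law M P x) = cylinder M (Suc n) B"
    unfolding p(3)
  proof (intro set_eqI iffI)
    fix \<omega> assume "\<omega> \<in> (\<lambda>\<omega> i. \<omega> (Suc i)) -` cylinder M n A \<inter> space (path_space M)"
    then show "\<omega> \<in> cylinder M (Suc n) B"
      by (auto simp: cylinder_def space_path_space B_def split: nat.split)
  next
    fix \<omega> assume *: "\<omega> \<in> cylinder M (Suc n) B"
    have "\<omega> (Suc i) \<in> A i" if "i \<le> n" for i
      using * that by (auto simp: cylinder_def B_def dest!: spec[of _ "Suc i"])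
    then show "\<omega> \<in> (\<lambda>\<omega> i. \<omega> (Suc i)) -` cylinder M n A \<inter> space (path_space M)"
      using * by (auto simp: cylinder_def space_path_space)
  qed
  then have "emeasure (distr (chain_law M P x) (path_space M) (\<lambda>\<omega> i. \<omega> (Suc i))) (cylinder M n A)
      = emeasure (chain_law M P x) (cylinder M (Suc n) B)"
    by (subst emeasure_distr) auto
  also have "\<dots> = cylinder_integral P (Suc n) B (\<lambda>_. 1) x" using x B by (rule emeasure_chain_law_cylinder)
  also have "\<dots> = (\<integral>\<^sup>+z. cylinder_integral P n A (\<lambda>_. 1) z \<partial>P x)" using x by (simp add: B_def)
  also have "\<dots> = (\<integral>\<^sup>+z. emeasure (chain_law M P z) (cylinder M n A) \<partial>P x)"
    using prob_algebraD(3)[OF P_in[OF x]] by (intro nn_integral_cong) (simp add: emeasure_chain_law_cylinder A)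
  also have "\<dots> = emeasure (P x \<bind> chain_law M P) (cylinder M n A)"
    using P_in[OF x] by (subst emeasure_bind_prob_algebra[OF _ chain_law_measurable]) auto
  finally show "emeasure (distr (chain_law M P x) (path_space M) (\<lambda>\<omega> i. \<omega> (Suc i))) (cylinder M n A)
    = emeasure (P x \<bind> chain_law M P) (cylinder M n A)" .
qed

text \<open>The Markov property at time \<open>n\<close>. It exhibits the shifted path laws as
  images of the n-step laws under one kernel, so that their distance is controlled by that of the
  n-step laws.\<close>

lemma chain_law_shift:
  assumes x: "x \<in> space M"
  shows "distr (chain_law M P x) (path_space M) (\<lambda>\<omega> i. \<omega> (i + n)) = nstep M P n x \<bind> chain_law M P"
proof (induction n)
  case 0
  note p = prob_algebraD[OF chain_law_prob[OF x]]
  have "distr (chain_law M P x) (path_space M) (\<lambda>\<omega>. \<omega>) = chain_law M P x"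
    using p by (intro distr_id2) auto
  then show ?case using x by (simp add: bind_return[OF measurable_prob_algebraD[OF chain_law_measurable]])
next
  case (Suc n)
  note p = prob_algebraD[OF chain_law_prob[OF x]]
  note q = prob_algebraD[OF nstep_in[OF x, of n]]
  have m[measurable]: "(\<lambda>\<omega> i. \<omega> (Suc i)) \<in> path_space M \<rightarrow>\<^sub>M path_space M"
    using shift_measurable[of 1 M] by simp
  have "distr (chain_law M P x) (path_space M) (\<lambda>\<omega> i. \<omega> (i + Suc n))
      = distr (distr (chain_law M P x) (path_space M) (\<lambda>\<omega> i. \<omega> (i + n))) (path_space M) (\<lambda>\<omega> i. \<omega> (Suc i))"
    by (subst distr_distr) (auto simp: measurable_cong_sets[OF p(2) refl] comp_def shift_measurable)
  also have "\<dots> = distr (nstep M P n x \<bind> chain_law M P) (path_space M) (\<lambda>\<omega> i. \<omega> (Suc i))" by (simp add: Suc)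
  also have "\<dots> = nstep M P n x \<bind> (\<lambda>y. distr (chain_law M P y) (path_space M) (\<lambda>\<omega> i. \<omega> (Suc i)))"
    using prob_space.not_empty[OF q(1)] measurable_prob_algebraD[OF chain_law_measurable]
      measurable_cong_sets[OF q(2) refl]
    by (intro distr_bind[where K="path_space M"] m) blast+
  also have "\<dots> = nstep M P n x \<bind> (\<lambda>y. P y \<bind> chain_law M P)"
    using q by (intro bind_cong) (auto simp: chain_law_shift_1)
  also have "\<dots> = (nstep M P n x \<bind> P) \<bind> chain_law M P"
    using P_subprob measurable_prob_algebraD[OF chain_law_measurable] measurable_cong_sets[OF q(2) refl]
    by (intro bind_assoc[symmetric, of _ _ M _ "path_space M"]) blast+
  finally show ?case by simp
qed

text \<open>This translates path events, as they occur in weak irreducibility and in couplings of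
  paths, into statements about n-step laws.\<close>

lemma emeasure_chain_law_component:
  assumes x: "x \<in> space M" and A: "A \<in> sets M"
  shows "emeasure (chain_law M P x) {\<omega> \<in> space (path_space M). \<omega> n \<in> A} = emeasure (nstep M P n x) A"
proof -
  note p = prob_algebraD[OF chain_law_prob[OF x]]
  note [measurable] = A
  note [measurable_cong] = p(2)
  have cyl: "cylinder M 0 (\<lambda>_. A) = {\<omega> \<in> space (path_space M). \<omega> 0 \<in> A}" by (auto simp: cylinder_def)
  have 0: "emeasure (chain_law M P z) {\<omega> \<in> space (path_space M). \<omega> 0 \<in> A} = indicator A z" if "z \<in> space M" for z
    using emeasure_chain_law_cylinder[OF that, of "\<lambda>_. A" 0] A by (simp add: cyl)
  have "{\<omega> \<in> space (path_space M). \<omega> n \<in> A}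
      = (\<lambda>\<omega> i. \<omega> (i + n)) -` {\<omega> \<in> space (path_space M). \<omega> 0 \<in> A} \<inter> space (chain_law M P x)"
    by (auto simp: p(3) space_path_space)
  then have "emeasure (chain_law M P x) {\<omega> \<in> space (path_space M). \<omega> n \<in> A}
      = emeasure (distr (chain_law M P x) (path_space M) (\<lambda>\<omega> i. \<omega> (i + n))) {\<omega> \<in> space (path_space M). \<omega> 0 \<in> A}"
    by (subst emeasure_distr) (auto simp: measurable_cong_sets[OF p(2) refl] shift_measurable)
  also have "\<dots> = (\<integral>\<^sup>+z. emeasure (chain_law M P z) {\<omega> \<in> space (path_space M). \<omega> 0 \<in> A} \<partial>nstep M P n x)"
    unfolding chain_law_shift[OF x]
    using nstep_in[OF x] by (subst emeasure_bind_prob_algebra[OF _ chain_law_measurable]) auto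
  also have "\<dots> = (\<integral>\<^sup>+z. indicator A z \<partial>nstep M P n x)"
    using prob_algebraD[OF nstep_in[OF x, of n]] by (intro nn_integral_cong) (simp add: 0)
  also have "\<dots> = emeasure (nstep M P n x) A"
    using prob_algebraD[OF nstep_in[OF x, of n]] A by simp
  finally show ?thesis .
qed

end

subsection \<open>Convergence from non-singularity\<close>

lemma integral_bind_prob:
  fixes f :: "'a \<Rightarrow> real"
  assumes \<nu>: "\<nu> \<in> space (prob_algebra N)" and K: "K \<in> N \<rightarrow>\<^sub>M prob_algebra M"
    and f: "f \<in> borel_measurable M" and b: "\<And>x. x \<in> space M \<Longrightarrow> \<bar>f x\<bar> \<le> c"
  shows "(\<integral>x. f x \<partial>(\<nu> \<bind> K)) = (\<integral>x. \<integral>y. f y \<partial>K x \<partial>\<nu>)"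
proof (rule integral_bind[where K=M and B'=1, OF f b])
  note p = prob_algebraD[OF \<nu>]
  show "K \<in> \<nu> \<rightarrow>\<^sub>M subprob_algebra M"
    using measurable_prob_algebraD[OF K] measurable_cong_sets[OF p(2) refl] by blast
  show "finite_measure \<nu>" by (rule p)
  show "AE x in \<nu>. emeasure (K x) (space (K x)) \<le> ennreal 1"
    using prob_space.emeasure_space_1[OF prob_algebraD(1)[OF measurable_space[OF K]]] p(3)
    by (intro AE_I2) simp
qed

lemma measurable_integral_prob:
  fixes f :: "'a \<Rightarrow> real"
  assumes K: "K \<in> N \<rightarrow>\<^sub>M prob_algebra M" and f: "f \<in> borel_measurable M"
  shows "(\<lambda>x. \<integral>y. f y \<partial>K x) \<in> borel_measurable N"
  by (rule measurable_compose[OF measurable_prob_algebraD[OF K] integral_measurable_subprob_algebra[OF f]])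

lemma integral_prob_bounds:
  fixes f :: "'a \<Rightarrow> real"
  assumes \<nu>: "\<nu> \<in> space (prob_algebra M)" and f: "f \<in> borel_measurable M" 
    and b: "\<And>x. x \<in> space M \<Longrightarrow> 0 \<le> f x \<and> f x \<le> 1"
  shows "0 \<le> (\<integral>x. f x \<partial>\<nu>) \<and> (\<integral>x. f x \<partial>\<nu>) \<le> 1"
proof
  note p = prob_algebraD[OF \<nu>]
  interpret prob_space \<nu> by (rule p)
  show "0 \<le> (\<integral>x. f x \<partial>\<nu>)" using b p(3) by (intro integral_nonneg_AE AE_I2) auto
  show "(\<integral>x. f x \<partial>\<nu>) \<le> 1"
    using b p(3) by (intro integral_le_const integrable_prob_bounded[OF \<nu> f, of 1] AE_I2) auto
qed

lemma measure_bind_prob: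
  assumes \<nu>: "\<nu> \<in> space (prob_algebra N)" and K: "K \<in> N \<rightarrow>\<^sub>M prob_algebra M" and A: "A \<in> sets M"
  shows "measure (\<nu> \<bind> K) A = (\<integral>x. measure (K x) A \<partial>\<nu>)"
proof -
  note p = prob_algebraD[OF \<nu>]
  interpret prob_space \<nu> by (rule p)
  interpret subprob_space \<nu> by (rule prob_space_imp_subprob_space) (rule p)
  show ?thesis
    using measurable_prob_algebraD[OF K] measurable_cong_sets[OF p(2) refl] A by (intro measure_bind) blast+
qed

lemma measure_kernel_measurable:
  assumes K: "K \<in> N \<rightarrow>\<^sub>M prob_algebra M" and A: "A \<in> sets M"
  shows "(\<lambda>x. measure (K x) A) \<in> borel_measurable N"
  by (rule measurable_compose[OF K measurable_measure_prob_algebra[OF A]])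

lemma bind_in_prob_algebra:
  assumes "\<nu> \<in> space (prob_algebra N)" "K \<in> N \<rightarrow>\<^sub>M prob_algebra M"
  shows "\<nu> \<bind> K \<in> space (prob_algebra M)"
  using prob_space_bind'[OF assms] sets_bind'[OF assms] by (simp add: space_prob_algebra)

lemma measure_prob_bounds:
  assumes "\<nu> \<in> space (prob_algebra M)" shows "0 \<le> measure \<nu> A \<and> measure \<nu> A \<le> 1"
  using prob_space.prob_le_1[OF prob_algebraD(1)[OF assms]] by simp

text \<open>The probability of \<open>A\<close> under the kernel is a test function with values in
  [0, 1].\<close>

lemma tv_dist_bind_le:
  assumes \<nu>: "\<nu>1 \<in> space (prob_algebra N)" "\<nu>2 \<in> space (prob_algebra N)" and K: "K \<in> N \<rightarrow>\<^sub>M prob_algebra M"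
  shows "tv_dist M (\<nu>1 \<bind> K) (\<nu>2 \<bind> K) \<le> tv_dist N \<nu>1 \<nu>2"
proof (rule tv_dist_least)
  fix A assume A: "A \<in> sets M"
  show "\<bar>measure (\<nu>1 \<bind> K) A - measure (\<nu>2 \<bind> K) A\<bar> \<le> tv_dist N \<nu>1 \<nu>2"
    unfolding measure_bind_prob[OF \<nu>(1) K A] measure_bind_prob[OF \<nu>(2) K A]
    by (rule tv_dist_integral[OF \<nu> measure_kernel_measurable[OF K A]])
       (rule measure_prob_bounds[OF measurable_space[OF K]])
qed

lemma tv_dist_self: "tv_dist M \<nu> \<nu> = 0"
proof -
  have "(\<lambda>A. \<bar>measure \<nu> A - measure \<nu> A\<bar>) ` sets M = {0}" by auto
  then show ?thesis unfolding tv_dist_def by simp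
qed

lemma couplingsD:
  assumes "\<zeta> \<in> couplings \<nu>1 \<nu>2" "\<nu>1 \<in> space (prob_algebra M)" "\<nu>2 \<in> space (prob_algebra M)"
  shows "\<zeta> \<in> space (prob_algebra (M \<Otimes>\<^sub>M M))" "distr \<zeta> M fst = \<nu>1" "distr \<zeta> M snd = \<nu>2"
proof -
  note p = prob_algebraD[OF assms(2)] prob_algebraD[OF assms(3)]
  have "sets (\<nu>1 \<Otimes>\<^sub>M \<nu>2) = sets (M \<Otimes>\<^sub>M M)" using p by (intro sets_pair_measure_cong)
  then show "\<zeta> \<in> space (prob_algebra (M \<Otimes>\<^sub>M M))"
    using assms(1) by (simp add: couplings_def space_prob_algebra)
  show "distr \<zeta> M fst = \<nu>1" "distr \<zeta> M snd = \<nu>2"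
    using assms(1) distr_cong[OF refl p(2) refl, of \<zeta> fst] distr_cong[OF refl p(6) refl, of \<zeta> snd] by (auto simp: couplings_def)
qed

lemma couplingsI:
  assumes "\<zeta> \<in> space (prob_algebra (M \<Otimes>\<^sub>M M))" "distr \<zeta> M fst = \<nu>1" "distr \<zeta> M snd = \<nu>2"
  shows "\<zeta> \<in> couplings \<nu>1 \<nu>2"
proof -
  have s: "sets \<nu>1 = sets M" "sets \<nu>2 = sets M" using assms(2,3) by auto
  have "sets (\<nu>1 \<Otimes>\<^sub>M \<nu>2) = sets (M \<Otimes>\<^sub>M M)" using s by (intro sets_pair_measure_cong)
  then show ?thesis
    using assms distr_cong[OF refl s(1) refl, of \<zeta> fst] distr_cong[OF refl s(2) refl, of \<zeta> snd]
    by (auto simp: couplings_def space_prob_algebra)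
qed

lemma pair_measure_couplings:
  assumes \<nu>: "\<nu>1 \<in> space (prob_algebra M)" "\<nu>2 \<in> space (prob_algebra M)"
  shows "\<nu>1 \<Otimes>\<^sub>M \<nu>2 \<in> couplings \<nu>1 \<nu>2"
proof -
  note p1 = prob_algebraD[OF \<nu>(1)] and p2 = prob_algebraD[OF \<nu>(2)]
  interpret N1: prob_space \<nu>1 by (rule p1)
  interpret N2: prob_space \<nu>2 by (rule p2)
  interpret N12: pair_prob_space \<nu>1 \<nu>2 ..
  have "distr (\<nu>1 \<Otimes>\<^sub>M \<nu>2) \<nu>2 snd = \<nu>2"
  proof (rule measure_eqI)
    fix A assume "A \<in> sets (distr (\<nu>1 \<Otimes>\<^sub>M \<nu>2) \<nu>2 snd)"
    then have A: "A \<in> sets \<nu>2" by simp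
    have "snd -` A \<inter> space (\<nu>1 \<Otimes>\<^sub>M \<nu>2) = space \<nu>1 \<times> A"
      using sets.sets_into_space[OF A] by (auto simp: space_pair_measure)
    then show "emeasure (distr (\<nu>1 \<Otimes>\<^sub>M \<nu>2) \<nu>2 snd) A = emeasure \<nu>2 A"
      using A by (simp add: emeasure_distr N2.emeasure_pair_measure_Times N1.emeasure_space_1)
  qed simp
  moreover have "prob_space (\<nu>1 \<Otimes>\<^sub>M \<nu>2)" by (rule N12.prob_space_axioms)
  ultimately show ?thesis
    using N2.distr_pair_fst[of \<nu>1] by (simp add: couplings_def space_prob_algebra)
qed

text \<open>Both probabilities of \<open>A\<close> are integrals over the marginals of
  \<open>\<zeta>\<close>, so their difference is one integral over \<open>\<zeta>\<close> and the
  absolute value moves inside. The estimates on \<open>dist_lim\<close> come from three choices of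
  \<open>\<zeta>\<close>: the product, a coupling charging the diagonal, and a point mass paired
  with the invariant measure.\<close>

lemma tv_dist_bind_coupling:
  assumes \<nu>: "\<nu>1 \<in> space (prob_algebra N)" "\<nu>2 \<in> space (prob_algebra N)" and K: "K \<in> N \<rightarrow>\<^sub>M prob_algebra M"
    and cg: "countably_generated M" and z: "\<zeta> \<in> couplings \<nu>1 \<nu>2"
  shows "tv_dist M (\<nu>1 \<bind> K) (\<nu>2 \<bind> K) \<le> (\<integral>p. tv_dist M (K (fst p)) (K (snd p)) \<partial>\<zeta>)"
proof (rule tv_dist_least)
  fix A assume A: "A \<in> sets M"
  note zD = couplingsD[OF z \<nu>] and zp = prob_algebraD[OF couplingsD(1)[OF z \<nu>]]
  have f: "(\<lambda>x. measure (K x) A) \<in> borel_measurable N" by (rule measure_kernel_measurable[OF K A])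
  have m: "fst \<in> \<zeta> \<rightarrow>\<^sub>M N" "snd \<in> \<zeta> \<rightarrow>\<^sub>M N"
    using measurable_cong_sets[OF zp(2) refl] by auto
  have Kp: "K (fst p) \<in> space (prob_algebra M)" "K (snd p) \<in> space (prob_algebra M)" if "p \<in> space (N \<Otimes>\<^sub>M N)" for p
    using that measurable_space[OF K] by (auto simp: space_pair_measure)
  have K1: "(\<lambda>p. K (fst p)) \<in> N \<Otimes>\<^sub>M N \<rightarrow>\<^sub>M prob_algebra M" "(\<lambda>p. K (snd p)) \<in> N \<Otimes>\<^sub>M N \<rightarrow>\<^sub>M prob_algebra M"
    using K by (auto intro: measurable_compose[OF measurable_fst] measurable_compose[OF measurable_snd])
  have i: "integrable \<zeta> (\<lambda>p. measure (K (fst p)) A)" "integrable \<zeta> (\<lambda>p. measure (K (snd p)) A)"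
    using measure_prob_bounds[OF Kp(1), of _ A] measure_prob_bounds[OF Kp(2), of _ A]
    by (auto intro!: integrable_prob_bounded[OF zD(1), of _ 1] measure_kernel_measurable[OF _ A] K1)
  have it: "integrable \<zeta> (\<lambda>p. tv_dist M (K (fst p)) (K (snd p)))"
    using tv_dist_nonneg[OF Kp] tv_dist_le_1[OF Kp]
    by (intro integrable_prob_bounded[OF zD(1), of _ 1] measurable_tv_dist[OF cg K1]) auto
  have "measure (\<nu>1 \<bind> K) A - measure (\<nu>2 \<bind> K) A = (\<integral>p. measure (K (fst p)) A \<partial>\<zeta>) - (\<integral>p. measure (K (snd p)) A \<partial>\<zeta>)"
    unfolding measure_bind_prob[OF \<nu>(1) K A] measure_bind_prob[OF \<nu>(2) K A]
    using integral_distr[OF m(1) f] integral_distr[OF m(2) f] zD by simp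
  also have "\<dots> = (\<integral>p. measure (K (fst p)) A - measure (K (snd p)) A \<partial>\<zeta>)" using i by simp
  finally have "\<bar>measure (\<nu>1 \<bind> K) A - measure (\<nu>2 \<bind> K) A\<bar> \<le> (\<integral>p. \<bar>measure (K (fst p)) A - measure (K (snd p)) A\<bar> \<partial>\<zeta>)"
    using integral_abs_bound by metis
  also have "\<dots> \<le> (\<integral>p. tv_dist M (K (fst p)) (K (snd p)) \<partial>\<zeta>)"
    using i it tv_dist_upper[OF Kp A] zp(3) by (intro integral_mono) auto
  finally show "\<bar>measure (\<nu>1 \<bind> K) A - measure (\<nu>2 \<bind> K) A\<bar> \<le> (\<integral>p. tv_dist M (K (fst p)) (K (snd p)) \<partial>\<zeta>)" .
qed

text \<open>By invariance Kf - f has integral zero, and being non-negative it vanishes almost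
  everywhere. Then the mean of (f(y) - f(x))^2 over a stationary transition from x to y is the
  integral of K(f^2) - 2 f Kf + f^2, which is zero as well.\<close>

lemma subharmonic_AE_constant:
  fixes f :: "'a \<Rightarrow> real"
  assumes \<pi>: "\<pi> \<in> space (prob_algebra N)" and K: "K \<in> N \<rightarrow>\<^sub>M prob_algebra N" and inv: "\<pi> \<bind> K = \<pi>"
    and f[measurable]: "f \<in> borel_measurable N" and f01: "\<And>x. x \<in> space N \<Longrightarrow> 0 \<le> f x \<and> f x \<le> 1"
    and sub: "\<And>x. x \<in> space N \<Longrightarrow> f x \<le> (\<integral>y. f y \<partial>K x)"
  shows "AE x in \<pi>. AE y in K x. f y = f x"
proof -
  note p = prob_algebraD[OF \<pi>]
  note Kp = measurable_space[OF K]
  define F where "F x = (\<integral>y. f y \<partial>K x)" for x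
  define F2 where "F2 x = (\<integral>y. (f y)\<^sup>2 \<partial>K x)" for x
  have f2[measurable]: "(\<lambda>y. (f y)\<^sup>2) \<in> borel_measurable N" by measurable
  have f201: "0 \<le> (f x)\<^sup>2 \<and> (f x)\<^sup>2 \<le> 1" if "x \<in> space N" for x
    using f01[OF that] by (auto intro: power_le_one)
  have F[measurable]: "F \<in> borel_measurable N" unfolding F_def
    by (rule measurable_integral_prob[OF K f])
  have F2[measurable]: "F2 \<in> borel_measurable N" unfolding F2_def
    by (rule measurable_integral_prob[OF K f2])
  have F01: "0 \<le> F x \<and> F x \<le> 1" if "x \<in> space N" for x
    unfolding F_def using f01 by (rule integral_prob_bounds[OF Kp[OF that] f])
  have F201: "0 \<le> F2 x \<and> F2 x \<le> 1" if "x \<in> space N" for x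
    unfolding F2_def using f201 by (rule integral_prob_bounds[OF Kp[OF that] f2])
  have int: "integrable \<pi> g" if "g \<in> borel_measurable N" "\<And>x. x \<in> space N \<Longrightarrow> 0 \<le> g x \<and> g x \<le> 1" for g :: "'a \<Rightarrow> real"
    using that by (intro integrable_prob_bounded[OF \<pi>, of g 1]) auto
  have IF: "(\<integral>x. F x \<partial>\<pi>) = (\<integral>x. f x \<partial>\<pi>)"
    unfolding F_def using integral_bind_prob[OF \<pi> K f, of 1] f01 inv by auto
  have IF2: "(\<integral>x. F2 x \<partial>\<pi>) = (\<integral>x. (f x)\<^sup>2 \<partial>\<pi>)"
    unfolding F2_def using integral_bind_prob[OF \<pi> K f2, of 1] f201 inv by auto
  have "(\<integral>x. F x - f x \<partial>\<pi>) = 0"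
    using IF int[OF F F01] int[OF f f01] by simp
  moreover have "AE x in \<pi>. 0 \<le> F x - f x" using sub p(3) by (intro AE_I2) (simp add: F_def)
  ultimately have "AE x in \<pi>. F x - f x = 0"
    using int[OF F F01] int[OF f f01] integral_nonneg_eq_0_iff_AE[of \<pi> "\<lambda>x. F x - f x"] by simp
  then have Ff: "AE x in \<pi>. F x = f x" by eventually_elim simp
  \<comment> \<open>The conditional second moment of the increment of \<open>f\<close> along one
    transition.\<close>
  define G where "G x = (\<integral>y. (f y - f x)\<^sup>2 \<partial>K x)" for x
  have intK: "integrable (K x) f" "integrable (K x) (\<lambda>y. (f y)\<^sup>2)" if "x \<in> space N" for x
    using f01 f201 by (auto intro!: integrable_prob_bounded[OF Kp[OF that], of _ 1])
  have G_eq: "G x = F2 x - 2 * f x * F x + (f x)\<^sup>2" if x: "x \<in> space N" for x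
  proof -
    interpret prob_space "K x" using prob_algebraD(1)[OF Kp[OF x]] .
    have "(f y - f x)\<^sup>2 = (f y)\<^sup>2 - 2 * f x * f y + (f x)\<^sup>2" for y
      by (simp add: power2_eq_square algebra_simps)
    then show ?thesis
      unfolding G_def F_def F2_def using intK[OF x] by (simp add: prob_space)
  qed
  have "AE x in \<pi>. G x = F2 x - (f x)\<^sup>2"
    using Ff AE_space by eventually_elim (use G_eq p(3) in \<open>simp add: power2_eq_square\<close>)
  moreover have Gm: "G \<in> borel_measurable N"
    by (subst measurable_cong[OF G_eq]) measurable
  ultimately have "(\<integral>x. G x \<partial>\<pi>) = (\<integral>x. F2 x - (f x)\<^sup>2 \<partial>\<pi>)"
    using p(2) by (intro integral_cong_AE) (auto simp: measurable_cong_sets[OF p(2) refl])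
  also have "\<dots> = 0" using IF2 int[OF F2 F201] int[OF f2 f201] by simp
  finally have IG: "(\<integral>x. G x \<partial>\<pi>) = 0" .
  have G01: "0 \<le> G x" "G x \<le> 1" if x: "x \<in> space N" for x
  proof -
    have "0 \<le> (f y - f x)\<^sup>2 \<and> (f y - f x)\<^sup>2 \<le> 1" if "y \<in> space N" for y
    proof -
      have "\<bar>f y - f x\<bar> \<le> 1" using f01[OF that] f01[OF x] by auto
      then show ?thesis by (simp add: abs_square_le_1)
    qed
    then show "0 \<le> G x" "G x \<le> 1" unfolding G_def
      using integral_prob_bounds[OF Kp[OF x], of "\<lambda>y. (f y - f x)\<^sup>2"] by auto
  qed
  have "AE x in \<pi>. G x = 0"
  proof (subst integral_nonneg_eq_0_iff_AE[symmetric])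
    show "integrable \<pi> G" using G01 by (intro int Gm) auto
    show "AE x in \<pi>. 0 \<le> G x" using G01 p(3) by (intro AE_I2) auto
  qed (rule IG)
  with AE_space show ?thesis
  proof eventually_elim
    fix x assume x: "x \<in> space \<pi>" and 0: "G x = 0"
    then have x': "x \<in> space N" using p by simp
    have b: "0 \<le> (f y - f x)\<^sup>2 \<and> (f y - f x)\<^sup>2 \<le> 1" if "y \<in> space N" for y
    proof -
      have "\<bar>f y - f x\<bar> \<le> 1" using f01[OF that] f01[OF x'] by auto
      then show ?thesis by (simp add: abs_square_le_1)
    qed
    have "integrable (K x) (\<lambda>y. (f y - f x)\<^sup>2)"
      using b by (intro integrable_prob_bounded[OF Kp[OF x'], of _ 1]) auto
    then have "AE y in K x. (f y - f x)\<^sup>2 = 0"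
      using 0 integral_nonneg_eq_0_iff_AE[of "K x" "\<lambda>y. (f y - f x)\<^sup>2"] by (simp add: G_def)
    then show "AE y in K x. f y = f x" by eventually_elim simp
  qed
qed

locale stationary_kernel = markov_kernel +
  fixes \<mu> :: "'a measure"
  assumes countably_generated: "countably_generated M"
    and diagonal_sets: "diagonal M \<in> sets (M \<Otimes>\<^sub>M M)"
    and invariant: "invariant_prob M P \<mu>"
begin

lemma mu: "\<mu> \<in> space (prob_algebra M)"
  using invariant by (simp add: invariant_prob_def)

sublocale mu: prob_space \<mu> using prob_algebraD(1)[OF mu] .
sublocale mu2: pair_prob_space \<mu> \<mu> ..

lemma sets_mu: "sets \<mu> = sets M" and space_mu: "space \<mu> = space M"
  using prob_algebraD[OF mu] by auto

lemma sets_mu2: "sets (\<mu> \<Otimes>\<^sub>M \<mu>) = sets (M \<Otimes>\<^sub>M M)"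
  using sets_mu by (intro sets_pair_measure_cong)

lemma space_mu2: "space (\<mu> \<Otimes>\<^sub>M \<mu>) = space M \<times> space M"
  by (simp add: space_pair_measure space_mu)

lemma mu2: "\<mu> \<Otimes>\<^sub>M \<mu> \<in> space (prob_algebra (M \<Otimes>\<^sub>M M))"
  using mu2.prob_space_axioms sets_mu2 by (simp add: space_prob_algebra)

lemma nstep_invariant: "\<mu> \<bind> nstep M P n = \<mu>"
proof (induction n)
  case 0
  have "nstep M P 0 = return M" by (rule ext) simp
  then show ?case using bind_return''[OF sets_mu] by simp
next
  case (Suc n)
  have m: "nstep M P n \<in> \<mu> \<rightarrow>\<^sub>M subprob_algebra M"
    using nstep_subprob measurable_cong_sets[OF sets_mu refl] by blast
  have "nstep M P (Suc n) = (\<lambda>x. nstep M P n x \<bind> P)" by (rule ext) simp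
  then have e: "\<mu> \<bind> nstep M P (Suc n) = (\<mu> \<bind> nstep M P n) \<bind> P"
    by (simp only: bind_assoc[OF m P_subprob])
  show ?case unfolding e Suc using invariant by (simp add: invariant_prob_def)
qed

section \<open>The limiting distance of two states\<close>

definition dist_n :: "nat \<Rightarrow> 'a \<times> 'a \<Rightarrow> real" where
  "dist_n n p = tv_dist M (nstep M P n (fst p)) (nstep M P n (snd p))"

text \<open>Kernels contract total variation, so \<open>dist_n\<close> decreases in \<open>n\<close>
  and the infimum is the limit.\<close>

definition dist_lim :: "'a \<times> 'a \<Rightarrow> real" where
  "dist_lim p = (INF n. dist_n n p)"

lemma in_M2: "p \<in> space (M \<Otimes>\<^sub>M M) \<longleftrightarrow> fst p \<in> space M \<and> snd p \<in> space M"
  by (cases p) (simp add: space_pair_measure)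

lemma dist_n_bounds:
  assumes "p \<in> space (M \<Otimes>\<^sub>M M)" shows "0 \<le> dist_n n p \<and> dist_n n p \<le> 1"
  using assms unfolding dist_n_def in_M2
  by (intro conjI tv_dist_nonneg tv_dist_le_1) (auto intro: nstep_in)

lemma dist_n_decseq:
  assumes "p \<in> space (M \<Otimes>\<^sub>M M)" shows "decseq (\<lambda>n. dist_n n p)"
  using assms tv_dist_bind_le[OF nstep_in nstep_in P] 
  by (auto simp: decseq_Suc_iff dist_n_def in_M2)

lemma dist_n_tendsto:
  assumes "p \<in> space (M \<Otimes>\<^sub>M M)" shows "(\<lambda>n. dist_n n p) \<longlonglongrightarrow> dist_lim p"
  unfolding dist_lim_def
  using dist_n_bounds[OF assms] by (intro LIMSEQ_decseq_INF dist_n_decseq assms bdd_belowI2[of _ 0]) auto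

lemma dist_lim_le: assumes "p \<in> space (M \<Otimes>\<^sub>M M)" shows "dist_lim p \<le> dist_n n p"
  by (rule decseq_ge[OF dist_n_decseq dist_n_tendsto]) (rule assms)+

lemma dist_lim_bounds:
  assumes "p \<in> space (M \<Otimes>\<^sub>M M)" shows "0 \<le> dist_lim p \<and> dist_lim p \<le> 1"
proof
  show "0 \<le> dist_lim p"
    by (rule LIMSEQ_le_const[OF dist_n_tendsto[OF assms]]) (use dist_n_bounds[OF assms] in auto)
  show "dist_lim p \<le> 1" using dist_lim_le[OF assms, of 0] dist_n_bounds[OF assms, of 0] by linarith
qed

lemma nstep_fst_measurable: "(\<lambda>p. nstep M P n (fst p)) \<in> M \<Otimes>\<^sub>M M \<rightarrow>\<^sub>M prob_algebra M"
  and nstep_snd_measurable: "(\<lambda>p. nstep M P n (snd p)) \<in> M \<Otimes>\<^sub>M M \<rightarrow>\<^sub>M prob_algebra M"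
  by (rule measurable_compose[OF measurable_fst nstep_measurable] measurable_compose[OF measurable_snd nstep_measurable])+

lemma dist_n_measurable[measurable]: "dist_n n \<in> borel_measurable (M \<Otimes>\<^sub>M M)"
  unfolding dist_n_def[abs_def]
  by (intro measurable_tv_dist countably_generated nstep_fst_measurable nstep_snd_measurable)

lemma dist_lim_measurable[measurable]: "dist_lim \<in> borel_measurable (M \<Otimes>\<^sub>M M)"
  by (rule borel_measurable_LIMSEQ_real[OF dist_n_tendsto dist_n_measurable])

lemma dist_lim_refl: "x \<in> space M \<Longrightarrow> dist_lim (x, x) = 0"
  by (simp add: dist_lim_def dist_n_def tv_dist_self)

lemma dist_lim_sym: "dist_lim (x, y) = dist_lim (y, x)"
  by (simp add: dist_lim_def dist_n_def tv_dist_commute)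

lemma dist_lim_triangle:
  assumes "x \<in> space M" "y \<in> space M" "z \<in> space M"
  shows "dist_lim (x, z) \<le> dist_lim (x, y) + dist_lim (y, z)"
proof (rule LIMSEQ_le)
  show "(\<lambda>n. dist_n n (x, z)) \<longlonglongrightarrow> dist_lim (x, z)"
    using assms by (intro dist_n_tendsto) (auto simp: in_M2)
  show "(\<lambda>n. dist_n n (x, y) + dist_n n (y, z)) \<longlonglongrightarrow> dist_lim (x, y) + dist_lim (y, z)"
    using assms by (intro tendsto_add dist_n_tendsto) (auto simp: in_M2)
  show "\<exists>N. \<forall>n\<ge>N. dist_n n (x, z) \<le> dist_n n (x, y) + dist_n n (y, z)"
    unfolding dist_n_def fst_conv snd_conv using assms by (intro exI allI impI tv_dist_triangle nstep_in)
qed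

text \<open>The coupling is run for \<open>m\<close> steps and convexity is applied to the remaining
  \<open>n\<close>; then \<open>n\<close> tends to infinity under the integral. With the product
  coupling this is subharmonicity for the product chain.\<close>

lemma dist_lim_coupling:
  assumes x: "x \<in> space M" and y: "y \<in> space M" and z: "\<zeta> \<in> couplings (nstep M P m x) (nstep M P m y)"
  shows "dist_lim (x, y) \<le> (\<integral>p. dist_lim p \<partial>\<zeta>)"
proof (rule LIMSEQ_le_const)
  note zp = couplingsD(1)[OF z nstep_in[OF x] nstep_in[OF y]]
  note zs = prob_algebraD[OF zp]
  have xy: "(x, y) \<in> space (M \<Otimes>\<^sub>M M)" using x y by (simp add: in_M2)
  show "(\<lambda>n. \<integral>p. dist_n n p \<partial>\<zeta>) \<longlonglongrightarrow> (\<integral>p. dist_lim p \<partial>\<zeta>)"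
  proof (rule integral_dominated_convergence[where w="\<lambda>_. 1"])
    show "dist_lim \<in> borel_measurable \<zeta>" "dist_n n \<in> borel_measurable \<zeta>" for n
      using dist_lim_measurable dist_n_measurable measurable_cong_sets[OF zs(2) refl] by blast+
    show "integrable \<zeta> (\<lambda>_. 1)" by (rule finite_measure.integrable_const[OF zs(4)])
    show "AE p in \<zeta>. (\<lambda>n. dist_n n p) \<longlonglongrightarrow> dist_lim p"
      using dist_n_tendsto zs(3) by (intro AE_I2) auto
    show "AE p in \<zeta>. norm (dist_n n p) \<le> 1" for n
      using dist_n_bounds zs(3) by (intro AE_I2) auto
  qed
  have "dist_lim (x, y) \<le> (\<integral>p. dist_n n p \<partial>\<zeta>)" for n
  proof -
    have "dist_lim (x, y) \<le> dist_n (m + n) (x, y)" by (rule dist_lim_le[OF xy])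
    also have "\<dots> = tv_dist M (nstep M P m x \<bind> nstep M P n) (nstep M P m y \<bind> nstep M P n)"
      by (simp add: dist_n_def nstep_add x y)
    also have "\<dots> \<le> (\<integral>p. dist_n n p \<partial>\<zeta>)"
      unfolding dist_n_def
      by (rule tv_dist_bind_coupling[OF nstep_in[OF x] nstep_in[OF y] nstep_measurable countably_generated z])
    finally show ?thesis .
  qed
  then show "\<exists>N. \<forall>n\<ge>N. dist_lim (x, y) \<le> (\<integral>p. dist_n n p \<partial>\<zeta>)" by blast
qed

text \<open>The n-step kernel of two independent copies of the chain. Each \<open>n\<close> is
  treated as a kernel of its own that preserves the product of the invariant measure with
  itself.\<close>

definition nstep2 :: "nat \<Rightarrow> 'a \<times> 'a \<Rightarrow> ('a \<times> 'a) measure" where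
  "nstep2 n p = nstep M P n (fst p) \<Otimes>\<^sub>M nstep M P n (snd p)"

lemma nstep2_measurable: "nstep2 n \<in> M \<Otimes>\<^sub>M M \<rightarrow>\<^sub>M prob_algebra (M \<Otimes>\<^sub>M M)"
  unfolding nstep2_def[abs_def]
  by (rule measurable_pair_prob[OF nstep_fst_measurable nstep_snd_measurable])

lemma nstep2_invariant: "(\<mu> \<Otimes>\<^sub>M \<mu>) \<bind> nstep2 n = \<mu> \<Otimes>\<^sub>M \<mu>"
proof (rule pair_measure_eqI[symmetric])
  show "sigma_finite_measure \<mu>" "sigma_finite_measure \<mu>" by unfold_locales
  show "sets (\<mu> \<Otimes>\<^sub>M \<mu>) = sets ((\<mu> \<Otimes>\<^sub>M \<mu>) \<bind> nstep2 n)"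
    using sets_bind'[OF mu2 nstep2_measurable] sets_mu2 by simp
  fix A B assume "A \<in> sets \<mu>" "B \<in> sets \<mu>"
  then have A: "A \<in> sets M" "B \<in> sets M" by (simp_all add: sets_mu)
  have e: "(\<lambda>x. emeasure (nstep M P n x) C) \<in> borel_measurable \<mu>" if "C \<in> sets M" for C
    using measurable_compose[OF nstep_subprob measurable_emeasure_subprob_algebra[OF that]]
      measurable_cong_sets[OF sets_mu refl] by blast
  have i: "(\<integral>\<^sup>+x. emeasure (nstep M P n x) C \<partial>\<mu>) = emeasure \<mu> C" if "C \<in> sets M" for C
    using emeasure_bind_prob_algebra[OF mu nstep_measurable that] nstep_invariant by simp
  have AB: "A \<times> B \<in> sets (M \<Otimes>\<^sub>M M)" using A by (rule pair_measureI)
  have "emeasure ((\<mu> \<Otimes>\<^sub>M \<mu>) \<bind> nstep2 n) (A \<times> B) = (\<integral>\<^sup>+p. emeasure (nstep2 n p) (A \<times> B) \<partial>(\<mu> \<Otimes>\<^sub>M \<mu>))"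
    by (rule emeasure_bind_prob_algebra[OF mu2 nstep2_measurable AB])
  also have "\<dots> = (\<integral>\<^sup>+p. emeasure (nstep M P n (fst p)) A * emeasure (nstep M P n (snd p)) B \<partial>(\<mu> \<Otimes>\<^sub>M \<mu>))"
  proof (intro nn_integral_cong)
    fix p assume "p \<in> space (\<mu> \<Otimes>\<^sub>M \<mu>)"
    then have p: "fst p \<in> space M" "snd p \<in> space M" by (auto simp: space_mu2)
    interpret Q: prob_space "nstep M P n (snd p)" using prob_algebraD(1)[OF nstep_in[OF p(2)]] .
    show "emeasure (nstep2 n p) (A \<times> B) = emeasure (nstep M P n (fst p)) A * emeasure (nstep M P n (snd p)) B"
      unfolding nstep2_def
      using A prob_algebraD(2)[OF nstep_in[OF p(1)]] prob_algebraD(2)[OF nstep_in[OF p(2)]]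
      by (intro Q.emeasure_pair_measure_Times) auto
  qed
  also have "\<dots> = (\<integral>\<^sup>+x. \<integral>\<^sup>+y. emeasure (nstep M P n x) A * emeasure (nstep M P n y) B \<partial>\<mu> \<partial>\<mu>)"
    by (subst mu.nn_integral_fst[symmetric])
      (auto intro!: borel_measurable_times_ennreal measurable_compose[OF measurable_fst e] measurable_compose[OF measurable_snd e] A)
  also have "\<dots> = emeasure \<mu> A * emeasure \<mu> B"
    by (simp add: nn_integral_cmult nn_integral_multc e i A)
  finally show "emeasure \<mu> A * emeasure \<mu> B = emeasure ((\<mu> \<Otimes>\<^sub>M \<mu>) \<bind> nstep2 n) (A \<times> B)" by simp
qed

text \<open>The quantifier over \<open>n\<close> stands inside the almost-everywhere statement, so
  that the time used later may depend on the pair.\<close>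

lemma AE_dist_lim_constant: "AE p in \<mu> \<Otimes>\<^sub>M \<mu>. \<forall>n. AE q in nstep2 n p. dist_lim q = dist_lim p"
proof (subst AE_all_countable, rule allI)
  fix n
  show "AE p in \<mu> \<Otimes>\<^sub>M \<mu>. AE q in nstep2 n p. dist_lim q = dist_lim p"
  proof (rule subharmonic_AE_constant[OF mu2 nstep2_measurable nstep2_invariant dist_lim_measurable dist_lim_bounds])
    fix p assume "p \<in> space (M \<Otimes>\<^sub>M M)"
    then have p: "fst p \<in> space M" "snd p \<in> space M" by (auto simp: in_M2)
    show "dist_lim p \<le> (\<integral>q. dist_lim q \<partial>nstep2 n p)"
      using dist_lim_coupling[OF p pair_measure_couplings[OF nstep_in[OF p(1)] nstep_in[OF p(2)]]]
      by (simp add: nstep2_def)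
  qed
qed

lemma dist_lim_eq_0:
  assumes x: "x \<in> space M" and y: "y \<in> space M" and const: "AE q in nstep2 n (x, y). dist_lim q = dist_lim (x, y)"
    and ns: "non_singular M (nstep M P n x) (nstep M P n y)"
  shows "dist_lim (x, y) = 0"
proof -
  define c where "c = dist_lim (x, y)"
  have xy: "(x, y) \<in> space (M \<Otimes>\<^sub>M M)" using x y by (simp add: in_M2)
  note nx = nstep_in[OF x, of n] and ny = nstep_in[OF y, of n]
  obtain \<zeta> where z: "\<zeta> \<in> couplings (nstep M P n x) (nstep M P n y)" "emeasure \<zeta> (diagonal M) > 0"
    and null: "\<And>B. B \<in> sets (M \<Otimes>\<^sub>M M) \<Longrightarrow> emeasure (nstep M P n x \<Otimes>\<^sub>M nstep M P n y) B = 0 \<Longrightarrow>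
      B \<inter> diagonal M = {} \<Longrightarrow> emeasure \<zeta> B = 0"
    using non_singular_coupling[OF nx ny diagonal_sets ns] by blast
  note zp = couplingsD(1)[OF z(1) nx ny]
  note zs = prob_algebraD[OF zp]
  interpret prob_space \<zeta> by (rule zs)
  \<comment> \<open>Off the diagonal, the points where \<open>dist_lim\<close> differs from
    \<open>c\<close> form a null set of the product law, hence of \<open>\<zeta>\<close> by the
    choice of the coupling.\<close>
  define B where "B = {q \<in> space (M \<Otimes>\<^sub>M M). dist_lim q \<noteq> c} - diagonal M"
  have "{q \<in> space (M \<Otimes>\<^sub>M M). dist_lim q \<noteq> c} = dist_lim -` (- {c}) \<inter> space (M \<Otimes>\<^sub>M M)" by auto
  then have B: "B \<in> sets (M \<Otimes>\<^sub>M M)"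
    unfolding B_def using measurable_sets[OF dist_lim_measurable, of "- {c}"] diagonal_sets by auto
  have s2: "sets (nstep2 n (x, y)) = sets (M \<Otimes>\<^sub>M M)" "space (nstep2 n (x, y)) = space (M \<Otimes>\<^sub>M M)"
    using prob_algebraD[OF measurable_space[OF nstep2_measurable xy]] by auto
  have "emeasure (nstep2 n (x, y)) B = 0"
  proof -
    have "AE q in nstep2 n (x, y). q \<notin> B" using const by eventually_elim (auto simp: B_def c_def)
    then show ?thesis using s2 B sets.sets_into_space[OF B] by (subst (asm) AE_iff_measurable[of B]) auto
  qed
  moreover have "B \<inter> diagonal M = {}" by (auto simp: B_def)
  ultimately have "emeasure \<zeta> B = 0" using null[OF B] by (simp add: nstep2_def)
  then have nB: "AE q in \<zeta>. q \<notin> B" using B zs by (intro AE_not_in) (auto simp: null_sets_def)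
  have "c \<le> (\<integral>q. dist_lim q \<partial>\<zeta>)" unfolding c_def using x y z(1) by (rule dist_lim_coupling)
  also have "\<dots> = (\<integral>q. c * indicator (space (M \<Otimes>\<^sub>M M) - diagonal M) q \<partial>\<zeta>)"
  proof (rule integral_cong_AE)
    show "AE q in \<zeta>. dist_lim q = c * indicator (space (M \<Otimes>\<^sub>M M) - diagonal M) q"
      using nB AE_space
    proof eventually_elim
      fix q assume q: "q \<notin> B" "q \<in> space \<zeta>"
      show "dist_lim q = c * indicator (space (M \<Otimes>\<^sub>M M) - diagonal M) q"
      proof (cases "q \<in> diagonal M")
        case True
        then show ?thesis by (auto simp: diagonal_def dist_lim_refl)
      next
        case False
        then show ?thesis using q zs by (auto simp: B_def)
      qed
    qed
    have "(\<lambda>q. c * indicator (space (M \<Otimes>\<^sub>M M) - diagonal M) q) \<in> borel_measurable (M \<Otimes>\<^sub>M M)"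
      using diagonal_sets by (intro borel_measurable_times borel_measurable_const borel_measurable_indicator) auto
    then show "dist_lim \<in> borel_measurable \<zeta>"
      "(\<lambda>q. c * indicator (space (M \<Otimes>\<^sub>M M) - diagonal M) q) \<in> borel_measurable \<zeta>"
      using dist_lim_measurable measurable_cong_sets[OF zs(2) refl] by blast+
  qed
  \<comment> \<open>On the diagonal the integrand is zero, so \<open>c\<close> is at most its
    multiple by a factor below 1.\<close>
  also have "\<dots> = c * (1 - measure \<zeta> (diagonal M))"
    using prob_compl[of "diagonal M"] diagonal_sets zs by simp
  finally have "c * measure \<zeta> (diagonal M) \<le> 0" by (simp add: algebra_simps)
  moreover have "measure \<zeta> (diagonal M) > 0" using z(2) by (simp add: emeasure_eq_measure)
  moreover have "0 \<le> c" using dist_lim_bounds[OF xy] by (simp add: c_def)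
  ultimately have "c = 0" by (smt (verit) mult_pos_pos)
  then show ?thesis by (simp add: c_def)
qed

lemma AE_dist_lim_non_singular:
  "AE p in \<mu> \<Otimes>\<^sub>M \<mu>. (\<exists>n. non_singular M (nstep M P n (fst p)) (nstep M P n (snd p))) \<longrightarrow> dist_lim p = 0"
  using AE_dist_lim_constant AE_space
proof eventually_elim
  case (elim p)
  obtain x y where p: "p = (x, y)" by fastforce
  have "x \<in> space M" "y \<in> space M" using elim(2) by (auto simp: p space_mu2)
  then show ?case using dist_lim_eq_0 elim(1) unfolding p fst_conv snd_conv by blast
qed

lemma pair_couplings_Pair:
  assumes x: "x \<in> space M"
  shows "distr \<mu> (M \<Otimes>\<^sub>M M) (Pair x) \<in> couplings (return M x) \<mu>"
proof (rule couplingsI)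
  have m: "Pair x \<in> \<mu> \<rightarrow>\<^sub>M M \<Otimes>\<^sub>M M"
    using x measurable_cong_sets[OF sets_mu refl] measurable_Pair1'[OF x] by blast
  show "distr \<mu> (M \<Otimes>\<^sub>M M) (Pair x) \<in> space (prob_algebra (M \<Otimes>\<^sub>M M))"
    using mu.prob_space_distr[OF m] by (simp add: space_prob_algebra)
  have "distr (distr \<mu> (M \<Otimes>\<^sub>M M) (Pair x)) M fst = distr \<mu> M (\<lambda>_. x)"
    using m by (subst distr_distr) (auto simp: comp_def)
  also have "\<dots> = return M x" using x mu.distr_const by simp
  finally show "distr (distr \<mu> (M \<Otimes>\<^sub>M M) (Pair x)) M fst = return M x" .
  have "distr (distr \<mu> (M \<Otimes>\<^sub>M M) (Pair x)) M snd = distr \<mu> M (\<lambda>y. y)"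
    using m by (subst distr_distr) (auto simp: comp_def)
  then show "distr (distr \<mu> (M \<Otimes>\<^sub>M M) (Pair x)) M snd = \<mu>"
    using distr_id2[OF sets_mu[symmetric]] by simp
qed

text \<open>By invariance, the n-step law and \<open>\<mu>\<close> are the images of the point mass
  at \<open>x\<close> and of \<open>\<mu>\<close> under the same kernel, and the only way to couple
  these two is to fix the first coordinate.\<close>

lemma tv_dist_invariant_le:
  assumes x: "x \<in> space M"
  shows "tv_dist M (nstep M P n x) \<mu> \<le> (\<integral>y. dist_n n (x, y) \<partial>\<mu>)"
proof -
  have r: "return M x \<in> space (prob_algebra M)" by (rule measurable_space[OF measurable_return_prob_space x])
  have b: "return M x \<bind> nstep M P n = nstep M P n x" by (rule bind_return[OF nstep_subprob x])
  have m: "Pair x \<in> \<mu> \<rightarrow>\<^sub>M M \<Otimes>\<^sub>M M"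
    using x measurable_cong_sets[OF sets_mu refl] measurable_Pair1'[OF x] by blast
  have "tv_dist M (return M x \<bind> nstep M P n) (\<mu> \<bind> nstep M P n) \<le> (\<integral>p. dist_n n p \<partial>distr \<mu> (M \<Otimes>\<^sub>M M) (Pair x))"
    unfolding dist_n_def
    by (rule tv_dist_bind_coupling[OF r mu nstep_measurable countably_generated pair_couplings_Pair[OF x]])
  then show ?thesis
    unfolding b nstep_invariant integral_distr[OF m dist_n_measurable] .
qed

lemma convergence_of_dist_lim:
  assumes "AE p in \<mu> \<Otimes>\<^sub>M \<mu>. dist_lim p = 0"
  shows "AE x in \<mu>. (\<lambda>n. tv_dist M (nstep M P n x) \<mu>) \<longlonglongrightarrow> 0"
  using mu2.AE_pair[OF assms] AE_space
proof eventually_elim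
  fix x assume 0: "AE y in \<mu>. dist_lim (x, y) = 0" and "x \<in> space \<mu>"
  then have x: "x \<in> space M" by (simp add: space_mu)
  have m: "Pair x \<in> \<mu> \<rightarrow>\<^sub>M M \<Otimes>\<^sub>M M"
    using x measurable_cong_sets[OF sets_mu refl] measurable_Pair1'[OF x] by blast
  have "(\<lambda>n. \<integral>y. dist_n n (x, y) \<partial>\<mu>) \<longlonglongrightarrow> (\<integral>y. 0 \<partial>\<mu>)"
  proof (rule integral_dominated_convergence[where w="\<lambda>_. 1"])
    show "(\<lambda>y. dist_n n (x, y)) \<in> borel_measurable \<mu>" for n
      by (rule measurable_compose[OF m dist_n_measurable])
    show "AE y in \<mu>. (\<lambda>n. dist_n n (x, y)) \<longlonglongrightarrow> 0"
      using 0 AE_space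
    proof eventually_elim
      case (elim y)
      then show ?case using dist_n_tendsto[of "(x, y)"] x by (simp add: in_M2 space_mu)
    qed
    show "AE y in \<mu>. norm (dist_n n (x, y)) \<le> 1" for n
      using dist_n_bounds x by (intro AE_I2) (auto simp: in_M2 space_mu)
  qed auto
  then have lim: "(\<lambda>n. \<integral>y. dist_n n (x, y) \<partial>\<mu>) \<longlonglongrightarrow> 0" by simp
  show "(\<lambda>n. tv_dist M (nstep M P n x) \<mu>) \<longlonglongrightarrow> 0"
    using tv_dist_invariant_le[OF x] tv_dist_nonneg[OF nstep_in[OF x] mu]
    by (intro tendsto_sandwich[OF _ _ tendsto_const lim] always_eventually allI) auto
qed

lemma non_singular_imp_convergence:
  assumes "AE p in \<mu> \<Otimes>\<^sub>M \<mu>. \<exists>n. non_singular M (nstep M P n (fst p)) (nstep M P n (snd p))"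
  shows "AE x in \<mu>. (\<lambda>n. tv_dist M (nstep M P n x) \<mu>) \<longlonglongrightarrow> 0"
proof (rule convergence_of_dist_lim)
  show "AE p in \<mu> \<Otimes>\<^sub>M \<mu>. dist_lim p = 0"
    using assms AE_dist_lim_non_singular by eventually_elim blast
qed

lemma dist_n_tendsto_0:
  assumes "AE x in \<mu>. (\<lambda>n. tv_dist M (nstep M P n x) \<mu>) \<longlonglongrightarrow> 0"
  shows "AE p in \<mu> \<Otimes>\<^sub>M \<mu>. (\<lambda>n. dist_n n p) \<longlonglongrightarrow> 0"
proof -
  have m: "fst \<in> \<mu> \<Otimes>\<^sub>M \<mu> \<rightarrow>\<^sub>M \<mu>" "snd \<in> \<mu> \<Otimes>\<^sub>M \<mu> \<rightarrow>\<^sub>M \<mu>" by auto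
  have d: "distr (\<mu> \<Otimes>\<^sub>M \<mu>) \<mu> fst = \<mu>" "distr (\<mu> \<Otimes>\<^sub>M \<mu>) \<mu> snd = \<mu>"
    using pair_measure_couplings[OF mu mu] by (auto simp: couplings_def)
  have "AE p in \<mu> \<Otimes>\<^sub>M \<mu>. (\<lambda>n. tv_dist M (nstep M P n (fst p)) \<mu>) \<longlonglongrightarrow> 0"
    by (rule AE_distrD[OF m(1)], unfold d, rule assms)
  moreover have "AE p in \<mu> \<Otimes>\<^sub>M \<mu>. (\<lambda>n. tv_dist M (nstep M P n (snd p)) \<mu>) \<longlonglongrightarrow> 0"
    by (rule AE_distrD[OF m(2)], unfold d, rule assms)
  ultimately show ?thesis using AE_space
  proof eventually_elim
    case (elim p)
    then have p: "fst p \<in> space M" "snd p \<in> space M" "p \<in> space (M \<Otimes>\<^sub>M M)" by (auto simp: space_mu2 in_M2)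
    have lim: "(\<lambda>n. tv_dist M (nstep M P n (fst p)) \<mu> + tv_dist M (nstep M P n (snd p)) \<mu>) \<longlonglongrightarrow> 0"
      using tendsto_add[OF elim(1,2)] by simp
    have le: "dist_n n p \<le> tv_dist M (nstep M P n (fst p)) \<mu> + tv_dist M (nstep M P n (snd p)) \<mu>" for n
      unfolding dist_n_def
      using tv_dist_triangle[OF nstep_in[OF p(1)] mu nstep_in[OF p(2)]] tv_dist_commute[of M \<mu>] by simp
    show ?case
      by (rule tendsto_sandwich[OF always_eventually always_eventually tendsto_const lim])
        (use le dist_n_bounds[OF p(3)] in auto)
  qed
qed

end

subsection \<open>Singular kernels and cyclic classes\<close>

context stationary_kernel
begin

text \<open>The joint law of a stationary state and its successor under \<open>Q\<close>.
  Decomposing this single measure against \<open>\<mu> \<Otimes>\<^sub>M \<mu>\<close> provides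
  densities of the laws \<open>Q x\<close> that are jointly measurable in both variables.\<close>

definition graph_law :: "('a \<Rightarrow> 'a measure) \<Rightarrow> ('a \<times> 'a) measure" where
  "graph_law Q = \<mu> \<bind> (\<lambda>x. distr (Q x) (M \<Otimes>\<^sub>M M) (Pair x))"

lemma graph_kernel_measurable:
  assumes Q: "Q \<in> M \<rightarrow>\<^sub>M prob_algebra M"
  shows "(\<lambda>x. distr (Q x) (M \<Otimes>\<^sub>M M) (Pair x)) \<in> M \<rightarrow>\<^sub>M prob_algebra (M \<Otimes>\<^sub>M M)"
  by (rule measurable_distr_prob_space2[OF Q]) (auto simp: measurable_split_conv)

lemma graph_law_in:
  assumes Q: "Q \<in> M \<rightarrow>\<^sub>M prob_algebra M"
  shows "graph_law Q \<in> space (prob_algebra (M \<Otimes>\<^sub>M M))"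
  unfolding graph_law_def by (rule bind_in_prob_algebra[OF mu graph_kernel_measurable[OF Q]])

lemma emeasure_graph_law:
  assumes Q: "Q \<in> M \<rightarrow>\<^sub>M prob_algebra M" and B: "B \<in> sets (M \<Otimes>\<^sub>M M)"
  shows "emeasure (graph_law Q) B = (\<integral>\<^sup>+x. emeasure (Q x) (Pair x -` B) \<partial>\<mu>)"
  unfolding graph_law_def emeasure_bind_prob_algebra[OF mu graph_kernel_measurable[OF Q] B]
proof (intro nn_integral_cong)
  fix x assume "x \<in> space \<mu>"
  then have x: "x \<in> space M" by (simp add: space_mu)
  note q = prob_algebraD[OF measurable_space[OF Q x]]
  have m: "Pair x \<in> Q x \<rightarrow>\<^sub>M M \<Otimes>\<^sub>M M"
    using x measurable_cong_sets[OF q(2) refl] measurable_Pair1'[OF x] by blast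
  have "Pair x -` B \<inter> space (Q x) = Pair x -` B"
    using sets.sets_into_space[OF B] q(3) by (auto simp: space_pair_measure)
  then show "emeasure (distr (Q x) (M \<Otimes>\<^sub>M M) (Pair x)) B = emeasure (Q x) (Pair x -` B)"
    using emeasure_distr[OF m B] by simp
qed

lemma emeasure_section_measurable:
  assumes Q: "Q \<in> M \<rightarrow>\<^sub>M prob_algebra M" and B: "B \<in> sets (M \<Otimes>\<^sub>M M)"
  shows "(\<lambda>x. emeasure (Q x) (Pair x -` B)) \<in> borel_measurable M"
proof (rule emeasure_measurable_subprob_algebra2[OF _ measurable_prob_algebraD[OF Q]])
  have "Sigma (space M) (\<lambda>x. Pair x -` B) = B"
    using sets.sets_into_space[OF B] by (auto simp: space_pair_measure)
  then show "Sigma (space M) (\<lambda>x. Pair x -` B) \<in> sets (M \<Otimes>\<^sub>M M)" using B by simp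
qed

text \<open>If the absolutely continuous part of \<open>Q x\<close> has density \<open>p x\<close> with respect to \<open>\<mu>\<close>, mutual
  singularity means \<open>p x z * p y z = 0\<close> for almost all \<open>(x, y, z)\<close>; integrating out \<open>x\<close> and \<open>y\<close>
  first leaves the square of \<open>\<integral>p x z \<mu>(dx)\<close>.\<close>

lemma singular_kernels_imp_singular_invariant:
  assumes Q: "Q \<in> M \<rightarrow>\<^sub>M prob_algebra M"
    and sing: "AE p in \<mu> \<Otimes>\<^sub>M \<mu>. \<not> non_singular M (Q (fst p)) (Q (snd p))"
  shows "AE x in \<mu>. \<not> non_singular M (Q x) \<mu>"
proof -
  note G = graph_law_in[OF Q]
  note Gp = prob_algebraD[OF G] and m2 = prob_algebraD[OF mu2]
  note Qp = prob_algebraD[OF measurable_space[OF Q]]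
  obtain \<rho> and f g :: "'a \<times> 'a \<Rightarrow> real" where fin: "finite_measure \<rho>" and sets: "sets \<rho> = sets (M \<Otimes>\<^sub>M M)"
    and fm: "f \<in> borel_measurable (M \<Otimes>\<^sub>M M)" and gm: "g \<in> borel_measurable (M \<Otimes>\<^sub>M M)"
    and nn: "\<And>x. 0 \<le> f x" "\<And>x. 0 \<le> g x"
    and d: "graph_law Q = density \<rho> (\<lambda>x. ennreal (f x))" "\<mu> \<Otimes>\<^sub>M \<mu> = density \<rho> (\<lambda>x. ennreal (g x))"
    using common_density[OF Gp(4) m2(4) Gp(2) m2(2)] by metis
  note meas = measurable_cong_sets[OF sets refl] measurable_cong_sets[OF sets_mu2 refl]
  \<comment> \<open>Lebesgue decomposition: the set \<open>N\<close>, null for the product, carries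
    the singular part of the graph law, and \<open>h\<close> is the density of the rest.\<close>
  define N where "N = {z \<in> space (M \<Otimes>\<^sub>M M). g z = 0}"
  define h where "h z = ennreal (f z / g z)" for z
  have "N = g -` {0} \<inter> space (M \<Otimes>\<^sub>M M)" by (auto simp: N_def)
  then have N: "N \<in> sets (M \<Otimes>\<^sub>M M)" using measurable_sets[OF gm] by simp
  have h: "h \<in> borel_measurable (M \<Otimes>\<^sub>M M)" unfolding h_def using fm gm by measurable
  have hN: "h z = 0" if "z \<in> N" for z using that by (simp add: N_def h_def)
  have muN: "emeasure (\<mu> \<Otimes>\<^sub>M \<mu>) N = 0"
    unfolding d(2) using N gm sets
    by (subst emeasure_density) (auto simp: meas N_def intro!: nn_integral_zero' AE_I2 split: split_indicator)
  have off: "emeasure (graph_law Q) (B - N) = (\<integral>\<^sup>+x. \<integral>\<^sup>+z. h (x, z) * indicator B (x, z) \<partial>\<mu> \<partial>\<mu>)"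
    if B: "B \<in> sets (M \<Otimes>\<^sub>M M)" for B
  proof -
    have B': "indicator B \<in> borel_measurable (M \<Otimes>\<^sub>M M)" "indicator (B - N) \<in> borel_measurable (M \<Otimes>\<^sub>M M)"
      using B N by auto
    have "emeasure (graph_law Q) (B - N) = (\<integral>\<^sup>+z. ennreal (f z) * indicator (B - N) z \<partial>\<rho>)"
      unfolding d(1) using B N fm sets by (intro emeasure_density) (auto simp: meas)
    also have "\<dots> = (\<integral>\<^sup>+z. ennreal (g z) * (h z * indicator B z) \<partial>\<rho>)"
    proof (intro nn_integral_cong)
      fix z assume "z \<in> space \<rho>"
      then have z: "z \<in> space (M \<Otimes>\<^sub>M M)" using sets_eq_imp_space_eq[OF sets] by simp
      show "ennreal (f z) * indicator (B - N) z = ennreal (g z) * (h z * indicator B z)"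
      proof (cases "z \<in> N")
        case True
        then show ?thesis by (simp add: hN)
      next
        case False
        then have "g z \<noteq> 0" using z by (simp add: N_def)
        then have "ennreal (g z) * h z = ennreal (f z)"
          unfolding h_def using nn by (simp add: ennreal_mult[symmetric])
        then show ?thesis using False by (simp add: mult.assoc[symmetric] split: split_indicator)
      qed
    qed
    also have "\<dots> = (\<integral>\<^sup>+z. h z * indicator B z \<partial>(\<mu> \<Otimes>\<^sub>M \<mu>))"
      unfolding d(2) using gm h B' by (subst nn_integral_density) (auto simp: meas intro!: borel_measurable_times_ennreal)
    also have "\<dots> = (\<integral>\<^sup>+x. \<integral>\<^sup>+z. h (x, z) * indicator B (x, z) \<partial>\<mu> \<partial>\<mu>)"
      using h B' by (subst mu.nn_integral_fst[symmetric]) (auto simp: meas intro!: borel_measurable_times_ennreal)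
    finally show ?thesis .
  qed
  have hx: "(\<lambda>z. h (x, z)) \<in> borel_measurable \<mu>" "(\<lambda>z. h (z, x)) \<in> borel_measurable \<mu>" if x: "x \<in> space M" for x
  proof -
    have "(\<lambda>z. h (x, z)) \<in> borel_measurable M" "(\<lambda>z. h (z, x)) \<in> borel_measurable M"
      using measurable_compose[OF measurable_Pair1'[OF x] h] measurable_compose[OF measurable_Pair2'[OF x] h] by auto
    then show "(\<lambda>z. h (x, z)) \<in> borel_measurable \<mu>" "(\<lambda>z. h (z, x)) \<in> borel_measurable \<mu>"
      using measurable_cong_sets[OF sets_mu refl] by blast+
  qed
  obtain \<A> where A: "countable \<A>" "algebra (space M) \<A>" "sets M = sigma_sets (space M) \<A>"
    using countably_generated_algebra[OF countably_generated] by blast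
  interpret A: algebra "space M" \<A> by (rule A)
  have subA: "\<A> \<subseteq> sets M" unfolding A(3) by auto
  \<comment> \<open>For a fixed \<open>C\<close> the two functions of \<open>x\<close> have equal
    integrals over every \<open>B\<close>, namely the mass that the graph law gives to
    \<open>B \<times> C - N\<close>, so they agree almost everywhere. The null set depends on
    \<open>C\<close>; the countable algebra merges these null sets into one.\<close>
  have eqA: "AE x in \<mu>. emeasure (Q x) (Pair x -` (space M \<times> C - N)) = (\<integral>\<^sup>+z. h (x, z) * indicator C z \<partial>\<mu>)"
    if C: "C \<in> \<A>" for C
  proof -
    have C: "C \<in> sets M" using that subA by auto
    have CN: "space M \<times> C - N \<in> sets (M \<Otimes>\<^sub>M M)" using C N by auto
    have u: "(\<lambda>x. emeasure (Q x) (Pair x -` (space M \<times> C - N))) \<in> borel_measurable \<mu>"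
      using emeasure_section_measurable[OF Q CN] measurable_cong_sets[OF sets_mu refl] by blast
    have "(\<lambda>(x, z). h (x, z) * indicator C z) \<in> borel_measurable (M \<Otimes>\<^sub>M M)"
      using h C by (auto simp: split_beta' intro!: borel_measurable_times_ennreal measurable_compose[OF measurable_snd borel_measurable_indicator])
    then have hC: "(\<lambda>(x, z). h (x, z) * indicator C z) \<in> borel_measurable (\<mu> \<Otimes>\<^sub>M \<mu>)" using meas by blast
    have v: "(\<lambda>x. \<integral>\<^sup>+z. h (x, z) * indicator C z \<partial>\<mu>) \<in> borel_measurable \<mu>"
      using mu.borel_measurable_nn_integral_fst[OF hC] by simp
    have "density \<mu> (\<lambda>x. emeasure (Q x) (Pair x -` (space M \<times> C - N))) = density \<mu> (\<lambda>x. \<integral>\<^sup>+z. h (x, z) * indicator C z \<partial>\<mu>)"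
    proof (rule measure_eqI)
      fix B assume "B \<in> sets (density \<mu> (\<lambda>x. emeasure (Q x) (Pair x -` (space M \<times> C - N))))"
      then have B: "B \<in> sets M" by (simp add: sets_mu)
      have "emeasure (density \<mu> (\<lambda>x. emeasure (Q x) (Pair x -` (space M \<times> C - N)))) B
          = (\<integral>\<^sup>+x. emeasure (Q x) (Pair x -` (space M \<times> C - N)) * indicator B x \<partial>\<mu>)"
        using u B sets_mu by (intro emeasure_density) auto
      also have "\<dots> = (\<integral>\<^sup>+x. emeasure (Q x) (Pair x -` (B \<times> C - N)) \<partial>\<mu>)"
      proof (intro nn_integral_cong)
        fix x assume "x \<in> space \<mu>"
        then have "Pair x -` (B \<times> C - N) = (if x \<in> B then Pair x -` (space M \<times> C - N) else {})"
          by (auto simp: space_mu)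
        then show "emeasure (Q x) (Pair x -` (space M \<times> C - N)) * indicator B x = emeasure (Q x) (Pair x -` (B \<times> C - N))"
          by simp
      qed
      also have "\<dots> = emeasure (graph_law Q) (B \<times> C - N)"
        using B C N by (intro emeasure_graph_law[OF Q, symmetric]) auto
      also have "\<dots> = (\<integral>\<^sup>+x. \<integral>\<^sup>+z. h (x, z) * indicator (B \<times> C) (x, z) \<partial>\<mu> \<partial>\<mu>)"
        using B C by (intro off) auto
      also have "\<dots> = (\<integral>\<^sup>+x. (\<integral>\<^sup>+z. h (x, z) * indicator C z \<partial>\<mu>) * indicator B x \<partial>\<mu>)"
      proof (intro nn_integral_cong)
        fix x
        have "(\<integral>\<^sup>+z. h (x, z) * indicator (B \<times> C) (x, z) \<partial>\<mu>) = (\<integral>\<^sup>+z. h (x, z) * indicator C z * indicator B x \<partial>\<mu>)"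
          by (intro nn_integral_cong) (auto split: split_indicator)
        then show "(\<integral>\<^sup>+z. h (x, z) * indicator (B \<times> C) (x, z) \<partial>\<mu>) = (\<integral>\<^sup>+z. h (x, z) * indicator C z \<partial>\<mu>) * indicator B x"
          by (cases "x \<in> B") auto
      qed
      also have "\<dots> = emeasure (density \<mu> (\<lambda>x. \<integral>\<^sup>+z. h (x, z) * indicator C z \<partial>\<mu>)) B"
        using v B sets_mu by (intro emeasure_density[symmetric]) auto
      finally show "emeasure (density \<mu> (\<lambda>x. emeasure (Q x) (Pair x -` (space M \<times> C - N)))) B
          = emeasure (density \<mu> (\<lambda>x. \<integral>\<^sup>+z. h (x, z) * indicator C z \<partial>\<mu>)) B" .
    qed simp
    then show ?thesis by (rule mu.density_unique[OF u v])
  qed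
  have AE1: "AE x in \<mu>. \<forall>C\<in>\<A>. emeasure (Q x) (Pair x -` (space M \<times> C - N)) = (\<integral>\<^sup>+z. h (x, z) * indicator C z \<partial>\<mu>)"
    using eqA by (intro AE_ball_countable'[OF _ A(1)])
  define good where "good x \<longleftrightarrow> x \<in> space M \<and>
      (\<forall>C\<in>\<A>. emeasure (Q x) (Pair x -` (space M \<times> C - N)) = (\<integral>\<^sup>+z. h (x, z) * indicator C z \<partial>\<mu>))" for x
  have AE_good: "AE x in \<mu>. good x" using AE1 AE_space by eventually_elim (simp add: good_def space_mu)
  \<comment> \<open>For a good state both sides are finite measures in \<open>C\<close>; they agree
    on the algebra and hence on the sigma-algebra it generates.\<close>
  have good_eq: "emeasure (Q x) (C - Pair x -` N) = (\<integral>\<^sup>+z. h (x, z) * indicator C z \<partial>\<mu>)"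
    if x: "good x" and C: "C \<in> sets M" for x C
  proof -
    have xM: "x \<in> space M" using x by (simp add: good_def)
    have sQ: "sets (Q x) = sets M" and spQ: "space (Q x) = space M" using Qp[OF xM] by auto
    have Nx: "Pair x -` N \<in> sets M" by (rule sets_Pair1[OF N])
    define m1 where "m1 = density (Q x) (indicator (space M - Pair x -` N))"
    define m2 where "m2 = density \<mu> (\<lambda>z. h (x, z))"
    have e1: "emeasure m1 C = emeasure (Q x) (C - Pair x -` N)" if C: "C \<in> sets M" for C
    proof -
      have "emeasure m1 C = (\<integral>\<^sup>+z. indicator (space M - Pair x -` N) z * indicator C z \<partial>Q x)"
        unfolding m1_def using sQ C Nx by (intro emeasure_density) auto
      also have "\<dots> = (\<integral>\<^sup>+z. indicator (C - Pair x -` N) z \<partial>Q x)"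
        using sets.sets_into_space[OF C] by (intro nn_integral_cong) (auto split: split_indicator)
      also have "\<dots> = emeasure (Q x) (C - Pair x -` N)" using sQ C Nx by (intro nn_integral_indicator) auto
      finally show ?thesis .
    qed
    have e2: "emeasure m2 C = (\<integral>\<^sup>+z. h (x, z) * indicator C z \<partial>\<mu>)" if C: "C \<in> sets M" for C
      unfolding m2_def using hx(1)[OF xM] C sets_mu by (intro emeasure_density) auto
    have "m1 = m2"
    proof (rule measure_eqI_generator_eq[where E=\<A> and \<Omega>="space M" and A="\<lambda>_. space M"])
      show "Int_stable \<A>" by (auto simp: Int_stable_def)
      show "\<A> \<subseteq> Pow (space M)" using A.space_closed .
      show "sets m1 = sigma_sets (space M) \<A>" "sets m2 = sigma_sets (space M) \<A>"
        unfolding m1_def m2_def using sQ A(3) sets_mu by auto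
      show "range (\<lambda>_. space M) \<subseteq> \<A>" "(\<Union>i. space M) = space M" by auto
      have "emeasure (Q x) (space M - Pair x -` N) \<le> emeasure (Q x) (space (Q x))"
        by (rule emeasure_space)
      also have "\<dots> = 1" using prob_space.emeasure_space_1[OF Qp(1)[OF xM]] .
      finally have "emeasure m1 (space M) \<le> 1" by (simp add: e1)
      then show "emeasure m1 (space M) \<noteq> \<infinity>" by (auto simp: top_unique)
      fix C assume C: "C \<in> \<A>"
      then have Cs: "C \<in> sets M" using subA by auto
      have "Pair x -` (space M \<times> C - N) = C - Pair x -` N" using xM by auto
      then show "emeasure m1 C = emeasure m2 C"
        using x C e1[OF Cs] e2[OF Cs] unfolding good_def by metis
    qed
    then show ?thesis using e1[OF C] e2[OF C] by simp
  qed
  \<comment> \<open>One factor vanishes almost everywhere on the separating set, the other almost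
    everywhere off it.\<close>
  have prod0: "(\<integral>\<^sup>+z. h (x, z) * h (y, z) \<partial>\<mu>) = 0"
    if x: "good x" and y: "good y" and s: "\<not> non_singular M (Q x) (Q y)" for x y
  proof -
    have xM: "x \<in> space M" "y \<in> space M" using x y by (auto simp: good_def)
    obtain C where C: "C \<in> sets M" "emeasure (Q x) C = 0" "emeasure (Q y) (space M - C) = 0"
      using s by (auto simp: non_singular_def)
    have "emeasure (Q x) (C - Pair x -` N) \<le> emeasure (Q x) C"
      using C Qp(2)[OF xM(1)] by (intro emeasure_mono) auto
    then have "(\<integral>\<^sup>+z. h (x, z) * indicator C z \<partial>\<mu>) = 0" using good_eq[OF x C(1)] C by simp
    moreover have "emeasure (Q y) (space M - C - Pair y -` N) \<le> emeasure (Q y) (space M - C)"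
      using C Qp(2)[OF xM(2)] by (intro emeasure_mono) auto
    then have "(\<integral>\<^sup>+z. h (y, z) * indicator (space M - C) z \<partial>\<mu>) = 0" using good_eq[OF y, of "space M - C"] C by simp
    ultimately have "AE z in \<mu>. h (x, z) * indicator C z = 0" "AE z in \<mu>. h (y, z) * indicator (space M - C) z = 0"
      using hx(1) xM C sets_mu by (simp_all add: nn_integral_0_iff_AE)
    then have "AE z in \<mu>. h (x, z) * h (y, z) = 0"
      using AE_space by eventually_elim (auto simp: space_mu split: split_indicator_asm)
    then show ?thesis by (rule nn_integral_zero')
  qed
  have good2: "AE p in \<mu> \<Otimes>\<^sub>M \<mu>. good (fst p) \<and> good (snd p)"
  proof -
    have dd: "distr (\<mu> \<Otimes>\<^sub>M \<mu>) \<mu> fst = \<mu>" "distr (\<mu> \<Otimes>\<^sub>M \<mu>) \<mu> snd = \<mu>"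
      using pair_measure_couplings[OF mu mu] by (auto simp: couplings_def)
    have "AE p in \<mu> \<Otimes>\<^sub>M \<mu>. good (fst p)"
      by (rule AE_distrD[OF measurable_fst], unfold dd, rule AE_good)
    moreover have "AE p in \<mu> \<Otimes>\<^sub>M \<mu>. good (snd p)"
      by (rule AE_distrD[OF measurable_snd], unfold dd, rule AE_good)
    ultimately show ?thesis by eventually_elim blast
  qed
  define q where "q z = (\<integral>\<^sup>+y. h (y, z) \<partial>\<mu>)" for z
  have h2: "(\<lambda>(x, z). h (x, z)) \<in> borel_measurable (\<mu> \<Otimes>\<^sub>M \<mu>)" 
    using h by (simp only: meas(2) split_beta' prod.collapse)
  have qm: "q \<in> borel_measurable \<mu>"
    unfolding q_def using mu.borel_measurable_nn_integral_fst[OF measurable_pair_swap[OF h2]] by simp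
  have "(\<integral>\<^sup>+z. q z * q z \<partial>\<mu>) = 0"
  proof -
    have "(\<integral>\<^sup>+z. q z * q z \<partial>\<mu>) = (\<integral>\<^sup>+z. \<integral>\<^sup>+x. h (x, z) * q z \<partial>\<mu> \<partial>\<mu>)"
      using hx space_mu by (intro nn_integral_cong) (simp add: q_def nn_integral_multc)
    also have "\<dots> = (\<integral>\<^sup>+x. \<integral>\<^sup>+z. h (x, z) * q z \<partial>\<mu> \<partial>\<mu>)"
      using h2 by (intro mu2.Fubini') (auto simp: split_beta' intro!: borel_measurable_times_ennreal measurable_compose[OF measurable_snd qm])
    also have "\<dots> = (\<integral>\<^sup>+x. \<integral>\<^sup>+z. \<integral>\<^sup>+y. h (x, z) * h (y, z) \<partial>\<mu> \<partial>\<mu> \<partial>\<mu>)"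
      using hx space_mu by (intro nn_integral_cong) (simp add: q_def nn_integral_cmult)
    also have "\<dots> = (\<integral>\<^sup>+x. \<integral>\<^sup>+y. \<integral>\<^sup>+z. h (x, z) * h (y, z) \<partial>\<mu> \<partial>\<mu> \<partial>\<mu>)"
    proof (rule nn_integral_cong)
      fix x assume "x \<in> space \<mu>"
      then have "(\<lambda>(y, z). h (x, z) * h (y, z)) \<in> borel_measurable (\<mu> \<Otimes>\<^sub>M \<mu>)"
        using h2 hx space_mu by (auto simp: split_beta' intro!: borel_measurable_times_ennreal measurable_compose[OF measurable_snd hx(1)])
      then show "(\<integral>\<^sup>+z. \<integral>\<^sup>+y. h (x, z) * h (y, z) \<partial>\<mu> \<partial>\<mu>) = (\<integral>\<^sup>+y. \<integral>\<^sup>+z. h (x, z) * h (y, z) \<partial>\<mu> \<partial>\<mu>)"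
        by (rule mu2.Fubini')
    qed
    also have "\<dots> = 0"
    proof -
      have "AE p in \<mu> \<Otimes>\<^sub>M \<mu>. (\<integral>\<^sup>+z. h (fst p, z) * h (snd p, z) \<partial>\<mu>) = 0"
        using sing good2 by eventually_elim (use prod0 in blast)
      from mu2.AE_pair[OF this] have "AE x in \<mu>. AE y in \<mu>. (\<integral>\<^sup>+z. h (x, z) * h (y, z) \<partial>\<mu>) = 0" by simp
      then have "AE x in \<mu>. (\<integral>\<^sup>+y. \<integral>\<^sup>+z. h (x, z) * h (y, z) \<partial>\<mu> \<partial>\<mu>) = 0"
        by eventually_elim (rule nn_integral_zero')
      then show ?thesis by (rule nn_integral_zero')
    qed
    finally show ?thesis .
  qed
  then have "AE z in \<mu>. q z = 0"
    using qm by (subst (asm) nn_integral_0_iff_AE) (auto intro: borel_measurable_times_ennreal)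
  then have "(\<integral>\<^sup>+z. q z \<partial>\<mu>) = 0" by (rule nn_integral_zero')
  then have "(\<integral>\<^sup>+x. \<integral>\<^sup>+z. h (x, z) \<partial>\<mu> \<partial>\<mu>) = 0"
    unfolding q_def using mu2.Fubini'[OF h2] by simp
  then have "AE x in \<mu>. (\<integral>\<^sup>+z. h (x, z) \<partial>\<mu>) = 0"
    using mu.borel_measurable_nn_integral_fst[OF h2] by (subst (asm) nn_integral_0_iff_AE) auto
  moreover have "AE x in \<mu>. emeasure \<mu> (Pair x -` N) = 0"
  proof -
    have N': "N \<in> sets (\<mu> \<Otimes>\<^sub>M \<mu>)" using N sets_mu2 by simp
    have "(\<integral>\<^sup>+x. emeasure \<mu> (Pair x -` N) \<partial>\<mu>) = 0"
      using muN mu.emeasure_pair_measure_alt[OF N'] by simp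
    then show ?thesis
      using mu.measurable_emeasure_Pair[OF N'] by (subst (asm) nn_integral_0_iff_AE) auto
  qed
  \<comment> \<open>The density of \<open>Q x\<close> vanishes and the section of \<open>N\<close>
    at \<open>x\<close> is null for \<open>\<mu>\<close>; so the complement of this section
    separates \<open>Q x\<close> from \<open>\<mu>\<close>.\<close>
  ultimately show ?thesis using AE_good
  proof eventually_elim
    fix x assume 0: "(\<integral>\<^sup>+z. h (x, z) \<partial>\<mu>) = 0" "emeasure \<mu> (Pair x -` N) = 0" and x: "good x"
    then have xM: "x \<in> space M" by (simp add: good_def)
    have Nx: "Pair x -` N \<in> sets M" by (rule sets_Pair1[OF N])
    have "(\<integral>\<^sup>+z. h (x, z) * indicator (space M) z \<partial>\<mu>) = (\<integral>\<^sup>+z. h (x, z) \<partial>\<mu>)"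
      by (intro nn_integral_cong) (simp add: space_mu)
    then have "emeasure (Q x) (space M - Pair x -` N) = 0" using good_eq[OF x sets.top] 0 by simp
    moreover have "space M - (space M - Pair x -` N) = Pair x -` N"
      using sets.sets_into_space[OF Nx] by auto
    ultimately show "\<not> non_singular M (Q x) \<mu>"
      unfolding non_singular_def using Nx 0(2) by (auto intro!: bexI[of _ "space M - Pair x -` N"])
  qed
qed

end

lemma (in prob_space) AE_imp_ex:
  assumes "AE x in M. Q x" shows "\<exists>x\<in>space M. Q x"
proof (rule ccontr)
  assume neg: "\<not> ?thesis"
  have "AE x in M. False" using assms AE_space by eventually_elim (use neg in auto)
  then show False by (simp add: AE_False)
qed

section \<open>Null sets and weak irreducibility in terms of n-step laws\<close>

context stationary_kernel
begin

lemma emeasure_nstep_Suc: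
  assumes x: "x \<in> space M" and A: "A \<in> sets M"
  shows "emeasure (nstep M P (Suc n) x) A = (\<integral>\<^sup>+z. emeasure (nstep M P n z) A \<partial>P x)"
  using nstep_add[OF x, of "Suc 0" n] emeasure_bind_prob_algebra[OF P_in[OF x] nstep_measurable A, of n]
  by (simp only: nstep_1[OF x]) simp

lemma emeasure_nstep_measurable:
  assumes "A \<in> sets M" shows "(\<lambda>x. emeasure (nstep M P n x) A) \<in> borel_measurable M"
  by (rule measurable_compose[OF nstep_subprob measurable_emeasure_subprob_algebra[OF assms]])

text \<open>By invariance the n-step probabilities of \<open>A\<close> have mean
  \<open>emeasure \<mu> A\<close>.\<close>

lemma AE_nstep_null:
  assumes A: "A \<in> sets M" and 0: "emeasure \<mu> A = 0"
  shows "AE x in \<mu>. \<forall>n. emeasure (nstep M P n x) A = 0"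
proof (subst AE_all_countable, rule allI)
  fix n
  have "(\<integral>\<^sup>+x. emeasure (nstep M P n x) A \<partial>\<mu>) = 0"
    using emeasure_bind_prob_algebra[OF mu nstep_measurable A] 0 nstep_invariant by simp
  moreover have "(\<lambda>x. emeasure (nstep M P n x) A) \<in> borel_measurable \<mu>"
    using emeasure_nstep_measurable[OF A] measurable_cong_sets[OF sets_mu refl] by blast
  ultimately show "AE x in \<mu>. emeasure (nstep M P n x) A = 0"
    by (rule iffD1[OF nn_integral_0_iff_AE, rotated])
qed

text \<open>The event of ever visiting \<open>A\<close> is a countable union over times, so its
  probability is positive only if some n-step probability is.\<close>

lemma weakly_irreducibleE:
  assumes "weakly_irreducible M P \<mu>"
  obtains \<phi> E0 where "sets \<phi> = sets M" "emeasure \<phi> (space M) > 0" "E0 \<in> sets M" "emeasure \<mu> E0 = 1"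
    "\<And>x A. x \<in> E0 \<Longrightarrow> A \<in> sets M \<Longrightarrow> emeasure \<phi> A > 0 \<Longrightarrow> \<exists>n\<ge>1. emeasure (nstep M P n x) A > 0"
proof -
  from assms obtain \<phi> E0 where *: "sets \<phi> = sets M" "emeasure \<phi> (space M) > 0" "E0 \<in> sets M" "emeasure \<mu> E0 = 1"
    and irr: "\<forall>x\<in>E0. \<forall>A\<in>sets M. emeasure \<phi> A > 0 \<longrightarrow>
      emeasure (chain_law M P x) (\<Union>n \<in> {1..}. {\<omega> \<in> space (path_space M). \<omega> n \<in> A}) > 0"
    unfolding weakly_irreducible_def by (elim exE conjE) (rule that)
  have "\<exists>n\<ge>1. emeasure (nstep M P n x) A > 0" if "x \<in> E0" "A \<in> sets M" "emeasure \<phi> A > 0" for x A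
  proof (rule ccontr)
    assume neg: "\<not> (\<exists>n\<ge>1. emeasure (nstep M P n x) A > 0)"
    have x: "x \<in> space M" using that(1) sets.sets_into_space[OF *(3)] by blast
    have "{\<omega> \<in> space (path_space M). \<omega> n \<in> A} = (\<lambda>\<omega>. \<omega> n) -` A \<inter> space (path_space M)" for n by auto
    then have s: "{\<omega> \<in> space (path_space M). \<omega> n \<in> A} \<in> sets (chain_law M P x)" for n
      using measurable_sets[OF path_component_measurable that(2)] prob_algebraD(2)[OF chain_law_prob[OF x]] by simp
    have "(\<Union>n \<in> {1..}. {\<omega> \<in> space (path_space M). \<omega> n \<in> A}) \<in> null_sets (chain_law M P x)"
      using neg s emeasure_chain_law_component[OF x that(2)]
      by (intro null_sets_UN') (auto simp: null_sets_def not_less)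
    then have 0: "emeasure (chain_law M P x) (\<Union>n \<in> {1..}. {\<omega> \<in> space (path_space M). \<omega> n \<in> A}) = 0"
      by (rule null_setsD1)
    show False using irr[rule_format, OF that] unfolding 0 by simp
  qed
  then show ?thesis using that * by blast
qed

lemma AE_mem_of_full:
  assumes "A \<in> sets M" "emeasure \<mu> A = 1" shows "AE x in \<mu>. x \<in> A"
  using assms sets_mu by (intro mu.AE_prob_1) (auto simp: measure_def)

lemma AE_ex:
  assumes "AE x in \<mu>. Q x" shows "\<exists>x\<in>space M. Q x"
  using mu.AE_imp_ex[OF assms] by (simp add: space_mu)

lemma ex_of_pos:
  assumes "AE x in \<mu>. Q x" "emeasure \<mu> A > 0" "A \<in> sets M" shows "\<exists>x\<in>A. Q x"
proof (rule ccontr)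
  assume neg: "\<not> ?thesis"
  have "AE x in \<mu>. x \<notin> A" using assms(1) by eventually_elim (use neg in auto)
  then have "emeasure \<mu> A = 0"
    using assms(3) sets_mu sets.sets_into_space[OF assms(3)] space_mu
    by (subst (asm) AE_iff_measurable[of A]) auto
  then show False using assms(2) by simp
qed

text \<open>Otherwise almost every state has all its n-step laws, n at least 1, singular to
  \<open>\<mu>\<close>. Taking such a state in \<open>E0\<close>, all these laws live on one set
  that is null for \<open>\<mu>\<close>, so irreducibility forces \<open>\<phi>\<close> to charge
  that set. Almost every state never enters it, which contradicts irreducibility for another state
  of \<open>E0\<close>.\<close>

lemma weakly_irreducible_non_singular:
  assumes "weakly_irreducible M P \<mu>"
  shows "\<exists>n\<ge>1. \<not> (AE p in \<mu> \<Otimes>\<^sub>M \<mu>. \<not> non_singular M (nstep M P n (fst p)) (nstep M P n (snd p)))"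
proof (rule ccontr)
  assume "\<not> ?thesis"
  then have "AE x in \<mu>. \<not> non_singular M (nstep M P n x) \<mu>" if "n \<ge> 1" for n
    using that by (intro singular_kernels_imp_singular_invariant nstep_measurable) blast
  then have AE_sing: "AE x in \<mu>. \<forall>n. n \<ge> 1 \<longrightarrow> \<not> non_singular M (nstep M P n x) \<mu>"
    by (subst AE_all_countable) (auto intro: AE_impI)
  obtain \<phi> E0 where phi: "sets \<phi> = sets M" "emeasure \<phi> (space M) > 0" "E0 \<in> sets M" "emeasure \<mu> E0 = 1"
    and irr: "\<And>x A. x \<in> E0 \<Longrightarrow> A \<in> sets M \<Longrightarrow> emeasure \<phi> A > 0 \<Longrightarrow> \<exists>n\<ge>1. emeasure (nstep M P n x) A > 0"
    using weakly_irreducibleE[OF assms] by metis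
  have E0: "AE x in \<mu>. x \<in> E0" using phi by (intro AE_mem_of_full)
  have "AE x in \<mu>. x \<in> E0 \<and> (\<forall>n. n \<ge> 1 \<longrightarrow> \<not> non_singular M (nstep M P n x) \<mu>)"
    using AE_sing E0 by eventually_elim blast
  then obtain x where x: "x \<in> E0" "\<And>n. n \<ge> 1 \<Longrightarrow> \<not> non_singular M (nstep M P n x) \<mu>"
    using AE_ex by blast
  have xM: "x \<in> space M" using x(1) sets.sets_into_space[OF phi(3)] by blast
  have "\<forall>n. \<exists>A. n \<ge> 1 \<longrightarrow> A \<in> sets M \<and> emeasure (nstep M P n x) A = 0 \<and> emeasure \<mu> (space M - A) = 0"
    using x(2) unfolding non_singular_def by blast
  then obtain A where A: "\<And>n. n \<ge> 1 \<Longrightarrow> A n \<in> sets M" "\<And>n. n \<ge> 1 \<Longrightarrow> emeasure (nstep M P n x) (A n) = 0"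
    "\<And>n. n \<ge> 1 \<Longrightarrow> emeasure \<mu> (space M - A n) = 0" by metis
  \<comment> \<open>A single set that is null for \<open>\<mu>\<close> and carries every n-step law
    of \<open>x\<close> with n at least 1.\<close>
  define B where "B = (\<Union>n\<in>{1..}. space M - A n)"
  have B: "B \<in> sets M" unfolding B_def using A(1) by (intro sets.countable_UN') auto
  have "B \<in> null_sets \<mu>" unfolding B_def
    using A sets_mu by (intro null_sets_UN') (auto simp: null_sets_def)
  then have muB: "emeasure \<mu> B = 0" by auto
  have "emeasure (nstep M P n x) (space M - B) = 0" if n: "n \<ge> 1" for n
  proof -
    have "emeasure (nstep M P n x) (space M - B) \<le> emeasure (nstep M P n x) (A n)"
      using n A(1)[OF n] prob_algebraD(2)[OF nstep_in[OF xM]] by (intro emeasure_mono) (auto simp: B_def)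
    then show ?thesis using A(2)[OF n] by simp
  qed
  then have "\<not> emeasure \<phi> (space M - B) > 0" using irr[OF x(1), of "space M - B"] B
    by (metis less_irrefl sets.compl_sets)
  moreover have "emeasure \<phi> (space M) \<le> emeasure \<phi> B + emeasure \<phi> (space M - B)"
    using emeasure_subadditive[of B \<phi> "space M - B"] B phi(1) sets.sets_into_space[OF B] by (simp add: Un_absorb1)
  ultimately have phiB: "emeasure \<phi> B > 0" using phi(2) by (auto simp: not_less)
  have "AE y in \<mu>. y \<in> E0 \<and> (\<forall>n. emeasure (nstep M P n y) B = 0)"
    using AE_nstep_null[OF B muB] E0 by eventually_elim blast
  then obtain y where "y \<in> E0" "\<forall>n. emeasure (nstep M P n y) B = 0" using AE_ex by blast
  then show False using irr[OF _ B phiB] by (metis less_irrefl)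
qed

section \<open>Classes of states at limiting distance zero and their motion\<close>

definition cls :: "'a \<Rightarrow> 'a set" where
  "cls w = {y \<in> space M. dist_lim (w, y) = 0}"

lemma dist_lim_zero_sets: "{p \<in> space (M \<Otimes>\<^sub>M M). dist_lim p = 0} \<in> sets (M \<Otimes>\<^sub>M M)"
proof -
  have "{p \<in> space (M \<Otimes>\<^sub>M M). dist_lim p = 0} = dist_lim -` {0} \<inter> space (M \<Otimes>\<^sub>M M)" by auto
  then show ?thesis using measurable_sets[OF dist_lim_measurable] by simp
qed

lemma cls_eq_Pair: "w \<in> space M \<Longrightarrow> cls w = Pair w -` {p \<in> space (M \<Otimes>\<^sub>M M). dist_lim p = 0}"
  by (auto simp: cls_def in_M2)

lemma cls_sets: "w \<in> space M \<Longrightarrow> cls w \<in> sets M"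
  unfolding cls_eq_Pair by (rule sets_Pair1[OF dist_lim_zero_sets])

lemma cls_rel:
  assumes "w \<in> space M" "x \<in> cls w" "y \<in> cls w" shows "dist_lim (x, y) = 0"
proof -
  have xy: "x \<in> space M" "y \<in> space M" "dist_lim (w, x) = 0" "dist_lim (w, y) = 0" using assms by (auto simp: cls_def)
  then have "dist_lim (x, y) \<le> 0" using dist_lim_triangle[OF xy(1) assms(1) xy(2)] dist_lim_sym[of x w] by simp
  then show ?thesis using dist_lim_bounds[of "(x, y)"] xy by (auto simp: in_M2)
qed

lemma cls_eq_or_disjoint:
  assumes "v \<in> space M" "w \<in> space M" shows "cls v = cls w \<or> cls v \<inter> cls w = {}"
proof (rule disjCI)
  assume "cls v \<inter> cls w \<noteq> {}"
  then obtain u where u: "u \<in> cls v" "u \<in> cls w" by auto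
  then have uM: "u \<in> space M" by (simp add: cls_def)
  have *: "cls w \<subseteq> cls u" if "w \<in> space M" "u \<in> cls w" for u w
    using cls_rel[OF that] by (auto simp: cls_def)
  have "w \<in> cls u" "v \<in> cls u"
    using u assms dist_lim_sym by (auto simp: cls_def)
  then show "cls v = cls w"
    using *[OF assms(1) u(1)] *[OF assms(2) u(2)] *[OF uM \<open>w \<in> cls u\<close>] *[OF uM \<open>v \<in> cls u\<close>] by auto
qed

text \<open>If all classes were null, then by Fubini \<open>dist_lim\<close> would be positive for
  almost every pair, and almost every pair would be mutually singular at all times.\<close>

lemma weakly_irreducible_ex_cls:
  assumes "weakly_irreducible M P \<mu>"
  shows "\<exists>w\<in>space M. emeasure \<mu> (cls w) > 0"
proof (rule ccontr)
  assume "\<not> ?thesis"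
  then have 0: "emeasure \<mu> (cls w) = 0" if "w \<in> space M" for w using that by auto
  define S where "S = {p \<in> space (M \<Otimes>\<^sub>M M). dist_lim p = 0}"
  have S: "S \<in> sets (\<mu> \<Otimes>\<^sub>M \<mu>)" using dist_lim_zero_sets sets_mu2 by (simp add: S_def)
  have "emeasure (\<mu> \<Otimes>\<^sub>M \<mu>) S = (\<integral>\<^sup>+w. emeasure \<mu> (Pair w -` S) \<partial>\<mu>)"
    by (rule mu.emeasure_pair_measure_alt[OF S])
  also have "\<dots> = 0"
    using 0 cls_eq_Pair by (intro nn_integral_zero' AE_I2) (simp add: S_def space_mu)
  finally have "AE p in \<mu> \<Otimes>\<^sub>M \<mu>. p \<notin> S" using S by (intro AE_not_in) auto
  then have "AE p in \<mu> \<Otimes>\<^sub>M \<mu>. \<not> non_singular M (nstep M P n (fst p)) (nstep M P n (snd p))" for n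
    using AE_dist_lim_non_singular AE_space
    by eventually_elim (auto simp: S_def space_mu2 in_M2)
  then show False using weakly_irreducible_non_singular[OF assms] by blast
qed

text \<open>Compare a typical \<open>y\<close> of the class with almost every other member
  \<open>x\<close>. As \<open>dist_lim\<close> vanishes almost everywhere for the product of their
  one-step laws, \<open>P x\<close> lives on the class of \<open>z\<close> for almost every
  \<open>z\<close> drawn from \<open>P y\<close>. Exchanging the order of \<open>x\<close> and
  \<open>z\<close> gives one \<open>z\<close> that serves almost all \<open>x\<close>.\<close>

lemma cls_step:
  assumes w: "w \<in> space M" and pos: "emeasure \<mu> (cls w) > 0"
  shows "\<exists>w'\<in>space M. AE x in \<mu>. x \<in> cls w \<longrightarrow> emeasure (P x) (space M - cls w') = 0"
proof -
  from mu2.AE_pair[OF AE_dist_lim_constant]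
  obtain y where y: "y \<in> cls w" and AE_y: "AE x in \<mu>. \<forall>n. AE q in nstep2 n (y, x). dist_lim q = dist_lim (y, x)"
    using ex_of_pos[OF _ pos cls_sets[OF w]] by blast
  have yM: "y \<in> space M" using y by (simp add: cls_def)
  note py = prob_algebraD[OF P_in[OF yM]]
  interpret Py: prob_space "P y" by (rule py)
  interpret muPy: pair_sigma_finite \<mu> "P y" ..
  define good where "good x z \<longleftrightarrow> (x \<in> cls w \<longrightarrow> emeasure (P x) (space M - cls z) = 0)" for x z
  have "AE x in \<mu>. AE z in P y. good x z"
    using AE_y AE_space
  proof eventually_elim
    fix x assume c: "\<forall>n. AE q in nstep2 n (y, x). dist_lim q = dist_lim (y, x)" and "x \<in> space \<mu>"
    then have xM: "x \<in> space M" by (simp add: space_mu)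
    note px = prob_algebraD[OF P_in[OF xM]]
    interpret Px: prob_space "P x" by (rule px)
    interpret PyPx: pair_prob_space "P y" "P x" ..
    show "AE z in P y. good x z"
    proof (cases "x \<in> cls w")
      case True
      have "nstep2 (Suc 0) (y, x) = P y \<Otimes>\<^sub>M P x"
        unfolding nstep2_def fst_conv snd_conv nstep_1[OF yM] nstep_1[OF xM] ..
      then have "AE q in P y \<Otimes>\<^sub>M P x. dist_lim q = 0"
        using c[rule_format, of "Suc 0"] cls_rel[OF w y True] by (simp only:)
      from PyPx.AE_pair[OF this] AE_space show ?thesis
      proof eventually_elim
        fix z assume z: "AE u in P x. dist_lim (z, u) = 0" "z \<in> space (P y)"
        then have zM: "z \<in> space M" using py by simp
        have "AE u in P x. u \<notin> space M - cls z"
          using z(1) by eventually_elim (auto simp: cls_def)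
        then have "emeasure (P x) (space M - cls z) = 0"
          using cls_sets[OF zM] px by (subst (asm) AE_iff_measurable[of "space M - cls z"]) auto
        then show "good x z" by (simp add: good_def)
      qed
    qed (simp add: good_def)
  qed
  \<comment> \<open>Exchanging the two almost-everywhere quantifiers requires the relation to be
    jointly measurable.\<close>
  moreover have "{p \<in> space (\<mu> \<Otimes>\<^sub>M P y). good (fst p) (snd p)} \<in> sets (\<mu> \<Otimes>\<^sub>M P y)"
  proof -
    have s: "sets (\<mu> \<Otimes>\<^sub>M P y) = sets (M \<Otimes>\<^sub>M M)" using sets_mu py by (intro sets_pair_measure_cong)
    have sp: "space (\<mu> \<Otimes>\<^sub>M P y) = space (M \<Otimes>\<^sub>M M)" by (rule sets_eq_imp_space_eq[OF s])
    define S where "S = {p \<in> space (M \<Otimes>\<^sub>M M). dist_lim p = 0}"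
    have m: "(\<lambda>p. (snd (fst p), snd p)) \<in> (M \<Otimes>\<^sub>M M) \<Otimes>\<^sub>M M \<rightarrow>\<^sub>M M \<Otimes>\<^sub>M M"
      by (intro measurable_Pair measurable_compose[OF measurable_fst measurable_snd] measurable_snd)
    have "Sigma (space (M \<Otimes>\<^sub>M M)) (\<lambda>p. space M - cls (snd p)) 
        = (\<lambda>p. (snd (fst p), snd p)) -` (space (M \<Otimes>\<^sub>M M) - S) \<inter> space ((M \<Otimes>\<^sub>M M) \<Otimes>\<^sub>M M)"
      by (auto simp: S_def cls_def space_pair_measure)
    also have "\<dots> \<in> sets ((M \<Otimes>\<^sub>M M) \<Otimes>\<^sub>M M)"
      using dist_lim_zero_sets by (intro measurable_sets[OF m]) (auto simp: S_def)
    finally have "(\<lambda>p. emeasure (P (fst p)) (space M - cls (snd p))) \<in> borel_measurable (M \<Otimes>\<^sub>M M)"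
      by (rule emeasure_measurable_subprob_algebra2[OF _ measurable_compose[OF measurable_fst P_subprob]])
    from measurable_sets[OF this, of "{0}"]
    have "{p \<in> space (M \<Otimes>\<^sub>M M). emeasure (P (fst p)) (space M - cls (snd p)) = 0} \<in> sets (M \<Otimes>\<^sub>M M)"
      by (simp add: vimage_def Int_def conj_commute)
    moreover have "fst -` (space M - cls w) \<inter> space (M \<Otimes>\<^sub>M M) \<in> sets (M \<Otimes>\<^sub>M M)"
      using cls_sets[OF w] by (intro measurable_sets[OF measurable_fst]) auto
    ultimately have "{p \<in> space (M \<Otimes>\<^sub>M M). emeasure (P (fst p)) (space M - cls (snd p)) = 0} \<union>
      (fst -` (space M - cls w) \<inter> space (M \<Otimes>\<^sub>M M)) \<in> sets (M \<Otimes>\<^sub>M M)" by (rule sets.Un)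
    moreover have "{p \<in> space (M \<Otimes>\<^sub>M M). emeasure (P (fst p)) (space M - cls (snd p)) = 0} \<union>
      (fst -` (space M - cls w) \<inter> space (M \<Otimes>\<^sub>M M)) = {p \<in> space (M \<Otimes>\<^sub>M M). good (fst p) (snd p)}"
      by (auto simp: good_def in_M2)
    ultimately show ?thesis using s sp by simp
  qed
  \<comment> \<open>Now the successor \<open>z\<close> is chosen before \<open>x\<close>, and its
    class is the target.\<close>
  ultimately have "AE z in P y. AE x in \<mu>. good x z"
    using muPy.AE_commute[of good] by blast
  then have "AE z in P y. z \<in> space M \<and> (AE x in \<mu>. good x z)"
    using AE_space by eventually_elim (simp add: py)
  then obtain z where "z \<in> space M" "AE x in \<mu>. good x z"
    using Py.AE_imp_ex by blast
  then show ?thesis by (auto simp: good_def)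
qed


text \<open>The members of the next set that fail at horizon \<open>n\<close> form a null set, and
  by invariance almost no state moves into a null set.\<close>

lemma AE_iterate:
  fixes K :: "nat \<Rightarrow> 'a set"
  assumes K: "\<And>m. K m \<in> sets M"
    and step: "\<And>m. AE x in \<mu>. x \<in> K m \<longrightarrow> emeasure (P x) (space M - K (Suc m)) = 0"
  shows "AE x in \<mu>. x \<in> K m \<longrightarrow> emeasure (nstep M P n x) (space M - K (m + n)) = 0"
proof (induction n arbitrary: m)
  case 0
  show ?case using K[of m] by (intro AE_I2) (auto simp: space_mu)
next
  case (Suc n)
  \<comment> \<open>The states of the next set for which the induction hypothesis fails.\<close>
  define N where "N = {z \<in> K (Suc m). emeasure (nstep M P n z) (space M - K (Suc m + n)) \<noteq> 0}"
  have m: "(\<lambda>z. emeasure (nstep M P n z) (space M - K (Suc m + n))) \<in> borel_measurable M"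
    using K by (intro emeasure_nstep_measurable) auto
  have "N = K (Suc m) - ((\<lambda>z. emeasure (nstep M P n z) (space M - K (Suc m + n))) -` {0} \<inter> space M)"
    using sets.sets_into_space[OF K] by (auto simp: N_def)
  then have N: "N \<in> sets M" using K measurable_sets[OF m, of "{0}"] by auto
  have "AE z in \<mu>. z \<notin> N" using Suc[of "Suc m"] by eventually_elim (auto simp: N_def)
  then have "emeasure \<mu> N = 0"
    using N sets_mu sets.sets_into_space[OF N] space_mu by (subst (asm) AE_iff_measurable[of N]) auto
  from AE_nstep_null[OF N this] step[of m] AE_space
  show ?case
  proof eventually_elim
    fix x assume 0: "\<forall>n. emeasure (nstep M P n x) N = 0" and s: "x \<in> K m \<longrightarrow> emeasure (P x) (space M - K (Suc m)) = 0"
      and "x \<in> space \<mu>"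
    then have x: "x \<in> space M" by (simp add: space_mu)
    note p = prob_algebraD[OF P_in[OF x]]
    have N0: "emeasure (P x) N = 0" using 0[rule_format, of "Suc 0"] unfolding nstep_1[OF x] .
    show "x \<in> K m \<longrightarrow> emeasure (nstep M P (Suc n) x) (space M - K (m + Suc n)) = 0"
    proof
      assume xK: "x \<in> K m"
      have "AE z in P x. z \<notin> N" using N0 N p by (intro AE_not_in) (auto simp: null_sets_def)
      moreover have "AE z in P x. z \<notin> space M - K (Suc m)"
        using s xK K p by (intro AE_not_in) (auto simp: null_sets_def)
      ultimately have "AE z in P x. emeasure (nstep M P n z) (space M - K (m + Suc n)) = 0"
        using AE_space by eventually_elim (auto simp: N_def p)
      then have "(\<integral>\<^sup>+z. emeasure (nstep M P n z) (space M - K (m + Suc n)) \<partial>P x) = 0" by (rule nn_integral_zero')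
      then show "emeasure (nstep M P (Suc n) x) (space M - K (m + Suc n)) = 0"
        using K by (subst emeasure_nstep_Suc[OF x]) auto
    qed
  qed
qed

text \<open>States of \<open>C\<close> almost never leave it, so irreducibility from one of them
  shows that \<open>\<phi>\<close> lives on \<open>C\<close> and charges it. Conversely, states
  inside \<open>C\<close> already account for all of the invariant mass of \<open>C\<close>, so
  almost no state outside can ever enter it; irreducibility from an outside state would require
  that.\<close>

lemma closed_set_full:
  assumes wi: "weakly_irreducible M P \<mu>" and C: "C \<in> sets M" and pos: "emeasure \<mu> C > 0"
    and cl: "AE x in \<mu>. x \<in> C \<longrightarrow> emeasure (P x) (space M - C) = 0"
  shows "AE x in \<mu>. x \<in> C"
proof -
  obtain \<phi> E0 where phi: "sets \<phi> = sets M" "emeasure \<phi> (space M) > 0" "E0 \<in> sets M" "emeasure \<mu> E0 = 1"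
    and irr: "\<And>x A. x \<in> E0 \<Longrightarrow> A \<in> sets M \<Longrightarrow> emeasure \<phi> A > 0 \<Longrightarrow> \<exists>n\<ge>1. emeasure (nstep M P n x) A > 0"
    using weakly_irreducibleE[OF wi] by metis
  have E0: "AE x in \<mu>. x \<in> E0" using phi by (intro AE_mem_of_full)
  have stay: "AE x in \<mu>. \<forall>n. x \<in> C \<longrightarrow> emeasure (nstep M P n x) (space M - C) = 0"
    using AE_iterate[of "\<lambda>_. C"] C cl by (subst AE_all_countable) auto
  have "AE x in \<mu>. x \<in> E0 \<and> (\<forall>n. x \<in> C \<longrightarrow> emeasure (nstep M P n x) (space M - C) = 0)"
    using E0 stay by eventually_elim blast
  from ex_of_pos[OF this pos C] obtain x where x: "x \<in> E0" "\<And>n. emeasure (nstep M P n x) (space M - C) = 0"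
    by blast
  then have "\<not> emeasure \<phi> (space M - C) > 0" using irr[OF x(1), of "space M - C"] C
    by (metis less_irrefl sets.compl_sets)
  moreover have "emeasure \<phi> (space M) \<le> emeasure \<phi> C + emeasure \<phi> (space M - C)"
    using emeasure_subadditive[of C \<phi> "space M - C"] C phi(1) sets.sets_into_space[OF C] by (simp add: Un_absorb1)
  ultimately have phiC: "emeasure \<phi> C > 0" using phi(2) by (auto simp: not_less)
  \<comment> \<open>By invariance the mass of \<open>C\<close> equals the mass of \<open>C\<close>,
    contributed by the states inside, plus the mass arriving from outside; hence the latter is
    zero.\<close>
  have leave: "AE x in \<mu>. x \<notin> C \<longrightarrow> emeasure (nstep M P n x) C = 0" for n
  proof -
    have Cm: "(\<lambda>x. emeasure (nstep M P n x) C) \<in> borel_measurable \<mu>"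
      using emeasure_nstep_measurable[OF C] measurable_cong_sets[OF sets_mu refl] by blast
    have full: "emeasure (nstep M P n x) C = 1"
      if "x \<in> space M" "emeasure (nstep M P n x) (space M - C) = 0" for x
    proof -
      note p = prob_algebraD[OF nstep_in[OF that(1), of n]]
      interpret Q: prob_space "nstep M P n x" by (rule p)
      have "measure (nstep M P n x) (space M - C) = 0" using that(2) by (simp add: measure_def)
      then show ?thesis using Q.prob_compl[of C] C p by (simp add: Q.emeasure_eq_measure)
    qed
    have "emeasure \<mu> C = (\<integral>\<^sup>+x. emeasure (nstep M P n x) C \<partial>\<mu>)"
      using emeasure_bind_prob_algebra[OF mu nstep_measurable C, of n] nstep_invariant by simp
    also have "\<dots> = (\<integral>\<^sup>+x. indicator C x + emeasure (nstep M P n x) C * indicator (space M - C) x \<partial>\<mu>)"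
      using stay AE_space
    proof (intro nn_integral_cong_AE, eventually_elim)
      fix x assume "\<forall>n. x \<in> C \<longrightarrow> emeasure (nstep M P n x) (space M - C) = 0" "x \<in> space \<mu>"
      then show "emeasure (nstep M P n x) C = indicator C x + emeasure (nstep M P n x) C * indicator (space M - C) x"
        using full[of x] by (cases "x \<in> C") (auto simp: space_mu)
    qed
    also have "\<dots> = emeasure \<mu> C + (\<integral>\<^sup>+x. emeasure (nstep M P n x) C * indicator (space M - C) x \<partial>\<mu>)"
      using C Cm sets_mu by (subst nn_integral_add) (auto intro!: borel_measurable_times_ennreal)
    finally have "(\<integral>\<^sup>+x. emeasure (nstep M P n x) C * indicator (space M - C) x \<partial>\<mu>) = 0"
      using mu.emeasure_finite[of C] by (simp add: ennreal_add_left_cancel[of "emeasure \<mu> C" 0, simplified])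
    moreover have "(\<lambda>x. emeasure (nstep M P n x) C * indicator (space M - C) x) \<in> borel_measurable \<mu>"
      using C Cm sets_mu by (intro borel_measurable_times_ennreal) auto
    ultimately have "AE x in \<mu>. emeasure (nstep M P n x) C * indicator (space M - C) x = 0"
      by (intro iffD1[OF nn_integral_0_iff_AE])
    then show ?thesis using AE_space by eventually_elim (auto simp: space_mu split: split_indicator_asm)
  qed
  then have "AE x in \<mu>. \<forall>n. x \<notin> C \<longrightarrow> emeasure (nstep M P n x) C = 0" by (subst AE_all_countable) auto
  then show ?thesis using E0
  proof eventually_elim
    fix x assume a: "\<forall>n. x \<notin> C \<longrightarrow> emeasure (nstep M P n x) C = 0" "x \<in> E0"
    show "x \<in> C" using irr[OF a(2) C phiC] a(1) by (metis less_irrefl)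
  qed
qed

text \<open>Classes are equal or disjoint, and a probability measure has room for finitely many
  disjoint sets of mass at least \<open>c\<close>.\<close>

lemma ex_repeated_cls:
  assumes w: "\<And>i. w i \<in> space M" and pos: "c > 0" "\<And>i::nat. emeasure \<mu> (cls (w i)) \<ge> c"
  shows "\<exists>i d. d > 0 \<and> cls (w i) = cls (w (i + d))"
proof (rule ccontr)
  assume neg: "\<not> ?thesis"
  have dis: "cls (w i) \<noteq> cls (w j)" if "i < j" for i j
    using neg that by (metis less_imp_add_positive)
  have disj: "disjoint_family (\<lambda>i. cls (w i))"
    unfolding disjoint_family_on_def
  proof (intro ballI impI)
    fix i j :: nat assume "i \<noteq> j"
    then have "cls (w i) \<noteq> cls (w j)" using dis[of i j] dis[of j i] by (cases "i < j") auto
    then show "cls (w i) \<inter> cls (w j) = {}" using cls_eq_or_disjoint[OF w w] by blast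
  qed
  have le: "of_nat n * c \<le> 1" for n :: nat
  proof -
    have "of_nat n * c = (\<Sum>i<n. c)" by simp
    also have "\<dots> \<le> (\<Sum>i<n. emeasure \<mu> (cls (w i)))" by (intro sum_mono pos)
    also have "\<dots> = emeasure \<mu> (\<Union>i<n. cls (w i))"
      using disj cls_sets[OF w] sets_mu by (intro sum_emeasure) (auto simp: disjoint_family_on_def)
    also have "\<dots> \<le> 1" by (rule mu.emeasure_le_1)
    finally show ?thesis .
  qed
  have c1: "c \<le> 1" using le[of 1] by simp
  obtain r where r: "c = ennreal r" "r > 0"
    using pos(1) c1 by (cases c) (auto simp: top_unique)
  obtain n :: nat where n: "real n * r > 1" using reals_Archimedean3[OF r(2)] by blast
  have "ennreal (real n * r) \<le> 1" using le[of n] r by (simp add: ennreal_mult' ennreal_of_nat_eq_real_of_nat)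
  then have "real n * r \<le> 1" by (simp add: ennreal_le_1)
  then show False using n by simp
qed

text \<open>By invariance the mass of the next class is the mean probability of moving into it,
  hence at least the mass of the present class. The uniform lower bound along the sequence is what
  forces a repetition.\<close>

lemma cls_sequence:
  assumes w0: "w0 \<in> space M" and pos: "emeasure \<mu> (cls w0) > 0"
  obtains w where "\<And>i. w i \<in> space M" "\<And>i. emeasure \<mu> (cls (w i)) \<ge> emeasure \<mu> (cls w0)"
    "\<And>i::nat. AE x in \<mu>. x \<in> cls (w i) \<longrightarrow> emeasure (P x) (space M - cls (w (Suc i))) = 0"
proof -
  define good where "good u \<longleftrightarrow> u \<in> space M \<and> emeasure \<mu> (cls u) \<ge> emeasure \<mu> (cls w0)" for u
  have succ_ex: "\<exists>v. good v \<and> (AE x in \<mu>. x \<in> cls u \<longrightarrow> emeasure (P x) (space M - cls v) = 0)" if u: "good u" for u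
  proof -
    have uM: "u \<in> space M" and up: "emeasure \<mu> (cls u) > 0" using u pos by (auto simp: good_def intro: less_le_trans)
    obtain v where v: "v \<in> space M" and AE: "AE x in \<mu>. x \<in> cls u \<longrightarrow> emeasure (P x) (space M - cls v) = 0"
      using cls_step[OF uM up] by blast
    have "emeasure \<mu> (cls u) = (\<integral>\<^sup>+x. indicator (cls u) x \<partial>\<mu>)" using cls_sets[OF uM] sets_mu by simp
    also have "\<dots> \<le> (\<integral>\<^sup>+x. emeasure (P x) (cls v) \<partial>\<mu>)"
      using AE AE_space
    proof (intro nn_integral_mono_AE, eventually_elim)
      fix x assume x: "x \<in> cls u \<longrightarrow> emeasure (P x) (space M - cls v) = 0" "x \<in> space \<mu>"
      then have xM: "x \<in> space M" by (simp add: space_mu)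
      note p = prob_algebraD[OF P_in[OF xM]]
      interpret Q: prob_space "P x" by (rule p)
      show "indicator (cls u) x \<le> emeasure (P x) (cls v)"
      proof (cases "x \<in> cls u")
        case True
        then have "measure (P x) (space M - cls v) = 0" using x by (simp add: measure_def)
        then have "emeasure (P x) (cls v) = 1" using Q.prob_compl[of "cls v"] cls_sets[OF v] p by (simp add: Q.emeasure_eq_measure)
        then show ?thesis by (simp add: indicator_def)
      qed simp
    qed
    also have "\<dots> = emeasure \<mu> (cls v)"
      using emeasure_bind_prob_algebra[OF mu P cls_sets[OF v]] invariant by (simp add: invariant_prob_def)
    finally have "good v" using v u by (auto simp: good_def)
    then show ?thesis using AE by blast
  qed
  have "good w0" using w0 by (simp add: good_def)
  then obtain w where "\<And>i. good (w i)" "\<And>i::nat. AE x in \<mu>. x \<in> cls (w i) \<longrightarrow> emeasure (P x) (space M - cls (w (Suc i))) = 0"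
    using dependent_nat_choice[of "\<lambda>_. good" "\<lambda>_ u v. AE x in \<mu>. x \<in> cls u \<longrightarrow> emeasure (P x) (space M - cls v) = 0"] succ_ex
    by blast
  then show ?thesis using that by (auto simp: good_def)
qed

text \<open>Periodicity asks for transitions with probability one from every state, while
  \<open>K\<close> moves correctly only almost everywhere. Keeping the states whose whole future
  follows the cycle almost surely costs a null set and leaves an exact cycle.\<close>

lemma not_aperiodic_of_cycle:
  fixes K :: "nat \<Rightarrow> 'a set"
  assumes d: "d \<ge> 2" and K: "\<And>m. K m \<in> sets M" and per: "\<And>m. K (m + d) = K m"
    and dis: "\<And>m n. m \<noteq> n \<Longrightarrow> m \<in> {1..d} \<Longrightarrow> n \<in> {1..d} \<Longrightarrow> K m \<inter> K n = {}"
    and step: "\<And>m. AE x in \<mu>. x \<in> K m \<longrightarrow> emeasure (P x) (space M - K (Suc m)) = 0"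
    and pos: "emeasure \<mu> (K 1) > 0"
  shows "\<not> aperiodic M P \<mu>"
proof -
  \<comment> \<open>The states whose chain lies in \<open>K (m + n)\<close> almost surely for each
    \<open>n\<close>; the case \<open>n = 0\<close> says that the state itself lies in
    \<open>K m\<close>.\<close>
  define E where "E m = (\<Inter>n. {x \<in> space M. emeasure (nstep M P n x) (space M - K (m + n)) = 0})" for m
  have null_sets: "{x \<in> space M. emeasure (nstep M P n x) A = 0} \<in> sets M" if A: "A \<in> sets M" for n A
  proof -
    have "{x \<in> space M. emeasure (nstep M P n x) A = 0} = (\<lambda>x. emeasure (nstep M P n x) A) -` {0} \<inter> space M" by auto
    then show ?thesis using measurable_sets[OF emeasure_nstep_measurable[OF A], of "{0}"] by simp
  qed
  have E: "E m \<in> sets M" for m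
    unfolding E_def using K by (intro sets.countable_INT) (auto intro!: null_sets)
  have EM: "E m \<subseteq> space M" for m using sets.sets_into_space[OF E] .
  have EK: "E m \<subseteq> K m" for m
  proof
    fix x assume "x \<in> E m"
    then have "x \<in> space M" "emeasure (nstep M P 0 x) (space M - K (m + 0)) = 0" unfolding E_def by blast+
    then show "x \<in> K m" using K[of m] by (auto split: split_indicator_asm)
  qed
  have per_E: "E (m + d) = E m" for m
  proof -
    have "K (m + d + n) = K (m + n)" for n using per[of "m + n"] by (simp add: ac_simps)
    then show ?thesis by (simp add: E_def)
  qed
  have KE: "AE x in \<mu>. x \<in> K m \<longrightarrow> x \<in> E m" for m
  proof -
    have "AE x in \<mu>. \<forall>n. x \<in> K m \<longrightarrow> emeasure (nstep M P n x) (space M - K (m + n)) = 0"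
      using AE_iterate[of K, OF K step] by (subst AE_all_countable) auto
    then show ?thesis using AE_space by eventually_elim (auto simp: E_def space_mu)
  qed
  have posE: "emeasure \<mu> (E 1) > 0"
  proof -
    have "emeasure \<mu> (K 1) \<le> emeasure \<mu> (E 1)"
      using KE[of 1] E sets_mu by (intro emeasure_mono_AE) auto
    then show ?thesis using pos by auto
  qed
  \<comment> \<open>Expanding the future of a state of \<open>E m\<close> along its first step shows
    that almost every successor has the future required by the next set.\<close>
  have stepE: "emeasure (P x) (E (Suc m)) = 1" if x: "x \<in> E m" for x m
  proof -
    have xM: "x \<in> space M" using EM x by blast
    note p = prob_algebraD[OF P_in[OF xM]]
    interpret Q: prob_space "P x" by (rule p)
    have "AE z in P x. emeasure (nstep M P n z) (space M - K (Suc m + n)) = 0" for n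
    proof -
      have s: "space M - K (Suc m + n) \<in> sets M" using K by auto
      have "emeasure (nstep M P (Suc n) x) (space M - K (m + Suc n)) = 0" using x unfolding E_def by blast
      then have 0: "(\<integral>\<^sup>+z. emeasure (nstep M P n z) (space M - K (Suc m + n)) \<partial>P x) = 0"
        using emeasure_nstep_Suc[OF xM s] by simp
      have "(\<lambda>z. emeasure (nstep M P n z) (space M - K (Suc m + n))) \<in> borel_measurable (P x)"
        using emeasure_nstep_measurable[OF s] measurable_cong_sets[OF p(2) refl] by blast
      then show ?thesis using 0 by (intro iffD1[OF nn_integral_0_iff_AE])
    qed
    then have "AE z in P x. \<forall>n. emeasure (nstep M P n z) (space M - K (Suc m + n)) = 0"
      by (subst AE_all_countable) blast
    then have "AE z in P x. z \<in> E (Suc m)"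
      using AE_space by eventually_elim (simp add: E_def p)
    then show ?thesis using E p Q.prob_eq_1[of "E (Suc m)"] by (simp add: Q.emeasure_eq_measure)
  qed
  have "(\<forall>i \<in> {1..d}. E i \<in> sets M) \<and> disjoint_family_on E {1..d} \<and> emeasure \<mu> (E 1) > 0 \<and>
          (\<forall>i \<in> {1..d}. \<forall>x \<in> E i. emeasure (P x) (E (if i = d then 1 else i + 1)) = 1)"
  proof (intro conjI ballI)
    show "disjoint_family_on E {1..d}"
      unfolding disjoint_family_on_def
    proof (intro ballI impI)
      fix m n assume "m \<in> {1..d}" "n \<in> {1..d}" "m \<noteq> n"
      then have "K m \<inter> K n = {}" by (intro dis)
      then show "E m \<inter> E n = {}" using EK[of m] EK[of n] by blast
    qed
    fix i x assume "i \<in> {1..d}" and x: "x \<in> E i"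
    show "emeasure (P x) (E (if i = d then 1 else i + 1)) = 1"
      using stepE[OF x] per_E[of 1] by auto
  qed (use E posE in auto)
  then show ?thesis unfolding aperiodic_def using d by blast
qed

lemma aperiodic_irreducible_imp_convergence:
  assumes ap: "aperiodic M P \<mu>" and wi: "weakly_irreducible M P \<mu>"
  shows "AE x in \<mu>. (\<lambda>n. tv_dist M (nstep M P n x) \<mu>) \<longlonglongrightarrow> 0"
proof -
  obtain w0 where w0: "w0 \<in> space M" "emeasure \<mu> (cls w0) > 0"
    using weakly_irreducible_ex_cls[OF wi] by blast
  obtain w where w: "\<And>i. w i \<in> space M" and big: "\<And>i. emeasure \<mu> (cls (w i)) \<ge> emeasure \<mu> (cls w0)"
    and step: "\<And>i::nat. AE x in \<mu>. x \<in> cls (w i) \<longrightarrow> emeasure (P x) (space M - cls (w (Suc i))) = 0"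
    by (rule cls_sequence[OF w0]) (rule that)
  \<comment> \<open>The gap is minimised over all starting positions at once, so that no two of the
    \<open>d\<close> classes along a shortest repetition coincide.\<close>
  define Q where "Q d \<longleftrightarrow> d > 0 \<and> (\<exists>i. cls (w i) = cls (w (i + d)))" for d
  define d where "d = (LEAST d. Q d)"
  have "\<exists>d. Q d" using ex_repeated_cls[of w, OF w w0(2) big] by (auto simp: Q_def)
  then have "Q d" unfolding d_def by (rule LeastI_ex)
  then obtain i where d0: "d > 0" and i: "cls (w i) = cls (w (i + d))" by (auto simp: Q_def)
  have least: "\<not> Q e" if "e < d" for e using not_less_Least that unfolding d_def by blast
  \<comment> \<open>The \<open>d\<close> classes following position \<open>i\<close>, repeated
    periodically.\<close>
  define K where "K m = cls (w (i + m mod d))" for m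
  have K: "K m \<in> sets M" for m unfolding K_def by (rule cls_sets[OF w])
  have per: "K (m + d) = K m" for m by (simp add: K_def)
  have stepK: "AE x in \<mu>. x \<in> K m \<longrightarrow> emeasure (P x) (space M - K (Suc m)) = 0" for m
  proof (cases "Suc (m mod d) = d")
    \<comment> \<open>At the end of a round the next class of the sequence is the one at position
      \<open>i + d\<close>, which is the class at position \<open>i\<close>.\<close>
    case True
    then have "Suc m mod d = 0" by (simp add: mod_Suc)
    then have "K (Suc m) = cls (w (Suc (i + m mod d)))" using i True by (simp add: K_def add_Suc_right[symmetric] del: add_Suc_right)
    then show ?thesis using step[of "i + m mod d"] by (simp add: K_def)
  next
    case False
    then have "Suc m mod d = Suc (m mod d)" by (simp add: mod_Suc)
    then show ?thesis using step[of "i + m mod d"] by (simp add: K_def)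
  qed
  \<comment> \<open>Equality of two of these classes would be a repetition with the smaller gap
    \<open>b - a\<close>.\<close>
  have dis0: "K a \<inter> K b = {}" if "a < b" "b < d" for a b
  proof -
    have "\<not> Q (b - a)" using that by (intro least) auto
    moreover have "i + a + (b - a) = i + b" using that by simp
    ultimately have "cls (w (i + a)) \<noteq> cls (w (i + b))" using that unfolding Q_def by (metis zero_less_diff)
    then show ?thesis using cls_eq_or_disjoint[OF w w, of "i + a" "i + b"] that by (simp add: K_def)
  qed
  have "\<not> d \<ge> 2"
  proof
    assume d2: "d \<ge> 2"
    have "\<not> aperiodic M P \<mu>"
    proof (rule not_aperiodic_of_cycle[OF d2 K per _ stepK])
      fix m n assume mn: "m \<noteq> n" "m \<in> {1..d}" "n \<in> {1..d}"
      then have "m mod d \<noteq> n mod d" by (cases "m = d"; cases "n = d") auto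
      then have "K (m mod d) \<inter> K (n mod d) = {}"
        using dis0[of "m mod d" "n mod d"] dis0[of "n mod d" "m mod d"] d0 by (cases "m mod d < n mod d") auto
      then show "K m \<inter> K n = {}" by (simp add: K_def)
    next
      show "emeasure \<mu> (K 1) > 0" using big w0(2) by (auto simp: K_def intro: less_le_trans)
    qed
    then show False using ap by blast
  qed
  then have d1: "d = 1" using d0 by simp
  define C where "C = cls (w i)"
  have "AE x in \<mu>. x \<in> C \<longrightarrow> emeasure (P x) (space M - C) = 0"
    using stepK[of 0] by (simp add: K_def d1 C_def)
  then have AE_C: "AE x in \<mu>. x \<in> C"
    using big[of i] w0(2) cls_sets[OF w] by (intro closed_set_full[OF wi]) (auto simp: C_def intro: less_le_trans)
  then have C2: "AE x in \<mu>. AE y in \<mu>. dist_lim (x, y) = 0"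
  proof eventually_elim
    fix x assume x: "x \<in> C"
    show "AE y in \<mu>. dist_lim (x, y) = 0"
      using AE_C by eventually_elim (use x cls_rel[OF w] in \<open>simp add: C_def\<close>)
  qed
  have "AE p in \<mu> \<Otimes>\<^sub>M \<mu>. dist_lim p = 0"
  proof (rule mu2.AE_pair_measure[OF _ C2])
    show "{p \<in> space (\<mu> \<Otimes>\<^sub>M \<mu>). dist_lim p = 0} \<in> sets (\<mu> \<Otimes>\<^sub>M \<mu>)"
      using dist_lim_zero_sets sets_mu2 sets_eq_imp_space_eq[OF sets_mu2] by simp
  qed
  then show ?thesis by (rule convergence_of_dist_lim)
qed

section \<open>Convergence implies irreducibility and aperiodicity\<close>

lemma convergence_measure:
  assumes x: "x \<in> space M" and lim: "(\<lambda>n. tv_dist M (nstep M P n x) \<mu>) \<longlonglongrightarrow> 0" and A: "A \<in> sets M"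
  shows "(\<lambda>n. measure (nstep M P n x) A) \<longlonglongrightarrow> measure \<mu> A"
proof (rule LIM_zero_cancel, rule tendsto_rabs_zero_cancel)
  show "(\<lambda>n. \<bar>measure (nstep M P n x) A - measure \<mu> A\<bar>) \<longlonglongrightarrow> 0"
    using tv_dist_upper[OF nstep_in[OF x] mu A]
    by (intro tendsto_sandwich[OF _ _ tendsto_const lim] always_eventually allI) auto
qed

text \<open>The invariant measure itself serves as irreducibility measure: n-step probabilities of a
  set of positive measure converge to a positive number.\<close>

lemma convergence_imp_weakly_irreducible:
  assumes conv: "AE x in \<mu>. (\<lambda>n. tv_dist M (nstep M P n x) \<mu>) \<longlonglongrightarrow> 0"
  shows "weakly_irreducible M P \<mu>"
proof -
  obtain N where N: "N \<in> null_sets \<mu>" "{x \<in> space \<mu>. \<not> (\<lambda>n. tv_dist M (nstep M P n x) \<mu>) \<longlonglongrightarrow> 0} \<subseteq> N"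
    using conv by (auto simp: eventually_ae_filter)
  define E0 where "E0 = space M - N"
  have E0: "E0 \<in> sets M" using N sets_mu by (auto simp: E0_def)
  have E0_1: "emeasure \<mu> E0 = 1"
    unfolding E0_def using N mu.emeasure_space_1 by (subst emeasure_Diff_null_set) (auto simp: space_mu sets_mu)
  have "emeasure (chain_law M P x) (\<Union>n \<in> {1..}. {\<omega> \<in> space (path_space M). \<omega> n \<in> A}) > 0"
    if x: "x \<in> E0" and A: "A \<in> sets M" and pos: "emeasure \<mu> A > 0" for x A
  proof -
    have xM: "x \<in> space M" and lim: "(\<lambda>n. tv_dist M (nstep M P n x) \<mu>) \<longlonglongrightarrow> 0"
      using x N(2) by (auto simp: E0_def space_mu)
    have "measure \<mu> A > 0" using pos by (simp add: mu.emeasure_eq_measure)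
    then have "eventually (\<lambda>n. measure (nstep M P n x) A > 0) sequentially"
      using order_tendstoD(1)[OF convergence_measure[OF xM lim A]] by auto
    then obtain n where n: "n \<ge> 1" "measure (nstep M P n x) A > 0"
      by (auto simp: eventually_sequentially) (metis nle_le)
    have "{\<omega> \<in> space (path_space M). \<omega> m \<in> A} = (\<lambda>\<omega>. \<omega> m) -` A \<inter> space (path_space M)" for m by auto
    then have s: "{\<omega> \<in> space (path_space M). \<omega> m \<in> A} \<in> sets (chain_law M P x)" for m
      using measurable_sets[OF path_component_measurable A] prob_algebraD(2)[OF chain_law_prob[OF xM]] by simp
    have "0 < emeasure (nstep M P n x) A" using n(2) by (auto simp: measure_def zero_less_iff_neq_zero)
    also have "\<dots> = emeasure (chain_law M P x) {\<omega> \<in> space (path_space M). \<omega> n \<in> A}"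
      by (rule emeasure_chain_law_component[OF xM A, symmetric])
    also have "\<dots> \<le> emeasure (chain_law M P x) (\<Union>n \<in> {1..}. {\<omega> \<in> space (path_space M). \<omega> n \<in> A})"
      using n(1) s by (intro emeasure_mono sets.countable_UN') auto
    finally show ?thesis .
  qed
  moreover have "sigma_finite_measure \<mu>" by unfold_locales
  moreover have "emeasure \<mu> (space M) > 0" using mu.emeasure_space_1 by (simp add: space_mu)
  ultimately show ?thesis
    unfolding weakly_irreducible_def using sets_mu E0 E0_1 by blast
qed

text \<open>From a state of the first cyclic set, the probability of being there is 1 at multiples
  of \<open>d\<close> and 0 one step later, yet both subsequences converge to the invariant mass of
  that set.\<close>

lemma convergence_imp_aperiodic:
  assumes conv: "AE x in \<mu>. (\<lambda>n. tv_dist M (nstep M P n x) \<mu>) \<longlonglongrightarrow> 0"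
  shows "aperiodic M P \<mu>"
  unfolding aperiodic_def
proof (rule notI, elim exE conjE)
  fix d and E :: "nat \<Rightarrow> 'a set"
  assume d: "d \<ge> 2" and E: "\<forall>i \<in> {1..d}. E i \<in> sets M" and dis: "disjoint_family_on E {1..d}" and pos: "emeasure \<mu> (E 1) > 0"
    and cyc: "\<forall>i \<in> {1..d}. \<forall>x \<in> E i. emeasure (P x) (E (if i = d then 1 else i + 1)) = 1"
  have E1: "E 1 \<in> sets M" using E d by auto
  obtain x where x: "x \<in> E 1" and lim: "(\<lambda>n. tv_dist M (nstep M P n x) \<mu>) \<longlonglongrightarrow> 0"
    using ex_of_pos[OF conv pos E1] by blast
  have xM: "x \<in> space M" using x sets.sets_into_space[OF E1] by blast
  \<comment> \<open>The index of the cyclic set occupied at time \<open>n\<close>, counted from 1 as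
    in the definition of periodicity.\<close>
  define c where "c n = Suc (n mod d)" for n
  have c: "c n \<in> {1..d}" for n using d by (auto simp: c_def Suc_le_eq)
  have c_Suc: "c (Suc n) = (if c n = d then 1 else c n + 1)" for n using d by (auto simp: c_def mod_Suc)
  have visit: "measure (nstep M P n x) (E (c n)) = 1" for n
  proof (induction n)
    case 0
    show ?case using x E1 by (simp add: c_def measure_return)
  next
    case (Suc n)
    note p = prob_algebraD[OF nstep_in[OF xM, of n]]
    interpret Q: prob_space "nstep M P n x" by (rule p)
    have s: "E (c n) \<in> sets M" "E (c (Suc n)) \<in> sets M" using E c by auto
    have "AE z in nstep M P n x. z \<in> E (c n)" using Suc s p by (subst (asm) Q.prob_eq_1) auto
    then have "AE z in nstep M P n x. measure (P z) (E (c (Suc n))) = 1"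
      by eventually_elim (use cyc c in \<open>simp add: measure_def c_Suc\<close>)
    then have "(\<integral>z. measure (P z) (E (c (Suc n))) \<partial>nstep M P n x) = (\<integral>z. 1 \<partial>nstep M P n x)"
      using measure_kernel_measurable[OF P s(2)] measurable_cong_sets[OF p(2) refl]
      by (intro integral_cong_AE) auto
    then show ?case using measure_bind_prob[OF nstep_in[OF xM] P s(2), of n] by (simp add: Q.prob_space)
  qed
  note conv1 = convergence_measure[OF xM lim E1]
  have "strict_mono (\<lambda>n. n * d)" "strict_mono (\<lambda>n. n * d + 1)"
    using d by (auto simp: strict_mono_def)
  then have l: "(\<lambda>n. measure (nstep M P (n * d) x) (E 1)) \<longlonglongrightarrow> measure \<mu> (E 1)"
    "(\<lambda>n. measure (nstep M P (n * d + 1) x) (E 1)) \<longlonglongrightarrow> measure \<mu> (E 1)"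
    using LIMSEQ_subseq_LIMSEQ[OF conv1] unfolding comp_def by blast+
  have "c (n * d) = 1" "c (n * d + 1) = 2" for n using d by (auto simp: c_def mod_Suc)
  then have v: "measure (nstep M P (n * d) x) (E 1) = 1" "measure (nstep M P (n * d + 1) x) (E 2) = 1" for n
    using visit[of "n * d"] visit[of "n * d + 1"] by auto
  have "measure (nstep M P (n * d + 1) x) (E 1) = 0" for n
  proof -
    note p = prob_algebraD[OF nstep_in[OF xM, of "n * d + 1"]]
    interpret Q: prob_space "nstep M P (n * d + 1) x" by (rule p)
    have s: "E 2 \<in> sets M" using E d by auto
    have "E 1 \<inter> E 2 = {}" using dis d unfolding disjoint_family_on_def by auto
    then have "measure (nstep M P (n * d + 1) x) (E 1) + measure (nstep M P (n * d + 1) x) (E 2) = measure (nstep M P (n * d + 1) x) (E 1 \<union> E 2)"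
      using E1 s p by (intro Q.finite_measure_Union[symmetric]) auto
    also have "\<dots> \<le> 1" by (rule Q.prob_le_1)
    finally show ?thesis using v(2)[of n] measure_nonneg[of "nstep M P (n * d + 1) x" "E 1"] by linarith
  qed
  then have "measure \<mu> (E 1) = 0" "measure \<mu> (E 1) = 1"
    using l v(1) LIMSEQ_unique[OF tendsto_const] by force+
  then show False by simp
qed

end

subsection \<open>Successful couplings\<close>

definition uniform01 :: "real measure" where
  "uniform01 = uniform_measure lborel {0..1}"

lemma prob_space_uniform01: "prob_space uniform01"
  unfolding uniform01_def by (rule prob_space_uniform_measure) auto

lemma sets_uniform01[measurable_cong, simp]: "sets uniform01 = sets borel"
  by (simp add: uniform01_def)

lemma space_uniform01[simp]: "space uniform01 = UNIV"
  by (simp add: uniform01_def)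

lemma emeasure_uniform01_atMost:
  assumes "0 \<le> t" "t \<le> 1" shows "emeasure uniform01 {..t} = ennreal t"
proof -
  have "{0..1} \<inter> {..t} = {0..t}" using assms by auto
  then show ?thesis using assms divide_ennreal[of t 1] by (simp add: uniform01_def)
qed

text \<open>The randomisation is the quantile transform of a regular version of the conditional
  distribution function, which is only needed at rational arguments.\<close>

lemma randomization_real:
  fixes \<nu> :: "('a \<times> real) measure"
  assumes fin: "finite_measure \<nu>" and sets: "sets \<nu> = sets (A \<Otimes>\<^sub>M borel)"
    and unit: "AE p in \<nu>. snd p \<in> {0..1}"
  obtains g where "g \<in> A \<Otimes>\<^sub>M borel \<rightarrow>\<^sub>M borel"
    "distr (distr \<nu> A fst \<Otimes>\<^sub>M uniform01) (A \<Otimes>\<^sub>M borel) (\<lambda>(a, u). (a, g (a, u))) = \<nu>"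
proof -
  interpret U: prob_space uniform01 by (rule prob_space_uniform01)
  interpret fin: finite_measure \<nu> by fact
  note meas = measurable_cong_sets[OF sets refl]
  have sp: "space \<nu> = space A \<times> UNIV" using sets_eq_imp_space_eq[OF sets] by (simp add: space_pair_measure)
  have fstm: "fst \<in> \<nu> \<rightarrow>\<^sub>M A" by (simp add: meas)
  define \<alpha> where "\<alpha> = distr \<nu> A fst"
  interpret al: finite_measure \<alpha> unfolding \<alpha>_def by (rule fin.finite_measure_distr[OF fstm])
  have sa[simp, measurable_cong]: "sets \<alpha> = sets A" by (simp add: \<alpha>_def)
  have spa: "space \<alpha> = space A" by (simp add: \<alpha>_def)
  have rect: "B \<times> S \<in> sets \<nu>" if "B \<in> sets A" "S \<in> sets borel" for B S
    using that sets by auto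
  \<comment> \<open>A version of the conditional probability, given the first coordinate, that the
    second is at most \<open>q\<close>; it is a Radon-Nikodym derivative truncated to take values in
    [0, 1] everywhere.\<close>
  have ex: "\<exists>f. f \<in> borel_measurable A \<and> (\<forall>a. 0 \<le> f a \<and> f a \<le> 1) \<and>
      (\<forall>B\<in>sets A. (\<integral>\<^sup>+a. ennreal (f a) * indicator B a \<partial>\<alpha>) = emeasure \<nu> (B \<times> {..q}))" for q :: real
  proof -
    define \<nu>q where "\<nu>q = distr (restrict_space \<nu> (space A \<times> {..q})) A fst"
    have R: "space A \<times> {..q} \<in> sets \<nu>" by (intro rect) auto
    have fm: "fst \<in> restrict_space \<nu> (space A \<times> {..q}) \<rightarrow>\<^sub>M A"
      by (rule measurable_restrict_space1[OF fstm])
    have eq: "emeasure \<nu>q B = emeasure \<nu> (B \<times> {..q})" if B: "B \<in> sets A" for B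
    proof -
      have "fst -` B \<inter> space (restrict_space \<nu> (space A \<times> {..q})) = B \<times> {..q}"
        using sets.sets_into_space[OF B] by (auto simp: space_restrict_space sp)
      then show ?thesis
        unfolding \<nu>q_def using emeasure_distr[OF fm B] R sets.sets_into_space[OF B]
          emeasure_restrict_space[of "space A \<times> {..q}" \<nu> "B \<times> {..q}"]
        by (simp add: sp Sigma_mono Int_absorb2)
    qed
    have le: "emeasure \<nu>q B \<le> emeasure \<alpha> B" if B: "B \<in> sets A" for B
    proof -
      have "fst -` B \<inter> space \<nu> = B \<times> UNIV" using sets.sets_into_space[OF B] by (auto simp: sp)
      then have "emeasure \<alpha> B = emeasure \<nu> (B \<times> UNIV)"
        unfolding \<alpha>_def using emeasure_distr[OF fstm B] by simp
      then show ?thesis unfolding eq[OF B] using rect[OF B, of UNIV] by (auto intro!: emeasure_mono)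
    qed
    have ac: "absolutely_continuous \<alpha> \<nu>q"
      unfolding absolutely_continuous_def null_sets_def using le by (fastforce simp: \<nu>q_def)
    obtain h where h: "h \<in> borel_measurable \<alpha>" "density \<alpha> h = \<nu>q"
      using al.Radon_Nikodym[OF ac] by (auto simp: \<nu>q_def)
    have hA: "h \<in> borel_measurable A" using h(1) measurable_cong_sets[OF sa refl] by blast
    define G where "G = {a \<in> space A. h a > 1}"
    have G: "G \<in> sets A" unfolding G_def by (intro borel_measurable_less borel_measurable_const hA)
    \<comment> \<open>The restricted marginal is dominated by the full one, so the truncation
      changes the density on a null set only.\<close>
    have "AE a in \<alpha>. h a \<le> 1"
    proof -
      have "(\<integral>\<^sup>+a. h a * indicator G a \<partial>\<alpha>) = emeasure \<nu>q G"
        using h G by (subst h(2)[symmetric], subst emeasure_density) auto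
      also have "\<dots> \<le> (\<integral>\<^sup>+a. indicator G a \<partial>\<alpha>)" using le[OF G] G by simp
      finally have 1: "(\<integral>\<^sup>+a. h a * indicator G a \<partial>\<alpha>) \<le> (\<integral>\<^sup>+a. indicator G a \<partial>\<alpha>)" .
      have f2: "(\<integral>\<^sup>+a. indicator G a \<partial>\<alpha>) \<noteq> \<infinity>" using G al.emeasure_finite by simp
      have "(\<integral>\<^sup>+a. h a * indicator G a - indicator G a \<partial>\<alpha>) = (\<integral>\<^sup>+a. h a * indicator G a \<partial>\<alpha>) - (\<integral>\<^sup>+a. indicator G a \<partial>\<alpha>)"
        using G h f2 by (intro nn_integral_diff) (auto simp: G_def split: split_indicator)
      also have "\<dots> = 0" using 1 f2 by (auto simp: diff_eq_0_iff_ennreal less_top[symmetric] top_unique)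
      finally have "AE a in \<alpha>. h a * indicator G a - indicator G a = 0"
        using G h by (intro iffD1[OF nn_integral_0_iff_AE]) auto
      then show ?thesis using AE_space
      proof eventually_elim
        fix a assume a: "h a * indicator G a - indicator G a = 0" "a \<in> space \<alpha>"
        show "h a \<le> 1"
        proof (rule ccontr)
          assume "\<not> h a \<le> 1"
          then have "a \<in> G" using a spa by (simp add: G_def)
          then have "h a - 1 = 0" using a by simp
          then show False using \<open>\<not> h a \<le> 1\<close> by (simp add: ennreal_minus_eq_0)
        qed
      qed
    qed
    then have AE1: "AE a in \<alpha>. ennreal (enn2real (min 1 (h a))) = h a"
    proof eventually_elim
      fix a assume a: "h a \<le> 1"
      also have "(1::ennreal) < top" by simp
      finally show "ennreal (enn2real (min 1 (h a))) = h a" using a by (simp add: min_absorb2)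
    qed
    show ?thesis
    proof (intro exI[of _ "\<lambda>a. enn2real (min 1 (h a))"] conjI allI ballI)
      show "(\<lambda>a. enn2real (min 1 (h a))) \<in> borel_measurable A" using hA by measurable
      show "0 \<le> enn2real (min 1 (h a))" for a by simp
      show "enn2real (min 1 (h a)) \<le> 1" for a by (intro enn2real_leI) auto
      fix B assume B: "B \<in> sets A"
      have "(\<integral>\<^sup>+a. ennreal (enn2real (min 1 (h a))) * indicator B a \<partial>\<alpha>) = (\<integral>\<^sup>+a. h a * indicator B a \<partial>\<alpha>)"
      proof (rule nn_integral_cong_AE)
        show "AE a in \<alpha>. ennreal (enn2real (min 1 (h a))) * indicator B a = h a * indicator B a"
          using AE1 by eventually_elim simp
      qed
      also have "\<dots> = emeasure \<nu> (B \<times> {..q})"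
        using h B eq[OF B] by (subst emeasure_density[symmetric]) auto
      finally show "(\<integral>\<^sup>+a. ennreal (enn2real (min 1 (h a))) * indicator B a \<partial>\<alpha>) = emeasure \<nu> (B \<times> {..q})" .
    qed
  qed
  then obtain F where Fm: "\<And>q. F q \<in> borel_measurable A" and F01: "\<And>q a. 0 \<le> F q a" "\<And>q a. F q a \<le> 1"
    and FI: "\<And>q B. B \<in> sets A \<Longrightarrow> (\<integral>\<^sup>+a. ennreal (F q a) * indicator B a \<partial>\<alpha>) = emeasure \<nu> (B \<times> {..q})"
    by metis
  define S where "S = \<rat> \<inter> {0..<(1::real)}"
  have S: "countable S" unfolding S_def by (intro countable_Int1 countable_rat)
  have mono: "AE a in \<alpha>. F q a \<le> F r a" if "q \<le> r" for q r
  proof -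
    define B where "B = {a \<in> space A. F r a < F q a}"
    have B: "B \<in> sets A" unfolding B_def by (intro borel_measurable_less Fm)
    have "(\<integral>\<^sup>+a. ennreal (F q a) * indicator B a - ennreal (F r a) * indicator B a \<partial>\<alpha>)
        = (\<integral>\<^sup>+a. ennreal (F q a) * indicator B a \<partial>\<alpha>) - (\<integral>\<^sup>+a. ennreal (F r a) * indicator B a \<partial>\<alpha>)"
    proof (intro nn_integral_diff)
      show "(\<integral>\<^sup>+a. ennreal (F r a) * indicator B a \<partial>\<alpha>) \<noteq> \<infinity>"
        unfolding FI[OF B] using fin.emeasure_finite by simp
    qed (use Fm B in \<open>auto simp: measurable_cong_sets[OF sa refl] B_def intro!: ennreal_leI split: split_indicator\<close>)
    also have "\<dots> = 0"
      unfolding FI[OF B] using that rect[OF B, of "{..r}"] fin.emeasure_finite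
      by (auto simp: diff_eq_0_iff_ennreal less_top[symmetric] intro!: emeasure_mono)
    finally have "AE a in \<alpha>. ennreal (F q a) * indicator B a - ennreal (F r a) * indicator B a = 0"
      using Fm B by (intro iffD1[OF nn_integral_0_iff_AE]) (auto simp: measurable_cong_sets[OF sa refl])
    then show ?thesis using AE_space
    proof eventually_elim
      fix a assume a: "ennreal (F q a) * indicator B a - ennreal (F r a) * indicator B a = 0" "a \<in> space \<alpha>"
      show "F q a \<le> F r a"
      proof (rule ccontr)
        assume n: "\<not> F q a \<le> F r a"
        then have "a \<in> B" using a spa by (simp add: B_def)
        then have "ennreal (F q a - F r a) = 0" using a F01 by (simp add: ennreal_minus)
        then show False using n by (simp add: ennreal_eq_0_iff)
      qed
    qed
  qed
  \<comment> \<open>The infimum of the rational levels whose conditional probability reaches the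
    uniform variable. The added 1 keeps the set non-empty and is the right default since
    \<open>\<nu>\<close> lives on values up to 1.\<close>
  define g where "g p = Inf (insert 1 {q \<in> S. snd p \<le> F q (fst p)})" for p :: "'a \<times> real"
  have bdd: "bdd_below (insert 1 {q \<in> S. snd p \<le> F q (fst p)})" for p :: "'a \<times> real"
    by (rule bdd_belowI[where m=0]) (auto simp: S_def)
  \<comment> \<open>Strict inequalities for the infimum are countable unions of conditions on single
    rational levels. Working with them makes right-continuous versions of the conditional
    distribution functions dispensable.\<close>
  have g_less: "g p < r \<longleftrightarrow> r > 1 \<or> (\<exists>q\<in>S. q < r \<and> snd p \<le> F q (fst p))" for p r
    unfolding g_def cInf_less_iff[OF insert_not_empty bdd] by auto
  have lev: "{p \<in> space (A \<Otimes>\<^sub>M borel). snd p \<le> F q (fst p)} \<in> sets (A \<Otimes>\<^sub>M borel)" for q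
    by (intro borel_measurable_le measurable_snd measurable_compose[OF measurable_fst Fm])
  have gm: "g \<in> A \<Otimes>\<^sub>M borel \<rightarrow>\<^sub>M borel"
  proof (rule borel_measurableI_less)
    fix r
    have "{p \<in> space (A \<Otimes>\<^sub>M borel). g p < r} = (if r > 1 then space (A \<Otimes>\<^sub>M borel) else
        (\<Union>q\<in>{q\<in>S. q < r}. {p \<in> space (A \<Otimes>\<^sub>M borel). snd p \<le> F q (fst p)}))"
      by (auto simp: g_less)
    also have "\<dots> \<in> sets (A \<Otimes>\<^sub>M borel)"
      using S lev by (auto intro!: sets.countable_UN')
    finally show "{p \<in> space (A \<Otimes>\<^sub>M borel). g p < r} \<in> sets (A \<Otimes>\<^sub>M borel)" .
  qed
  have sau: "sets (\<alpha> \<Otimes>\<^sub>M uniform01) = sets (A \<Otimes>\<^sub>M borel)" by (intro sets_pair_measure_cong) auto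
  have hm: "(\<lambda>(a, u). (a, g (a, u))) \<in> \<alpha> \<Otimes>\<^sub>M uniform01 \<rightarrow>\<^sub>M A \<Otimes>\<^sub>M borel"
  proof -
    have "(\<lambda>p. (fst p, g p)) \<in> A \<Otimes>\<^sub>M borel \<rightarrow>\<^sub>M A \<Otimes>\<^sub>M borel" using gm by measurable
    then show ?thesis unfolding measurable_cong_sets[OF sau refl] by (simp add: split_beta')
  qed
  define \<nu>' where "\<nu>' = distr (\<alpha> \<Otimes>\<^sub>M uniform01) (A \<Otimes>\<^sub>M borel) (\<lambda>(a, u). (a, g (a, u)))"
  have law: "emeasure \<nu>' (B \<times> {..<r}) = emeasure \<nu> (B \<times> {..<r})" if B: "B \<in> sets A" for B r
  proof -
    have BR: "B \<times> {..<r} \<in> sets (A \<Otimes>\<^sub>M borel)" using B by auto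
    have pre: "(\<lambda>(a, u). (a, g (a, u))) -` (B \<times> {..<r}) \<inter> space (\<alpha> \<Otimes>\<^sub>M uniform01) = {p \<in> space (\<alpha> \<Otimes>\<^sub>M uniform01). fst p \<in> B \<and> g p < r}"
      by auto
    have "emeasure \<nu>' (B \<times> {..<r}) = emeasure (\<alpha> \<Otimes>\<^sub>M uniform01) {p \<in> space (\<alpha> \<Otimes>\<^sub>M uniform01). fst p \<in> B \<and> g p < r}"
      unfolding \<nu>'_def emeasure_distr[OF hm BR] pre ..
    also have "\<dots> = (\<integral>\<^sup>+a. emeasure uniform01 (Pair a -` {p \<in> space (\<alpha> \<Otimes>\<^sub>M uniform01). fst p \<in> B \<and> g p < r}) \<partial>\<alpha>)"
      using measurable_sets[OF hm BR] unfolding pre by (rule U.emeasure_pair_measure_alt)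
    also have "\<dots> = (\<integral>\<^sup>+a. emeasure uniform01 {u. g (a, u) < r} * indicator B a \<partial>\<alpha>)"
      by (intro nn_integral_cong) (auto simp: space_pair_measure spa split: split_indicator intro!: arg_cong2[where f=emeasure])
    finally have step1: "emeasure \<nu>' (B \<times> {..<r}) = (\<integral>\<^sup>+a. emeasure uniform01 {u. g (a, u) < r} * indicator B a \<partial>\<alpha>)" .
    \<comment> \<open>Both \<open>g\<close> and the second coordinate under \<open>\<nu>\<close>
      take values in [0, 1], which settles the first two cases.\<close>
    consider "r > 1" | "r \<le> 0" | "0 < r" "r \<le> 1" by linarith
    then show ?thesis
    proof cases
      case 1
      then have "emeasure \<nu>' (B \<times> {..<r}) = (\<integral>\<^sup>+a. indicator B a \<partial>\<alpha>)"
        unfolding step1 g_less using U.emeasure_space_1 by simp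
      also have "\<dots> = emeasure \<nu> (fst -` B \<inter> space \<nu>)" using B emeasure_distr[OF fstm B] by (simp add: \<alpha>_def)
      also have "fst -` B \<inter> space \<nu> = B \<times> UNIV" using sets.sets_into_space[OF B] by (auto simp: sp)
      also have "emeasure \<nu> (B \<times> UNIV) = emeasure \<nu> (B \<times> {..<r})"
      proof (rule emeasure_eq_AE)
        show "AE p in \<nu>. p \<in> B \<times> UNIV \<longleftrightarrow> p \<in> B \<times> {..<r}"
          using unit by eventually_elim (use 1 in auto)
      qed (use rect[OF B] in auto)
      finally show ?thesis .
    next
      case 2
      have "{u. g (a, u) < r} = {}" for a using 2 by (auto simp: g_less S_def)
      then have "emeasure \<nu>' (B \<times> {..<r}) = 0" unfolding step1 by simp
      moreover have "emeasure \<nu> (B \<times> {..<r}) = emeasure \<nu> {}"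
      proof (rule emeasure_eq_AE)
        show "AE p in \<nu>. p \<in> B \<times> {..<r} \<longleftrightarrow> p \<in> {}"
          using unit by eventually_elim (use 2 in auto)
      qed (use rect[OF B] in auto)
      ultimately show ?thesis by simp
    next
      case 3
      \<comment> \<open>Rational levels increasing to \<open>r\<close> exhaust the event
        \<open>g < r\<close> and the ray below \<open>r\<close> alike, so both masses are limits of
        the same sequence.\<close>
      obtain s where s: "incseq s" "\<And>k. s k \<in> S" "\<And>k. s k < r" "s \<longlonglongrightarrow> r"
      proof -
        have "\<exists>q. q \<in> \<rat> \<and> max 0 (r - 1 / Suc k) < q \<and> q < r" for k
          using Rats_dense_in_real[of "max 0 (r - 1 / Suc k)" r] 3 by auto
        then obtain q where q: "\<And>k. q k \<in> \<rat>" "\<And>k. max 0 (r - 1 / Suc k) < q k" "\<And>k. q k < r" by metis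
        define s where "s k = Max (q ` {..k})" for k
        have sq: "s k \<in> q ` {..k}" for k unfolding s_def by (intro Max_in) auto
        show ?thesis
        proof (rule that)
          show "incseq s" unfolding s_def incseq_def by (auto intro!: Max_mono)
          show "s k \<in> S" for k
          proof -
            obtain j where "s k = q j" using sq[of k] by auto
            then show ?thesis using q(1)[of j] q(2)[of j] q(3)[of j] 3 by (auto simp: S_def)
          qed
          show l: "s k < r" for k using sq[of k] q by auto
          show "s \<longlonglongrightarrow> r"
          proof (rule tendsto_sandwich[OF _ _ _ tendsto_const])
            have "r - 1 / Suc k \<le> s k" for k
            proof -
              have "q k \<le> s k" unfolding s_def by (intro Max_ge) auto
              then show ?thesis using q(2)[of k] by auto
            qed
            then show "\<forall>\<^sub>F k in sequentially. r - 1 / Suc k \<le> s k" by (intro always_eventually allI)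
            show "\<forall>\<^sub>F k in sequentially. s k \<le> r" using l by (intro always_eventually allI less_imp_le)
            show "(\<lambda>k. r - 1 / Suc k) \<longlonglongrightarrow> r"
              using tendsto_diff[OF tendsto_const LIMSEQ_inverse_real_of_nat, of r] by (simp add: divide_inverse)
          qed
        qed
      qed
      have mono_all: "AE a in \<alpha>. \<forall>q\<in>S. \<forall>r\<in>S. q \<le> r \<longrightarrow> F q a \<le> F r a"
        using mono by (intro AE_ball_countable'[OF _ S] AE_impI)
      have "AE a in \<alpha>. emeasure uniform01 {u. g (a, u) < r} = (SUP k. ennreal (F (s k) a))"
        using mono_all
      proof eventually_elim
        fix a assume m: "\<forall>q\<in>S. \<forall>r\<in>S. q \<le> r \<longrightarrow> F q a \<le> F r a"
        have "{u. g (a, u) < r} = (\<Union>k. {..F (s k) a})"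
        proof (intro set_eqI iffI)
          fix u assume "u \<in> {u. g (a, u) < r}"
          then obtain q where q: "q \<in> S" "q < r" "u \<le> F q a" using 3 by (auto simp: g_less)
          obtain k where "q < s k" using order_tendstoD(1)[OF s(4) q(2)] by (auto simp: eventually_sequentially)
          then have "u \<le> F (s k) a" using m q s(2) by (meson less_imp_le order_trans)
          then show "u \<in> (\<Union>k. {..F (s k) a})" by auto
        next
          fix u assume "u \<in> (\<Union>k. {..F (s k) a})"
          then show "u \<in> {u. g (a, u) < r}" using s by (auto simp: g_less)
        qed
        moreover have "incseq (\<lambda>k. {..F (s k) a})"
          using m s(1,2) by (auto simp: incseq_def intro: order_trans)
        ultimately have "emeasure uniform01 {u. g (a, u) < r} = (SUP k. emeasure uniform01 {..F (s k) a})"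
          using SUP_emeasure_incseq[of "\<lambda>k. {..F (s k) a}" uniform01] by (simp add: image_subset_iff)
        then show "emeasure uniform01 {u. g (a, u) < r} = (SUP k. ennreal (F (s k) a))"
          using F01 by (simp add: emeasure_uniform01_atMost)
      qed
      then have "AE a in \<alpha>. emeasure uniform01 {u. g (a, u) < r} * indicator B a = (SUP k. ennreal (F (s k) a) * indicator B a)"
        by eventually_elim (simp add: SUP_mult_right_ennreal)
      then have "emeasure \<nu>' (B \<times> {..<r}) = (\<integral>\<^sup>+a. (SUP k. ennreal (F (s k) a) * indicator B a) \<partial>\<alpha>)"
        unfolding step1 by (rule nn_integral_cong_AE)
      also have "\<dots> = (SUP k. \<integral>\<^sup>+a. ennreal (F (s k) a) * indicator B a \<partial>\<alpha>)"
      proof (rule nn_integral_monotone_convergence_SUP_AE)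
        show "AE a in \<alpha>. ennreal (F (s k) a) * indicator B a \<le> ennreal (F (s (Suc k)) a) * indicator B a" for k
          using mono[of "s k" "s (Suc k)"] s(1)
          by (auto simp: incseq_Suc_iff elim!: eventually_mono intro!: mult_right_mono ennreal_leI)
        show "(\<lambda>a. ennreal (F (s k) a) * indicator B a) \<in> borel_measurable \<alpha>" for k
          using Fm B by (auto simp: measurable_cong_sets[OF sa refl])
      qed
      also have "\<dots> = (SUP k. emeasure \<nu> (B \<times> {..s k}))" by (simp add: FI[OF B])
      also have "\<dots> = emeasure \<nu> (\<Union>k. B \<times> {..s k})"
        using s(1) rect[OF B] by (intro SUP_emeasure_incseq) (auto simp: incseq_def intro: order_trans)
      also have "(\<Union>k. B \<times> {..s k}) = B \<times> {..<r}"
      proof (intro set_eqI iffI)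
        fix p assume "p \<in> B \<times> {..<r}"
        then have "fst p \<in> B" "snd p < r" by auto
        then obtain k where "snd p < s k" using order_tendstoD(1)[OF s(4), of "snd p"] by (auto simp: eventually_sequentially)
        then show "p \<in> (\<Union>k. B \<times> {..s k})" using \<open>fst p \<in> B\<close> by (cases p) (auto intro: less_imp_le)
      qed (use s(3) in \<open>auto intro: le_less_trans\<close>)
      finally show ?thesis .
    qed
  qed
  have "\<nu>' = \<nu>"
  proof (rule measure_eqI_generator_eq[where E="{B \<times> {..<r} | B r. B \<in> sets A}" and \<Omega>="space A \<times> UNIV" and A="\<lambda>n. space A \<times> {..<real n}"])
    show "Int_stable {B \<times> {..<r::real} | B r. B \<in> sets A}"
    proof (rule Int_stableI, safe)
      fix B r B' r' assume "B \<in> sets A" "B' \<in> sets A"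
      then show "\<exists>C t. B \<times> {..<r::real} \<inter> B' \<times> {..<r'} = C \<times> {..<t} \<and> C \<in> sets A"
        by (intro exI[of _ "B \<inter> B'"] exI[of _ "min r r'"]) auto
    qed
    show "{B \<times> {..<r::real} | B r. B \<in> sets A} \<subseteq> Pow (space A \<times> UNIV)"
      using sets.sets_into_space by fastforce
    show s: "sets \<nu> = sigma_sets (space A \<times> UNIV) {B \<times> {..<r::real} | B r. B \<in> sets A}"
    proof -
      have "sets (A \<Otimes>\<^sub>M (borel :: real measure)) = sets (sigma (space A \<times> space borel) {a \<times> b | a b. a \<in> sets A \<and> b \<in> range lessThan})"
      proof (rule sets_pair_eq)
        show "sets A \<subseteq> Pow (space A)" by (rule sets.space_closed)
        show "sets A = sigma_sets (space A) (sets A)" by (simp add: sets.sigma_sets_eq)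
        show "countable {space A}" "{space A} \<subseteq> sets A" "\<Union>{space A} = space A" by auto
        show "range lessThan \<subseteq> Pow (space (borel :: real measure))" by auto
        show "sets (borel :: real measure) = sigma_sets (space borel) (range lessThan)"
          by (subst borel_Iio) simp
        show "countable (range (\<lambda>n. {..<real n}))" by simp
        show "range (\<lambda>n. {..<real n}) \<subseteq> range lessThan" by auto
        show "\<Union>(range (\<lambda>n. {..<real n})) = space borel" using reals_Archimedean2 by auto
      qed
      also have "{a \<times> b | a b. a \<in> sets A \<and> b \<in> range lessThan} = {B \<times> {..<r::real} | B r. B \<in> sets A}" by blast
      finally show ?thesis
        using sets sets.sets_into_space by (subst (asm) sets_measure_of) fastforce+
    qed
    show "sets \<nu>' = sigma_sets (space A \<times> UNIV) {B \<times> {..<r::real} | B r. B \<in> sets A}"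
      using s sets by (simp add: \<nu>'_def)
    show "emeasure \<nu>' X = emeasure \<nu> X" if "X \<in> {B \<times> {..<r::real} | B r. B \<in> sets A}" for X
      using that law by auto
    show "range (\<lambda>n. space A \<times> {..<real n}) \<subseteq> {B \<times> {..<r::real} | B r. B \<in> sets A}" by auto
    show "(\<Union>n. space A \<times> {..<real n}) = space A \<times> UNIV" using reals_Archimedean2 by auto
    show "emeasure \<nu>' (space A \<times> {..<real n}) \<noteq> \<infinity>" for n
      using law[of "space A" "real n"] fin.emeasure_finite by simp
  qed
  then show ?thesis using that[OF gm] by (simp add: \<nu>'_def \<alpha>_def)
qed

text \<open>The real case is transported through the isomorphism with a Borel subset of the unit
  interval.\<close>

lemma randomization:
  assumes borel: "is_borel_space M" and ne: "space M \<noteq> {}"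
    and fin: "finite_measure \<nu>" and sets: "sets \<nu> = sets (A \<Otimes>\<^sub>M M)"
  obtains g where "g \<in> A \<Otimes>\<^sub>M borel \<rightarrow>\<^sub>M M"
    "distr (distr \<nu> A fst \<Otimes>\<^sub>M uniform01) (A \<Otimes>\<^sub>M M) (\<lambda>p. (fst p, g p)) = \<nu>"
proof -
  interpret fin: finite_measure \<nu> by fact
  interpret U: prob_space uniform01 by (rule prob_space_uniform01)
  obtain B \<phi> \<psi> where B: "B \<in> sets (borel :: real measure)" "B \<subseteq> {0..1}"
    and phi: "\<phi> \<in> M \<rightarrow>\<^sub>M restrict_space borel B" and psi: "\<psi> \<in> restrict_space borel B \<rightarrow>\<^sub>M M"
    and inv: "\<And>x. x \<in> space M \<Longrightarrow> \<psi> (\<phi> x) = x"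
    using borel unfolding is_borel_space_def by blast
  obtain x0 where x0: "x0 \<in> space M" using ne by blast
  have phiB: "\<phi> x \<in> B" if "x \<in> space M" for x
    using measurable_space[OF phi that] by (simp add: space_restrict_space)
  have phi': "\<phi> \<in> M \<rightarrow>\<^sub>M borel" using phi by (simp add: measurable_restrict_space2_iff)
  \<comment> \<open>The inverse is defined on \<open>B\<close> only; a fixed state outside
    \<open>B\<close> extends it measurably to all reals.\<close>
  define \<eta> where "\<eta> t = (if t \<in> B then \<psi> t else x0)" for t
  have chi: "\<eta> \<in> borel \<rightarrow>\<^sub>M M"
    unfolding \<eta>_def[abs_def]
  proof (rule measurable_If_restrict_space_iff[THEN iffD2])
    show "{x \<in> space borel. x \<in> B} \<in> sets borel" using B by simp
    show "\<psi> \<in> restrict_space borel {x. x \<in> B} \<rightarrow>\<^sub>M M \<and> (\<lambda>t. x0) \<in> restrict_space borel {x. x \<notin> B} \<rightarrow>\<^sub>M M"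
      using psi x0 by simp
  qed
  have chi_phi: "\<eta> (\<phi> x) = x" if "x \<in> space M" for x using that phiB inv by (simp add: \<eta>_def)
  have sp: "space \<nu> = space A \<times> space M" using sets_eq_imp_space_eq[OF sets] by (simp add: space_pair_measure)
  have fm: "(\<lambda>p. (fst p, \<phi> (snd p))) \<in> A \<Otimes>\<^sub>M M \<rightarrow>\<^sub>M A \<Otimes>\<^sub>M borel"
    by (intro measurable_Pair measurable_fst measurable_compose[OF measurable_snd phi'])
  then have fm': "(\<lambda>p. (fst p, \<phi> (snd p))) \<in> \<nu> \<rightarrow>\<^sub>M A \<Otimes>\<^sub>M borel"
    using measurable_cong_sets[OF sets refl] by blast
  have gm: "(\<lambda>p. (fst p, \<eta> (snd p))) \<in> A \<Otimes>\<^sub>M borel \<rightarrow>\<^sub>M A \<Otimes>\<^sub>M M"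
    by (intro measurable_Pair measurable_fst measurable_compose[OF measurable_snd chi])
  define \<nu>' where "\<nu>' = distr \<nu> (A \<Otimes>\<^sub>M borel) (\<lambda>p. (fst p, \<phi> (snd p)))"
  have fin': "finite_measure \<nu>'" unfolding \<nu>'_def by (rule fin.finite_measure_distr[OF fm'])
  have "AE p in \<nu>. snd (fst p, \<phi> (snd p)) \<in> {0..1}"
  proof (intro AE_I2)
    fix p assume "p \<in> space \<nu>"
    then have "\<phi> (snd p) \<in> B" using phiB by (auto simp: sp)
    then show "snd (fst p, \<phi> (snd p)) \<in> {0..1}" using B(2) by auto
  qed
  then have unit: "AE p in \<nu>'. snd p \<in> {0..1}"
    unfolding \<nu>'_def
  proof (subst AE_distr_iff[OF fm'])
    have "{p \<in> space (A \<Otimes>\<^sub>M borel). snd p \<in> {0..1}} = snd -` {0..1::real} \<inter> space (A \<Otimes>\<^sub>M borel)" by auto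
    then show "{p \<in> space (A \<Otimes>\<^sub>M borel). snd p \<in> {0..1::real}} \<in> sets (A \<Otimes>\<^sub>M borel)"
      using measurable_sets[OF measurable_snd, of "{0..1::real}" borel A] by simp
  qed
  have s': "sets \<nu>' = sets (A \<Otimes>\<^sub>M borel)" by (simp add: \<nu>'_def)
  obtain g0 where g0: "g0 \<in> A \<Otimes>\<^sub>M borel \<rightarrow>\<^sub>M borel"
    and eq: "distr (distr \<nu>' A fst \<Otimes>\<^sub>M uniform01) (A \<Otimes>\<^sub>M borel) (\<lambda>(a, u). (a, g0 (a, u))) = \<nu>'"
    by (rule randomization_real[OF fin' s' unit]) (rule that)
  have marg: "distr \<nu>' A fst = distr \<nu> A fst"
    unfolding \<nu>'_def distr_distr[OF measurable_fst fm'] by (simp add: comp_def)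
  have su: "sets (distr \<nu> A fst \<Otimes>\<^sub>M uniform01) = sets (A \<Otimes>\<^sub>M borel)"
    by (intro sets_pair_measure_cong) auto
  have g0m: "(\<lambda>p. (fst p, g0 p)) \<in> distr \<nu> A fst \<Otimes>\<^sub>M uniform01 \<rightarrow>\<^sub>M A \<Otimes>\<^sub>M borel"
    unfolding measurable_cong_sets[OF su refl] by (intro measurable_Pair measurable_fst g0)
  have "distr (distr \<nu> A fst \<Otimes>\<^sub>M uniform01) (A \<Otimes>\<^sub>M M) (\<lambda>p. (fst p, \<eta> (g0 p)))
      = distr (distr (distr \<nu> A fst \<Otimes>\<^sub>M uniform01) (A \<Otimes>\<^sub>M borel) (\<lambda>p. (fst p, g0 p))) (A \<Otimes>\<^sub>M M) (\<lambda>p. (fst p, \<eta> (snd p)))"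
    by (subst distr_distr[OF gm g0m]) (simp add: comp_def)
  also have "\<dots> = distr \<nu>' (A \<Otimes>\<^sub>M M) (\<lambda>p. (fst p, \<eta> (snd p)))"
    using eq unfolding marg split_beta' prod.collapse by simp
  also have "\<dots> = distr \<nu> (A \<Otimes>\<^sub>M M) (\<lambda>p. (fst p, \<eta> (\<phi> (snd p))))"
    unfolding \<nu>'_def by (subst distr_distr[OF gm fm']) (simp add: comp_def)
  also have "\<dots> = distr \<nu> (A \<Otimes>\<^sub>M M) (\<lambda>p. p)"
    by (intro distr_cong) (auto simp: sp chi_phi)
  also have "\<dots> = \<nu>" by (rule distr_id2[OF sets[symmetric]])
  finally show ?thesis
    by (intro that[of "\<lambda>p. \<eta> (g0 p)"] measurable_compose[OF g0 chi])
qed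

section \<open>Couplings of paths that agree from a given time on\<close>

definition agree_from :: "'a measure \<Rightarrow> nat \<Rightarrow> ((nat \<Rightarrow> 'a) \<times> (nat \<Rightarrow> 'a)) set" where
  "agree_from M n = {p \<in> space (path_space M \<Otimes>\<^sub>M path_space M). \<forall>k\<ge>n. fst p k = snd p k}"

lemma agree_from_mono: "m \<le> n \<Longrightarrow> agree_from M m \<subseteq> agree_from M n"
  by (auto simp: agree_from_def)

lemma agree_from_sets:
  assumes diag: "diagonal M \<in> sets (M \<Otimes>\<^sub>M M)"
  shows "agree_from M n \<in> sets (path_space M \<Otimes>\<^sub>M path_space M)"
proof -
  have m: "(\<lambda>p. (fst p k, snd p k)) \<in> path_space M \<Otimes>\<^sub>M path_space M \<rightarrow>\<^sub>M M \<Otimes>\<^sub>M M" for k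
    by (intro measurable_Pair measurable_compose[OF measurable_fst path_component_measurable]
        measurable_compose[OF measurable_snd path_component_measurable])
  have "agree_from M n = (\<Inter>k\<in>{n..}. (\<lambda>p. (fst p k, snd p k)) -` diagonal M \<inter> space (path_space M \<Otimes>\<^sub>M path_space M))"
    by (auto simp: agree_from_def diagonal_def space_pair_measure space_path_space)
  also have "\<dots> \<in> sets (path_space M \<Otimes>\<^sub>M path_space M)"
    using measurable_sets[OF m diag] by (intro sets.countable_INT') auto
  finally show ?thesis .
qed

lemma case_nat_measurable_path: "(\<lambda>p. case_nat (snd p) (fst p)) \<in> path_space M \<Otimes>\<^sub>M M \<rightarrow>\<^sub>M path_space M"
proof (rule measurable_PiM_single')
  show "(\<lambda>p. case_nat (snd p) (fst p) i) \<in> path_space M \<Otimes>\<^sub>M M \<rightarrow>\<^sub>M M" for i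
    by (cases i) (auto intro: measurable_compose[OF measurable_fst path_component_measurable])
  show "(\<lambda>p i. case_nat (snd p) (fst p) i) \<in> space (path_space M \<Otimes>\<^sub>M M) \<rightarrow> UNIV \<rightarrow>\<^sub>E space M"
    by (auto simp: space_pair_measure space_path_space split: nat.split)
qed

text \<open>A path is recovered in law from its shift by sampling the initial state conditionally on
  the later ones; \<open>h\<close> only puts this state in front, so the later coordinates stay
  untouched.\<close>

lemma path_randomization:
  assumes borel: "is_borel_space M" and ne: "space M \<noteq> {}"
    and fin: "finite_measure \<kappa>" and sets: "sets \<kappa> = sets (path_space M)"
  obtains h where "h \<in> path_space M \<Otimes>\<^sub>M borel \<rightarrow>\<^sub>M path_space M"
    "distr (distr \<kappa> (path_space M) (\<lambda>\<omega> i. \<omega> (i + 1)) \<Otimes>\<^sub>M uniform01) (path_space M) h = \<kappa>"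
    "\<And>p i. h p (Suc i) = fst p i"
proof -
  interpret fin: finite_measure \<kappa> by fact
  note meas = measurable_cong_sets[OF sets refl]
  have sp: "space \<kappa> = space (path_space M)" by (rule sets_eq_imp_space_eq[OF sets])
  have m: "(\<lambda>\<omega>. (\<lambda>i. \<omega> (i + 1), \<omega> 0)) \<in> \<kappa> \<rightarrow>\<^sub>M path_space M \<Otimes>\<^sub>M M"
    unfolding meas by (intro measurable_Pair shift_measurable path_component_measurable)
  define \<nu> where "\<nu> = distr \<kappa> (path_space M \<Otimes>\<^sub>M M) (\<lambda>\<omega>. (\<lambda>i. \<omega> (i + 1), \<omega> 0))"
  have f: "finite_measure \<nu>" unfolding \<nu>_def by (rule fin.finite_measure_distr[OF m])
  have s: "sets \<nu> = sets (path_space M \<Otimes>\<^sub>M M)" by (simp add: \<nu>_def)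
  obtain g where g: "g \<in> path_space M \<Otimes>\<^sub>M borel \<rightarrow>\<^sub>M M"
    and eq: "distr (distr \<nu> (path_space M) fst \<Otimes>\<^sub>M uniform01) (path_space M \<Otimes>\<^sub>M M) (\<lambda>p. (fst p, g p)) = \<nu>"
    by (rule randomization[OF borel ne f s]) (rule that)
  have marg: "distr \<nu> (path_space M) fst = distr \<kappa> (path_space M) (\<lambda>\<omega> i. \<omega> (i + 1))"
    unfolding \<nu>_def distr_distr[OF measurable_fst m] by (simp add: comp_def)
  have su: "sets (distr \<kappa> (path_space M) (\<lambda>\<omega> i. \<omega> (i + 1)) \<Otimes>\<^sub>M uniform01) = sets (path_space M \<Otimes>\<^sub>M borel)"
    by (intro sets_pair_measure_cong) auto
  have pg: "(\<lambda>p. (fst p, g p)) \<in> path_space M \<Otimes>\<^sub>M borel \<rightarrow>\<^sub>M path_space M \<Otimes>\<^sub>M M"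
    by (intro measurable_Pair measurable_fst g)
  then have gm: "(\<lambda>p. (fst p, g p)) \<in> distr \<kappa> (path_space M) (\<lambda>\<omega> i. \<omega> (i + 1)) \<Otimes>\<^sub>M uniform01 \<rightarrow>\<^sub>M path_space M \<Otimes>\<^sub>M M"
    unfolding measurable_cong_sets[OF su refl] .
  define h where "h p = case_nat (g p) (fst p)" for p :: "(nat \<Rightarrow> 'a) \<times> real"
  have "distr (distr \<kappa> (path_space M) (\<lambda>\<omega> i. \<omega> (i + 1)) \<Otimes>\<^sub>M uniform01) (path_space M) h
      = distr (distr (distr \<kappa> (path_space M) (\<lambda>\<omega> i. \<omega> (i + 1)) \<Otimes>\<^sub>M uniform01) (path_space M \<Otimes>\<^sub>M M) (\<lambda>p. (fst p, g p)))
        (path_space M) (\<lambda>p. case_nat (snd p) (fst p))"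
    by (subst distr_distr[OF case_nat_measurable_path gm]) (simp add: comp_def h_def[abs_def])
  also have "\<dots> = distr \<nu> (path_space M) (\<lambda>p. case_nat (snd p) (fst p))"
    using eq unfolding marg by simp
  also have "\<dots> = distr \<kappa> (path_space M) (\<lambda>\<omega>. \<omega>)"
  proof -
    have "case_nat (\<omega> 0) (\<lambda>i. \<omega> (i + 1)) = \<omega>" for \<omega> :: "nat \<Rightarrow> 'a"
      by (rule ext) (simp split: nat.split)
    then show ?thesis
      unfolding \<nu>_def distr_distr[OF case_nat_measurable_path m] comp_def fst_conv snd_conv by (simp only:)
  qed
  also have "\<dots> = \<kappa>" by (rule distr_id2[OF sets[symmetric]])
  finally show ?thesis
  proof (rule that[rotated])
    show "h \<in> path_space M \<Otimes>\<^sub>M borel \<rightarrow>\<^sub>M path_space M"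
      using measurable_compose[OF pg case_nat_measurable_path] by (simp add: h_def[abs_def])
  qed (simp add: h_def)
qed

text \<open>Induction on \<open>n\<close>: the shifted laws have a coupling that agrees from
  \<open>n\<close> on, and prepending a separately sampled initial state to each path delays the
  agreement by one. The measures are finite instead of normalised because they will be parts of path
  laws.\<close>

lemma glue_paths:
  assumes borel: "is_borel_space M" and ne: "space M \<noteq> {}" and diag: "diagonal M \<in> sets (M \<Otimes>\<^sub>M M)"
    and "finite_measure \<kappa>1" "finite_measure \<kappa>2" "sets \<kappa>1 = sets (path_space M)" "sets \<kappa>2 = sets (path_space M)"
    and "distr \<kappa>1 (path_space M) (\<lambda>\<omega> i. \<omega> (i + n)) = distr \<kappa>2 (path_space M) (\<lambda>\<omega> i. \<omega> (i + n))"
  shows "\<exists>\<xi>. finite_measure \<xi> \<and> sets \<xi> = sets (path_space M \<Otimes>\<^sub>M path_space M) \<and>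
    distr \<xi> (path_space M) fst = \<kappa>1 \<and> distr \<xi> (path_space M) snd = \<kappa>2 \<and> (AE p in \<xi>. p \<in> agree_from M n)"
  using assms(4-8)
proof (induction n arbitrary: \<kappa>1 \<kappa>2)
  case 0
  interpret K: finite_measure \<kappa>1 by fact
  have eq: "\<kappa>2 = \<kappa>1" using 0 distr_id2[of "path_space M" \<kappa>1] distr_id2[of "path_space M" \<kappa>2] by simp
  have m: "(\<lambda>\<omega>. (\<omega>, \<omega>)) \<in> \<kappa>1 \<rightarrow>\<^sub>M path_space M \<Otimes>\<^sub>M path_space M"
    unfolding measurable_cong_sets[OF 0(3) refl] by (intro measurable_Pair measurable_ident_sets refl)
  define \<xi> where "\<xi> = distr \<kappa>1 (path_space M \<Otimes>\<^sub>M path_space M) (\<lambda>\<omega>. (\<omega>, \<omega>))"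
  have "finite_measure \<xi>" unfolding \<xi>_def by (rule K.finite_measure_distr[OF m])
  moreover have "sets \<xi> = sets (path_space M \<Otimes>\<^sub>M path_space M)" by (simp add: \<xi>_def)
  moreover have "distr \<xi> (path_space M) fst = \<kappa>1" "distr \<xi> (path_space M) snd = \<kappa>2"
    unfolding \<xi>_def eq using distr_id2[OF 0(3)[symmetric]] by (simp_all add: distr_distr[OF _ m] comp_def)
  moreover have "AE p in \<xi>. p \<in> agree_from M 0"
    unfolding \<xi>_def using agree_from_sets[OF diag, of 0] sets_eq_imp_space_eq[OF 0(3)]
    by (subst AE_distr_iff[OF m]) (auto simp: agree_from_def space_pair_measure intro!: AE_I2)
  ultimately show ?case by blast
next
  case (Suc n)
  let ?S = "path_space M" and ?\<theta> = "\<lambda>\<omega> i. \<omega> (i + 1)"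
  interpret K1: finite_measure \<kappa>1 by fact
  interpret K2: finite_measure \<kappa>2 by fact
  interpret U: prob_space uniform01 by (rule prob_space_uniform01)
  interpret UU: pair_prob_space uniform01 uniform01 ..
  have m1: "?\<theta> \<in> \<kappa>1 \<rightarrow>\<^sub>M ?S" "?\<theta> \<in> \<kappa>2 \<rightarrow>\<^sub>M ?S"
    unfolding measurable_cong_sets[OF Suc(4) refl] measurable_cong_sets[OF Suc(5) refl] by (rule shift_measurable)+
  have sh: "distr (distr \<kappa> ?S ?\<theta>) ?S (\<lambda>\<omega> i. \<omega> (i + n)) = distr \<kappa> ?S (\<lambda>\<omega> i. \<omega> (i + Suc n))"
    if "?\<theta> \<in> \<kappa> \<rightarrow>\<^sub>M ?S" for \<kappa>
    by (subst distr_distr[OF shift_measurable that]) (simp add: comp_def)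
  have "\<exists>\<xi>. finite_measure \<xi> \<and> sets \<xi> = sets (?S \<Otimes>\<^sub>M ?S) \<and>
    distr \<xi> ?S fst = distr \<kappa>1 ?S ?\<theta> \<and> distr \<xi> ?S snd = distr \<kappa>2 ?S ?\<theta> \<and> (AE p in \<xi>. p \<in> agree_from M n)"
    using Suc(6) by (intro Suc.IH K1.finite_measure_distr K2.finite_measure_distr m1) (simp_all only: sets_distr sh[OF m1(1)] sh[OF m1(2)])
  then obtain \<xi> where xi: "finite_measure \<xi>" "sets \<xi> = sets (?S \<Otimes>\<^sub>M ?S)"
    "distr \<xi> ?S fst = distr \<kappa>1 ?S ?\<theta>" "distr \<xi> ?S snd = distr \<kappa>2 ?S ?\<theta>" "AE p in \<xi>. p \<in> agree_from M n" by blast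
  interpret X: finite_measure \<xi> by fact
  interpret XU: pair_sigma_finite \<xi> "uniform01 \<Otimes>\<^sub>M uniform01" ..
  obtain h1 where h1: "h1 \<in> ?S \<Otimes>\<^sub>M borel \<rightarrow>\<^sub>M ?S" "distr (distr \<kappa>1 ?S ?\<theta> \<Otimes>\<^sub>M uniform01) ?S h1 = \<kappa>1"
    "\<And>p i. h1 p (Suc i) = fst p i"
    by (rule path_randomization[OF borel ne Suc(2,4)]) (rule that)
  obtain h2 where h2: "h2 \<in> ?S \<Otimes>\<^sub>M borel \<rightarrow>\<^sub>M ?S" "distr (distr \<kappa>2 ?S ?\<theta> \<Otimes>\<^sub>M uniform01) ?S h2 = \<kappa>2"
    "\<And>p i. h2 p (Suc i) = fst p i"
    by (rule path_randomization[OF borel ne Suc(3,5)]) (rule that)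
  \<comment> \<open>A coupled pair of shifted paths together with one uniform variable for each of
    the two missing initial states.\<close>
  define Q where "Q = \<xi> \<Otimes>\<^sub>M (uniform01 \<Otimes>\<^sub>M uniform01)"
  have sQ: "sets Q = sets ((?S \<Otimes>\<^sub>M ?S) \<Otimes>\<^sub>M (borel \<Otimes>\<^sub>M borel))"
    unfolding Q_def using xi(2) by (intro sets_pair_measure_cong) auto
  note Qmeas = measurable_cong_sets[OF sQ refl]
  have xm: "fst \<in> \<xi> \<rightarrow>\<^sub>M ?S" "snd \<in> \<xi> \<rightarrow>\<^sub>M ?S" unfolding measurable_cong_sets[OF xi(2) refl] by auto
  have um: "fst \<in> uniform01 \<Otimes>\<^sub>M uniform01 \<rightarrow>\<^sub>M borel" "snd \<in> uniform01 \<Otimes>\<^sub>M uniform01 \<rightarrow>\<^sub>M borel"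
    using measurable_fst[of uniform01 uniform01] measurable_snd[of uniform01 uniform01]
    by (simp_all add: measurable_cong_sets[OF refl sets_uniform01])
  have U_in: "uniform01 \<in> space (prob_algebra borel)" by (simp add: space_prob_algebra U.prob_space_axioms)
  have ud: "distr (uniform01 \<Otimes>\<^sub>M uniform01) borel fst = uniform01" "distr (uniform01 \<Otimes>\<^sub>M uniform01) borel snd = uniform01"
    using couplingsD[OF pair_measure_couplings[OF U_in U_in] U_in U_in] by auto
  have E1: "(\<lambda>p. (fst (fst p), fst (snd p))) \<in> Q \<rightarrow>\<^sub>M ?S \<Otimes>\<^sub>M borel"
    unfolding Qmeas by (intro measurable_Pair measurable_compose[OF measurable_fst measurable_fst] measurable_compose[OF measurable_snd measurable_fst])
  have E2: "(\<lambda>p. (snd (fst p), snd (snd p))) \<in> Q \<rightarrow>\<^sub>M ?S \<Otimes>\<^sub>M borel"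
    unfolding Qmeas by (intro measurable_Pair measurable_compose[OF measurable_fst measurable_snd] measurable_compose[OF measurable_snd measurable_snd])
  have D1: "distr Q (?S \<Otimes>\<^sub>M borel) (\<lambda>p. (fst (fst p), fst (snd p))) = distr \<kappa>1 ?S ?\<theta> \<Otimes>\<^sub>M uniform01"
    using pair_measure_distr[OF xm(1) um(1)] U.sigma_finite_measure_axioms
    unfolding ud xi(3) Q_def by (simp add: split_beta')
  have D2: "distr Q (?S \<Otimes>\<^sub>M borel) (\<lambda>p. (snd (fst p), snd (snd p))) = distr \<kappa>2 ?S ?\<theta> \<Otimes>\<^sub>M uniform01"
    using pair_measure_distr[OF xm(2) um(2)] U.sigma_finite_measure_axioms
    unfolding ud xi(4) Q_def by (simp add: split_beta')
  have H1: "(\<lambda>p. h1 (fst (fst p), fst (snd p))) \<in> Q \<rightarrow>\<^sub>M ?S" by (rule measurable_compose[OF E1 h1(1)])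
  have H2: "(\<lambda>p. h2 (snd (fst p), snd (snd p))) \<in> Q \<rightarrow>\<^sub>M ?S" by (rule measurable_compose[OF E2 h2(1)])
  define H where "H p = (h1 (fst (fst p), fst (snd p)), h2 (snd (fst p), snd (snd p)))" for p
  have H: "H \<in> Q \<rightarrow>\<^sub>M ?S \<Otimes>\<^sub>M ?S" unfolding H_def[abs_def] by (intro measurable_Pair H1 H2)
  define \<xi>' where "\<xi>' = distr Q (?S \<Otimes>\<^sub>M ?S) H"
  have marg: "distr \<xi>' ?S fst = \<kappa>1" "distr \<xi>' ?S snd = \<kappa>2"
  proof -
    have "distr \<xi>' ?S fst = distr Q ?S (\<lambda>p. h1 (fst (fst p), fst (snd p)))"
      unfolding \<xi>'_def distr_distr[OF measurable_fst H] by (simp add: comp_def H_def)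
    also have "\<dots> = distr (distr Q (?S \<Otimes>\<^sub>M borel) (\<lambda>p. (fst (fst p), fst (snd p)))) ?S h1"
      unfolding distr_distr[OF h1(1) E1] by (simp add: comp_def)
    also have "\<dots> = \<kappa>1" unfolding D1 by (rule h1(2))
    finally show "distr \<xi>' ?S fst = \<kappa>1" .
    have "distr \<xi>' ?S snd = distr Q ?S (\<lambda>p. h2 (snd (fst p), snd (snd p)))"
      unfolding \<xi>'_def distr_distr[OF measurable_snd H] by (simp add: comp_def H_def)
    also have "\<dots> = distr (distr Q (?S \<Otimes>\<^sub>M borel) (\<lambda>p. (snd (fst p), snd (snd p)))) ?S h2"
      unfolding distr_distr[OF h2(1) E2] by (simp add: comp_def)
    also have "\<dots> = \<kappa>2" unfolding D2 by (rule h2(2))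
    finally show "distr \<xi>' ?S snd = \<kappa>2" .
  qed
  have s': "sets \<xi>' = sets (?S \<Otimes>\<^sub>M ?S)" by (simp add: \<xi>'_def)
  have "finite_measure \<xi>'"
  proof (rule finite_measureI)
    have "fst \<in> \<xi>' \<rightarrow>\<^sub>M ?S" unfolding measurable_cong_sets[OF s' refl] by simp
    then have "emeasure \<kappa>1 (space ?S) = emeasure \<xi>' (fst -` space ?S \<inter> space \<xi>')"
      unfolding marg(1)[symmetric] by (intro emeasure_distr) auto
    also have "fst -` space ?S \<inter> space \<xi>' = space \<xi>'"
      using sets_eq_imp_space_eq[OF s'] by (auto simp: space_pair_measure)
    finally show "emeasure \<xi>' (space \<xi>') \<noteq> \<infinity>" using K1.emeasure_finite[of "space ?S"] by simp
  qed
  moreover have "AE p in \<xi>'. p \<in> agree_from M (Suc n)"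
  proof -
    have fstQ: "fst \<in> Q \<rightarrow>\<^sub>M \<xi>" unfolding Q_def by simp
    have dQ: "distr Q \<xi> fst = \<xi>" unfolding Q_def by (rule UU.distr_pair_fst)
    have "AE p in Q. fst p \<in> agree_from M n"
      by (rule AE_distrD[OF fstQ], unfold dQ, rule xi(5))
    then have "AE p in Q. H p \<in> agree_from M (Suc n)"
      using AE_space
    proof eventually_elim
      fix p assume p: "fst p \<in> agree_from M n" "p \<in> space Q"
      have "H p \<in> space (?S \<Otimes>\<^sub>M ?S)" using measurable_space[OF H p(2)] .
      moreover have "fst (H p) k = snd (H p) k" if "k \<ge> Suc n" for k
        using that p(1) h1(3) h2(3) by (cases k) (auto simp: H_def agree_from_def)
      ultimately show "H p \<in> agree_from M (Suc n)" by (simp add: agree_from_def)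
    qed
    moreover have "{p \<in> space (?S \<Otimes>\<^sub>M ?S). p \<in> agree_from M (Suc n)} = agree_from M (Suc n)"
      by (auto simp: agree_from_def)
    ultimately show ?thesis
      unfolding \<xi>'_def using agree_from_sets[OF diag, of "Suc n"] by (subst AE_distr_iff[OF H]) auto
  qed
  ultimately show ?case using marg s' by blast
qed

section \<open>Splitting measures and removing common parts\<close>

definition splits :: "'a measure \<Rightarrow> 'a measure \<Rightarrow> 'a measure \<Rightarrow> bool" where
  "splits R K r \<longleftrightarrow> sets K = sets R \<and> sets r = sets R \<and>
     (\<forall>A\<in>sets R. emeasure R A = emeasure K A + emeasure r A)"

lemma splits_finite:
  assumes "splits R K r" "finite_measure R"
  shows "finite_measure K" "finite_measure r"
proof -
  interpret finite_measure R by fact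
  have s: "space K = space R" "space r = space R"
    using assms(1) sets_eq_imp_space_eq by (auto simp: splits_def)
  have e: "emeasure R (space R) = emeasure K (space R) + emeasure r (space R)"
    using assms(1) by (auto simp: splits_def)
  show "finite_measure K" using e emeasure_finite[of "space R"] by (intro finite_measureI) (auto simp: s)
  show "finite_measure r" using e emeasure_finite[of "space R"] by (intro finite_measureI) (auto simp: s)
qed

lemma splits_density:
  assumes sets: "sets R = sets S" and a: "a \<in> borel_measurable S" and a01: "\<And>x. 0 \<le> a x \<and> a x \<le> (1::real)"
  shows "splits R (density R (\<lambda>x. ennreal (a x))) (density R (\<lambda>x. ennreal (1 - a x)))"
proof -
  have aR: "a \<in> borel_measurable R" using a measurable_cong_sets[OF sets refl] by blast
  have "emeasure R A = emeasure (density R (\<lambda>x. ennreal (a x))) A + emeasure (density R (\<lambda>x. ennreal (1 - a x))) A"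
    if A: "A \<in> sets R" for A
  proof -
    have "emeasure (density R (\<lambda>x. ennreal (a x))) A + emeasure (density R (\<lambda>x. ennreal (1 - a x))) A
        = (\<integral>\<^sup>+x. ennreal (a x) * indicator A x + ennreal (1 - a x) * indicator A x \<partial>R)"
      using A aR by (subst nn_integral_add) (auto simp: emeasure_density)
    also have "\<dots> = (\<integral>\<^sup>+x. indicator A x \<partial>R)"
      using a01 by (intro nn_integral_cong) (auto simp: ennreal_plus[symmetric] simp del: ennreal_plus split: split_indicator)
    finally show ?thesis using A by simp
  qed
  then show ?thesis by (simp add: splits_def)
qed

text \<open>The images under \<open>T\<close> share the part with density min(f, g). It is lifted
  back by weighting each original measure at \<open>x\<close> with the fraction of its image density
  at \<open>T x\<close> that is shared. The images of the remainders have densities f - min(f, g)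
  and g - min(f, g), which are never both positive.\<close>

lemma remove_common_part:
  assumes fin: "finite_measure R1" "finite_measure R2" and sets: "sets R1 = sets S" "sets R2 = sets S"
    and T: "T \<in> S \<rightarrow>\<^sub>M S"
  obtains K1 r1 K2 r2 A where "splits R1 K1 r1" "splits R2 K2 r2" "distr K1 S T = distr K2 S T"
    "A \<in> sets S" "emeasure (distr r1 S T) A = 0" "emeasure (distr r2 S T) (space S - A) = 0"
proof -
  interpret F1: finite_measure R1 by fact
  interpret F2: finite_measure R2 by fact
  have T1: "T \<in> R1 \<rightarrow>\<^sub>M S" and T2: "T \<in> R2 \<rightarrow>\<^sub>M S"
    using T measurable_cong_sets[OF sets(1) refl] measurable_cong_sets[OF sets(2) refl] by blast+
  obtain \<rho> and f g :: "'a \<Rightarrow> real" where "finite_measure \<rho>" and sr: "sets \<rho> = sets S"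
    and f: "f \<in> borel_measurable S" and g: "g \<in> borel_measurable S"
    and nn: "\<And>x. 0 \<le> f x" "\<And>x. 0 \<le> g x"
    and d: "distr R1 S T = density \<rho> (\<lambda>x. ennreal (f x))" "distr R2 S T = density \<rho> (\<lambda>x. ennreal (g x))"
    by (rule common_density[OF F1.finite_measure_distr[OF T1] F2.finite_measure_distr[OF T2] sets_distr sets_distr]) (rule that)
  \<comment> \<open>The shared fraction of the density \<open>u\<close>, with value 0 where
    \<open>u\<close> vanishes and there is nothing to share.\<close>
  define share where "share u v x = (if u x = 0 then 0 else min (u x) (v x) / u x)" for u v :: "'a \<Rightarrow> real" and x
  have share_m: "share u v \<in> borel_measurable S" if "u \<in> borel_measurable S" "v \<in> borel_measurable S" for u v
  proof -
    have "share u v = (\<lambda>x. min (u x) (v x) / u x)" by (auto simp: share_def)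
    then show ?thesis using that by simp
  qed
  have share01: "0 \<le> share u v x \<and> share u v x \<le> 1" if "0 \<le> u x" "0 \<le> v x" for u v x
    using that by (auto simp: share_def divide_le_eq)
  have share_mult: "u x * share u v x = min (u x) (v x)" "u x * (1 - share u v x) = u x - min (u x) (v x)"
    if "0 \<le> u x" "0 \<le> v x" for u v x
    using that by (auto simp: share_def right_diff_distrib)
  have dens: "distr (density R (\<lambda>x. ennreal (k (T x)))) S T = density \<rho> (\<lambda>x. ennreal (u x * k x))"
    if TR: "T \<in> R \<rightarrow>\<^sub>M S" and k: "k \<in> borel_measurable S" "\<And>x. 0 \<le> k x" and u: "u \<in> borel_measurable S" "\<And>x. 0 \<le> u x"
      and du: "distr R S T = density \<rho> (\<lambda>x. ennreal (u x))" for R k u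
  proof -
    have k': "(\<lambda>x. ennreal (k x)) \<in> borel_measurable S" using k by simp
    have "distr (density R (\<lambda>x. ennreal (k (T x)))) S T = density (distr R S T) (\<lambda>x. ennreal (k x))"
      by (rule density_distr[OF k' TR, symmetric])
    also have "\<dots> = density \<rho> (\<lambda>x. ennreal (u x) * ennreal (k x))"
      unfolding du using u k k' by (intro density_density_eq) (auto simp: measurable_cong_sets[OF sr refl])
    also have "\<dots> = density \<rho> (\<lambda>x. ennreal (u x * k x))"
      using u k by (simp add: ennreal_mult)
    finally show ?thesis .
  qed
  \<comment> \<open>The first remainder has zero image density on this set, the second one off
    it.\<close>
  define A where "A = {x \<in> space S. f x \<le> g x}"
  have A: "A \<in> sets S" unfolding A_def by (intro borel_measurable_le f g)
  define a where "a = share f g"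
  define b where "b = share g f"
  have am: "a \<in> borel_measurable S" "b \<in> borel_measurable S" unfolding a_def b_def by (intro share_m f g)+
  have a01: "0 \<le> a x \<and> a x \<le> 1" "0 \<le> b x \<and> b x \<le> 1" for x unfolding a_def b_def using nn by (auto intro!: share01)
  have aT: "(\<lambda>x. a (T x)) \<in> borel_measurable S" "(\<lambda>x. b (T x)) \<in> borel_measurable S"
    using measurable_compose[OF T am(1)] measurable_compose[OF T am(2)] by auto
  show ?thesis
  proof (rule that[OF splits_density[OF sets(1) aT(1)] splits_density[OF sets(2) aT(2)] _ A])
    show "0 \<le> a (T x) \<and> a (T x) \<le> 1" "0 \<le> b (T x) \<and> b (T x) \<le> 1" for x using a01 by auto
    have "distr (density R1 (\<lambda>x. ennreal (a (T x)))) S T = density \<rho> (\<lambda>x. ennreal (min (f x) (g x)))"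
      using dens[OF T1 am(1) _ f nn(1) d(1)] a01 share_mult nn by (simp add: a_def)
    also have "\<dots> = distr (density R2 (\<lambda>x. ennreal (b (T x)))) S T"
      using dens[OF T2 am(2) _ g nn(2) d(2)] a01 share_mult nn by (simp add: b_def min.commute)
    finally show "distr (density R1 (\<lambda>x. ennreal (a (T x)))) S T = distr (density R2 (\<lambda>x. ennreal (b (T x)))) S T" .
    have m1: "(\<lambda>x. 1 - a x) \<in> borel_measurable S" "(\<lambda>x. 1 - b x) \<in> borel_measurable S" using am by auto
    have "distr (density R1 (\<lambda>x. ennreal (1 - a (T x)))) S T = density \<rho> (\<lambda>x. ennreal (f x - min (f x) (g x)))"
      using dens[OF T1 m1(1) _ f nn(1) d(1)] a01 share_mult nn by (simp add: a_def)
    then show "emeasure (distr (density R1 (\<lambda>x. ennreal (1 - a (T x)))) S T) A = 0"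
      using A f g sr by (simp add: emeasure_density measurable_cong_sets[OF sr refl])
        (intro nn_integral_zero' AE_I2, auto simp: A_def split: split_indicator)
    have "distr (density R2 (\<lambda>x. ennreal (1 - b (T x)))) S T = density \<rho> (\<lambda>x. ennreal (g x - min (g x) (f x)))"
      using dens[OF T2 m1(2) _ g nn(2) d(2)] a01 share_mult nn by (simp add: b_def)
    then show "emeasure (distr (density R2 (\<lambda>x. ennreal (1 - b (T x)))) S T) (space S - A) = 0"
      using A f g sr by (simp add: emeasure_density measurable_cong_sets[OF sr refl])
        (intro nn_integral_zero' AE_I2, auto simp: A_def split: split_indicator)
  qed
qed

text \<open>Goldstein's greedy construction: at stage \<open>n\<close> remove from both laws the largest parts
  whose images under the \<open>n\<close>-fold shift agree. The remainders have mutually singular images, so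
  their mass is the total variation distance of the shifted laws.\<close>

lemma successive_splitting:
  fixes M :: "'a measure"
  assumes L: "L1 \<in> space (prob_algebra (path_space M))" "L2 \<in> space (prob_algebra (path_space M))"
  obtains K1 K2 R1 R2 where
    "\<And>n::nat. sets (K1 n) = sets (path_space M)" "\<And>n. sets (K2 n) = sets (path_space M)"
    "\<And>n. finite_measure (K1 n)" "\<And>n. finite_measure (K2 n)"
    "\<And>n. distr (K1 n) (path_space M) (\<lambda>\<omega> i. \<omega> (i + n)) = distr (K2 n) (path_space M) (\<lambda>\<omega> i. \<omega> (i + n))"
    "\<And>n A. A \<in> sets (path_space M) \<Longrightarrow> emeasure L1 A = (\<Sum>i<n. emeasure (K1 i) A) + emeasure (R1 n) A"
    "\<And>n A. A \<in> sets (path_space M) \<Longrightarrow> emeasure L2 A = (\<Sum>i<n. emeasure (K2 i) A) + emeasure (R2 n) A"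
    "\<And>n. sets (R1 n) = sets (path_space M)" "\<And>n. sets (R2 n) = sets (path_space M)"
    "\<And>n. emeasure (R1 n) (space (path_space M)) = emeasure (R2 n) (space (path_space M))"
    "\<And>n. emeasure (R1 (Suc n)) (space (path_space M)) \<le>
      ennreal (tv_dist (path_space M) (distr L1 (path_space M) (\<lambda>\<omega> i. \<omega> (i + n))) (distr L2 (path_space M) (\<lambda>\<omega> i. \<omega> (i + n))))"
proof -
  let ?S = "path_space M"
  note p1 = prob_algebraD[OF L(1)] and p2 = prob_algebraD[OF L(2)]
  interpret L1: prob_space L1 by (rule p1)
  interpret L2: prob_space L2 by (rule p2)
  define \<theta> :: "nat \<Rightarrow> (nat \<Rightarrow> 'a) \<Rightarrow> nat \<Rightarrow> 'a" where "\<theta> n = (\<lambda>\<omega> i. \<omega> (i + n))" for n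
  have \<theta>: "\<theta> n \<in> ?S \<rightarrow>\<^sub>M ?S" for n unfolding \<theta>_def by (rule shift_measurable)
  define ok where "ok R \<longleftrightarrow> finite_measure (fst R) \<and> finite_measure (snd R) \<and> sets (fst R) = sets ?S \<and> sets (snd R) = sets ?S"
    for R :: "(nat \<Rightarrow> 'a) measure \<times> (nat \<Rightarrow> 'a) measure"
  define step where "step n R R' \<longleftrightarrow> (\<exists>K1 K2 A. splits (fst R) K1 (fst R') \<and> splits (snd R) K2 (snd R') \<and>
      distr K1 ?S (\<theta> n) = distr K2 ?S (\<theta> n) \<and> A \<in> sets ?S \<and>
      emeasure (distr (fst R') ?S (\<theta> n)) A = 0 \<and> emeasure (distr (snd R') ?S (\<theta> n)) (space ?S - A) = 0)" for n R R'
  have ex: "\<exists>R'. ok R' \<and> step n R R'" if R: "ok R" for R n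
  proof -
    obtain K1 r1 K2 r2 A where *: "splits (fst R) K1 r1" "splits (snd R) K2 r2" "distr K1 ?S (\<theta> n) = distr K2 ?S (\<theta> n)"
      "A \<in> sets ?S" "emeasure (distr r1 ?S (\<theta> n)) A = 0" "emeasure (distr r2 ?S (\<theta> n)) (space ?S - A) = 0"
      by (rule remove_common_part[of "fst R" "snd R" ?S "\<theta> n"]) (use R \<theta> in \<open>auto simp: ok_def\<close>)
    have "ok (r1, r2)"
      using R *(1,2) splits_finite(2)[OF *(1)] splits_finite(2)[OF *(2)] by (auto simp: ok_def splits_def)
    moreover have "step n R (r1, r2)" unfolding step_def fst_conv snd_conv using * by blast
    ultimately show ?thesis by blast
  qed
  have ok0: "ok (L1, L2)" using p1 p2 by (simp add: ok_def)
  have "\<exists>R. R 0 = (L1, L2) \<and> (\<forall>n. ok (R n) \<and> step n (R n) (R (Suc n)))"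
  proof -
    have "\<exists>R. \<forall>n. (ok (R n) \<and> (n = 0 \<longrightarrow> R n = (L1, L2))) \<and> step n (R n) (R (Suc n))"
      by (rule dependent_nat_choice) (use ok0 ex in auto)
    then show ?thesis by blast
  qed
  then obtain R where R0: "R 0 = (L1, L2)" and ok: "\<And>n. ok (R n)" and step: "\<And>n. step n (R n) (R (Suc n))" by blast
  define R1 where "R1 n = fst (R n)" for n
  define R2 where "R2 n = snd (R n)" for n
  have "\<forall>n. \<exists>K1 K2 A. splits (R1 n) K1 (R1 (Suc n)) \<and> splits (R2 n) K2 (R2 (Suc n)) \<and>
      distr K1 ?S (\<theta> n) = distr K2 ?S (\<theta> n) \<and> A \<in> sets ?S \<and>
      emeasure (distr (R1 (Suc n)) ?S (\<theta> n)) A = 0 \<and> emeasure (distr (R2 (Suc n)) ?S (\<theta> n)) (space ?S - A) = 0"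
    using step unfolding step_def R1_def R2_def by blast
  then obtain K1 K2 A where K: "\<And>n. splits (R1 n) (K1 n) (R1 (Suc n))" "\<And>n. splits (R2 n) (K2 n) (R2 (Suc n))"
    and eq: "\<And>n. distr (K1 n) ?S (\<theta> n) = distr (K2 n) ?S (\<theta> n)" and A: "\<And>n. A n \<in> sets ?S"
    and sing: "\<And>n. emeasure (distr (R1 (Suc n)) ?S (\<theta> n)) (A n) = 0" "\<And>n. emeasure (distr (R2 (Suc n)) ?S (\<theta> n)) (space ?S - A n) = 0"
    unfolding choice_iff by blast
  have sR: "sets (R1 n) = sets ?S" "sets (R2 n) = sets ?S" and fR: "finite_measure (R1 n)" "finite_measure (R2 n)" for n
    using ok[of n] by (auto simp: ok_def R1_def R2_def)
  have sK: "sets (K1 n) = sets ?S" "sets (K2 n) = sets ?S" for n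
    using K[of n] sR[of n] by (auto simp: splits_def)
  have fK: "finite_measure (K1 n)" "finite_measure (K2 n)" for n
    using splits_finite(1)[OF K(1) fR(1)] splits_finite(1)[OF K(2) fR(2)] by auto
  have sums: "emeasure l B = (\<Sum>i<n. emeasure (J i) B) + emeasure (Q n) B"
    if B: "B \<in> sets ?S" and "Q 0 = l" and J: "\<And>n. splits (Q n) (J n) (Q (Suc n))" and s: "\<And>n. sets (Q n) = sets ?S"
    for l :: "(nat \<Rightarrow> 'a) measure" and J Q n B
  proof (induction n)
    case 0
    show ?case using \<open>Q 0 = l\<close> by simp
  next
    case (Suc n)
    have "emeasure (Q n) B = emeasure (J n) B + emeasure (Q (Suc n)) B"
      using J[of n] B s by (simp add: splits_def)
    then show ?case using Suc by (simp add: ac_simps)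
  qed
  have sum1: "emeasure L1 B = (\<Sum>i<n. emeasure (K1 i) B) + emeasure (R1 n) B"
    and sum2: "emeasure L2 B = (\<Sum>i<n. emeasure (K2 i) B) + emeasure (R2 n) B" if B: "B \<in> sets ?S" for n B
    using sums[of B R1 L1 K1, OF B _ K(1) sR(1)]
      sums[of B R2 L2 K2, OF B _ K(2) sR(2)] by (simp_all add: R1_def R2_def R0)
  have pre: "emeasure (distr Q ?S (\<theta> n)) B = emeasure Q (\<theta> n -` B \<inter> space ?S)"
    if "sets Q = sets ?S" "B \<in> sets ?S" for Q n B
    using that \<theta>[of n] sets_eq_imp_space_eq[OF that(1)]
    by (subst emeasure_distr) (auto simp: measurable_cong_sets[OF that(1) refl])
  \<comment> \<open>Parts removed at an earlier stage have equal images under a shorter shift, hence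
    also under the longer one.\<close>
  have K_eq: "emeasure (K1 i) (\<theta> n -` B \<inter> space ?S) = emeasure (K2 i) (\<theta> n -` B \<inter> space ?S)"
    if "i \<le> n" and B: "B \<in> sets ?S" for i n B
  proof -
    have C: "\<theta> (n - i) -` B \<inter> space ?S \<in> sets ?S" by (rule measurable_sets[OF \<theta> B])
    have "\<theta> n = \<theta> (n - i) \<circ> \<theta> i" using that(1) by (auto simp: \<theta>_def fun_eq_iff)
    moreover have "\<theta> i \<omega> \<in> space ?S" if "\<omega> \<in> space ?S" for \<omega> using measurable_space[OF \<theta> that] .
    ultimately have "\<theta> n -` B \<inter> space ?S = \<theta> i -` (\<theta> (n - i) -` B \<inter> space ?S) \<inter> space ?S" by auto
    then show ?thesis using pre[OF sK(1)[of i] C] pre[OF sK(2)[of i] C] eq[of i] by metis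
  qed
  \<comment> \<open>The removed parts have equal total mass on both sides and both laws have mass 1,
    so the remainders have equal mass too.\<close>
  have mass: "emeasure (R1 n) (space ?S) = emeasure (R2 n) (space ?S)" for n
  proof -
    define c where "c = (\<Sum>i<n. emeasure (K1 i) (space ?S))"
    have "\<theta> n -` space ?S \<inter> space ?S = space ?S" using measurable_space[OF \<theta>] by auto
    then have "emeasure (K1 i) (space ?S) = emeasure (K2 i) (space ?S)" if "i \<le> n" for i
      using K_eq[OF that sets.top] by simp
    then have c2: "c = (\<Sum>i<n. emeasure (K2 i) (space ?S))" unfolding c_def by (intro sum.cong) auto
    have t: "c + emeasure (R1 n) (space ?S) = 1" "c + emeasure (R2 n) (space ?S) = 1"
      using sum1[OF sets.top, of n] sum2[OF sets.top, of n] L1.emeasure_space_1 L2.emeasure_space_1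
      unfolding c_def[symmetric] c2[symmetric] p1(3) p2(3) by simp_all
    then have "c \<noteq> top" by auto
    moreover have "c + emeasure (R1 n) (space ?S) = c + emeasure (R2 n) (space ?S)" using t by simp
    ultimately show ?thesis by (simp add: ennreal_add_left_cancel)
  qed
  have small: "emeasure (R1 (Suc n)) (space ?S) \<le> ennreal (tv_dist ?S (distr L1 ?S (\<theta> n)) (distr L2 ?S (\<theta> n)))" for n
  proof -
    \<comment> \<open>This set is null for the first remainder and full for the second, while the
      parts removed so far weigh it equally. Thus the two laws differ on it by exactly the remaining
      mass.\<close>
    define B where "B = \<theta> n -` A n \<inter> space ?S"
    have B: "B \<in> sets ?S" unfolding B_def by (rule measurable_sets[OF \<theta> A])
    define k where "k = (\<Sum>i<Suc n. emeasure (K1 i) B)"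
    have l1: "emeasure L1 B = k"
      using sum1[OF B, of "Suc n"] sing(1)[of n] pre[OF sR(1) A] by (simp add: k_def B_def)
    have "emeasure (R2 (Suc n)) (space ?S) = emeasure (R2 (Suc n)) B"
    proof -
      have "\<theta> n -` (space ?S - A n) \<inter> space ?S = space ?S - B"
        using measurable_space[OF \<theta>] by (auto simp: B_def)
      then have "emeasure (R2 (Suc n)) (space ?S - B) = 0"
        using sing(2)[of n] pre[OF sR(2)[of "Suc n"], of "space ?S - A n" n] A by simp
      moreover have "emeasure (R2 (Suc n)) (space ?S) \<le> emeasure (R2 (Suc n)) B + emeasure (R2 (Suc n)) (space ?S - B)"
        using emeasure_subadditive[of B "R2 (Suc n)" "space ?S - B"] B sR sets.sets_into_space[OF B] by (simp add: Un_absorb1)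
      moreover have "emeasure (R2 (Suc n)) B \<le> emeasure (R2 (Suc n)) (space ?S)"
        using B sR sets.sets_into_space[OF B] by (intro emeasure_mono) auto
      ultimately show ?thesis by simp
    qed
    moreover note mass[of "Suc n"]
    moreover have "emeasure L2 B = k + emeasure (R2 (Suc n)) B"
    proof -
      have "k = (\<Sum>i<Suc n. emeasure (K2 i) B)"
        unfolding k_def B_def using K_eq[OF _ A] by (intro sum.cong) auto
      then show ?thesis using sum2[OF B, of "Suc n"] by simp
    qed
    ultimately have "emeasure L2 B = emeasure L1 B + emeasure (R1 (Suc n)) (space ?S)" using l1 by simp
    then have "emeasure (R1 (Suc n)) (space ?S) = emeasure L2 B - emeasure L1 B"
      by (simp add: L1.emeasure_eq_measure)
    also have "\<dots> = ennreal (measure L2 B - measure L1 B)"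
      by (simp add: L1.emeasure_eq_measure L2.emeasure_eq_measure ennreal_minus)
    also have "\<dots> \<le> ennreal (tv_dist ?S (distr L1 ?S (\<theta> n)) (distr L2 ?S (\<theta> n)))"
    proof (rule ennreal_leI)
      have dp: "distr L ?S (\<theta> n) \<in> space (prob_algebra ?S)" if "L \<in> space (prob_algebra ?S)" for L
        using measurable_space[OF measurable_distr_prob_space[OF \<theta>] that] .
      have "measure L1 B = measure (distr L1 ?S (\<theta> n)) (A n)" "measure L2 B = measure (distr L2 ?S (\<theta> n)) (A n)"
        using pre[OF p1(2) A] pre[OF p2(2) A] by (simp_all add: measure_def B_def)
      then show "measure L2 B - measure L1 B \<le> tv_dist ?S (distr L1 ?S (\<theta> n)) (distr L2 ?S (\<theta> n))"
        using tv_dist_upper[OF dp[OF L(1)] dp[OF L(2)] A, of n] by linarith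
    qed
    finally show ?thesis .
  qed
  show ?thesis
    by (rule that[of K1 K2 R1 R2, OF sK fK eq[unfolded \<theta>_def] sum1 sum2 sR mass small[unfolded \<theta>_def]])
qed

text \<open>The parts removed at stage \<open>n\<close> are glued into a measure on pairs that agree
  from \<open>n\<close> on, and the stages are added up. The remainders vanish in the limit, so the
  sum has the right marginals; what may still disagree after time \<open>n\<close> is at most the
  mass left after stage \<open>n\<close>.\<close>

lemma successful_coupling:
  fixes M :: "'a measure"
  assumes borel: "is_borel_space M" and diag: "diagonal M \<in> sets (M \<Otimes>\<^sub>M M)"
    and L: "L1 \<in> space (prob_algebra (path_space M))" "L2 \<in> space (prob_algebra (path_space M))"
    and lim: "(\<lambda>n. tv_dist (path_space M) (distr L1 (path_space M) (\<lambda>\<omega> i. \<omega> (i + n))) (distr L2 (path_space M) (\<lambda>\<omega> i. \<omega> (i + n)))) \<longlonglongrightarrow> 0"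
  obtains \<xi> where "\<xi> \<in> couplings L1 L2" "(\<lambda>n. measure \<xi> (agree_from M n)) \<longlonglongrightarrow> 1"
proof -
  let ?S = "path_space M"
  define t where "t n = tv_dist ?S (distr L1 ?S (\<lambda>\<omega> i. \<omega> (i + n))) (distr L2 ?S (\<lambda>\<omega> i. \<omega> (i + n)))" for n
  note p1 = prob_algebraD[OF L(1)] and p2 = prob_algebraD[OF L(2)]
  interpret L1: prob_space L1 by (rule p1)
  interpret L2: prob_space L2 by (rule p2)
  obtain \<omega>0 where "\<omega>0 \<in> space ?S" using L1.not_empty p1(3) by blast
  then have ne: "space M \<noteq> {}" by (auto simp: space_path_space)
  obtain K1 K2 R1 R2 where sK: "\<And>n::nat. sets (K1 n) = sets ?S" "\<And>n. sets (K2 n) = sets ?S"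
    and fK: "\<And>n. finite_measure (K1 n)" "\<And>n. finite_measure (K2 n)"
    and eq: "\<And>n. distr (K1 n) ?S (\<lambda>\<omega> i. \<omega> (i + n)) = distr (K2 n) ?S (\<lambda>\<omega> i. \<omega> (i + n))"
    and sum1: "\<And>n A. A \<in> sets ?S \<Longrightarrow> emeasure L1 A = (\<Sum>i<n. emeasure (K1 i) A) + emeasure (R1 n) A"
    and sum2: "\<And>n A. A \<in> sets ?S \<Longrightarrow> emeasure L2 A = (\<Sum>i<n. emeasure (K2 i) A) + emeasure (R2 n) A"
    and sR: "\<And>n. sets (R1 n) = sets ?S" "\<And>n. sets (R2 n) = sets ?S"
    and mass: "\<And>n. emeasure (R1 n) (space ?S) = emeasure (R2 n) (space ?S)"
    and small0: "\<And>n. emeasure (R1 (Suc n)) (space ?S) \<le>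
      ennreal (tv_dist ?S (distr L1 ?S (\<lambda>\<omega> i. \<omega> (i + n))) (distr L2 ?S (\<lambda>\<omega> i. \<omega> (i + n))))"
    by (rule successive_splitting[OF L]) (rule that; assumption)
  note small = small0[folded t_def]
  have "\<forall>n. \<exists>\<xi>. finite_measure \<xi> \<and> sets \<xi> = sets (?S \<Otimes>\<^sub>M ?S) \<and>
    distr \<xi> ?S fst = K1 n \<and> distr \<xi> ?S snd = K2 n \<and> (AE p in \<xi>. p \<in> agree_from M n)"
    using glue_paths[OF borel ne diag fK sK eq] by blast
  then obtain X where X: "\<And>n. finite_measure (X n)" "\<And>n. sets (X n) = sets (?S \<Otimes>\<^sub>M ?S)"
    "\<And>n. distr (X n) ?S fst = K1 n" "\<And>n. distr (X n) ?S snd = K2 n" "\<And>n. AE p in X n. p \<in> agree_from M n"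
    unfolding choice_iff by blast
  have spX: "space (X n) = space ?S \<times> space ?S" for n
    using sets_eq_imp_space_eq[OF X(2)] by (simp add: space_pair_measure)
  \<comment> \<open>The sum of the glued stages; its total mass is 1 only because the remainders
    tend to zero.\<close>
  define \<xi> where "\<xi> = mix_measure (?S \<Otimes>\<^sub>M ?S) X"
  have sx: "sets \<xi> = sets (?S \<Otimes>\<^sub>M ?S)" by (simp add: \<xi>_def)
  have spx: "space \<xi> = space ?S \<times> space ?S" using sets_eq_imp_space_eq[OF sx] by (simp add: space_pair_measure)
  have ex: "emeasure \<xi> B = (\<Sum>n. emeasure (X n) B)" if "B \<in> sets (?S \<Otimes>\<^sub>M ?S)" for B
    unfolding \<xi>_def using X(2) that by (subst emeasure_mix_measure) (auto simp: nn_integral_count_space_nat)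
  have X1: "emeasure (X n) (A \<times> space ?S) = emeasure (K1 n) A"
    and X2: "emeasure (X n) (space ?S \<times> A) = emeasure (K2 n) A" if A: "A \<in> sets ?S" for n A
  proof -
    have m: "fst \<in> X n \<rightarrow>\<^sub>M ?S" "snd \<in> X n \<rightarrow>\<^sub>M ?S" unfolding measurable_cong_sets[OF X(2) refl] by auto
    have "fst -` A \<inter> space (X n) = A \<times> space ?S" "snd -` A \<inter> space (X n) = space ?S \<times> A"
      using sets.sets_into_space[OF A] by (auto simp: spX)
    then show "emeasure (X n) (A \<times> space ?S) = emeasure (K1 n) A" "emeasure (X n) (space ?S \<times> A) = emeasure (K2 n) A"
      using emeasure_distr[OF m(1) A] emeasure_distr[OF m(2) A] X(3,4) by auto
  qed
  have small2: "emeasure (R2 (Suc n)) (space ?S) \<le> ennreal (t n)" for n using small[of n] mass by simp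
  have dp: "distr L ?S (\<lambda>\<omega> i. \<omega> (i + n)) \<in> space (prob_algebra ?S)" if "L \<in> space (prob_algebra ?S)" for L n
    by (rule measurable_space[OF measurable_distr_prob_space[OF shift_measurable] that])
  have tn: "0 \<le> t n" for n unfolding t_def by (rule tv_dist_nonneg[OF dp[OF L(1)] dp[OF L(2)]])
  have t0: "(\<lambda>n. ennreal (t n)) \<longlonglongrightarrow> 0"
    using lim tendsto_ennrealI[of t 0 sequentially] by (simp add: t_def[abs_def])
  have rem: "emeasure (R1 (Suc n)) A \<le> ennreal (t n)" "emeasure (R2 (Suc n)) A \<le> ennreal (t n)" if A: "A \<in> sets ?S" for A n
  proof -
    have "emeasure (R1 (Suc n)) A \<le> emeasure (R1 (Suc n)) (space ?S)" "emeasure (R2 (Suc n)) A \<le> emeasure (R2 (Suc n)) (space ?S)"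
      using A sR[of "Suc n"] sets.sets_into_space[OF A] by (auto intro!: emeasure_mono)
    then show "emeasure (R1 (Suc n)) A \<le> ennreal (t n)" "emeasure (R2 (Suc n)) A \<le> ennreal (t n)"
      using small[of n] small2[of n] by (auto intro: order_trans)
  qed
  \<comment> \<open>The partial sums miss \<open>L\<close> by the remainder, which is at most
    \<open>t n\<close> after stage \<open>n\<close>.\<close>
  have total: "emeasure L A = (\<Sum>n. emeasure (K n) A)"
    if s: "\<And>n. emeasure L A = (\<Sum>i<n. emeasure (K i) A) + emeasure (R n) A" and r: "\<And>n. emeasure (R (Suc n)) A \<le> ennreal (t n)"
    for L :: "(nat \<Rightarrow> 'a) measure" and K R A
  proof (rule antisym)
    have "emeasure L A \<le> (\<Sum>n. emeasure (K n) A) + ennreal (t n)" for n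
      unfolding s[of "Suc n"] by (intro add_mono sum_le_suminf r) auto
    moreover have "(\<lambda>n. (\<Sum>n. emeasure (K n) A) + ennreal (t n)) \<longlonglongrightarrow> (\<Sum>n. emeasure (K n) A) + 0"
      by (intro tendsto_add tendsto_const t0)
    ultimately show "emeasure L A \<le> (\<Sum>n. emeasure (K n) A)"
      by (intro LIMSEQ_le_const[of _ "(\<Sum>n. emeasure (K n) A)"]) auto
    show "(\<Sum>n. emeasure (K n) A) \<le> emeasure L A"
    proof (rule suminf_le_const)
      show "(\<Sum>i<n. emeasure (K i) A) \<le> emeasure L A" for n unfolding s[of n] by simp
    qed auto
  qed
  have m1: "emeasure \<xi> (A \<times> space ?S) = emeasure L1 A" and m2: "emeasure \<xi> (space ?S \<times> A) = emeasure L2 A"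
    if A: "A \<in> sets ?S" for A
    using total[of L1 A K1 R1, OF sum1[OF A] rem(1)[OF A]] total[of L2 A K2 R2, OF sum2[OF A] rem(2)[OF A]] A
    by (simp_all add: ex X1 X2)
  have prob: "prob_space \<xi>"
    using m1[OF sets.top] L1.emeasure_space_1 p1(3) by (intro prob_spaceI) (simp add: spx)
  interpret P: prob_space \<xi> by (rule prob)
  have mx: "fst \<in> \<xi> \<rightarrow>\<^sub>M ?S" "snd \<in> \<xi> \<rightarrow>\<^sub>M ?S" unfolding measurable_cong_sets[OF sx refl] by auto
  have coup: "\<xi> \<in> couplings L1 L2"
  proof (rule couplingsI)
    show "\<xi> \<in> space (prob_algebra (?S \<Otimes>\<^sub>M ?S))" using prob sx by (simp add: space_prob_algebra)
    show "distr \<xi> ?S fst = L1"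
    proof (rule measure_eqI)
      fix A assume "A \<in> sets (distr \<xi> ?S fst)"
      then have A: "A \<in> sets ?S" by simp
      have "fst -` A \<inter> space \<xi> = A \<times> space ?S" using sets.sets_into_space[OF A] by (auto simp: spx)
      then show "emeasure (distr \<xi> ?S fst) A = emeasure L1 A" using emeasure_distr[OF mx(1) A] m1[OF A] by simp
    qed (simp add: p1)
    show "distr \<xi> ?S snd = L2"
    proof (rule measure_eqI)
      fix A assume "A \<in> sets (distr \<xi> ?S snd)"
      then have A: "A \<in> sets ?S" by simp
      have "snd -` A \<inter> space \<xi> = space ?S \<times> A" using sets.sets_into_space[OF A] by (auto simp: spx)
      then show "emeasure (distr \<xi> ?S snd) A = emeasure L2 A" using emeasure_distr[OF mx(2) A] m2[OF A] by simp
    qed (simp add: p2)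
  qed
  \<comment> \<open>The stages up to \<open>n\<close> are concentrated on pairs that agree from
    \<open>n\<close> on, and all later stages together have mass at most \<open>t n\<close>.\<close>
  have lower: "1 - t n \<le> measure \<xi> (agree_from M n)" for n
  proof -
    note ag = agree_from_sets[OF diag]
    have full: "emeasure (X i) (agree_from M n) = emeasure (K1 i) (space ?S)" if "i \<le> n" for i
    proof -
      have "emeasure (X i) (agree_from M n) = emeasure (X i) (space (X i))"
      proof (rule emeasure_eq_AE)
        show "AE p in X i. p \<in> agree_from M n \<longleftrightarrow> p \<in> space (X i)"
          using X(5)[of i] AE_space
          by eventually_elim (use agree_from_mono[OF that, of M] in auto)
      qed (use ag X(2) in auto)
      then show ?thesis using X1[OF sets.top, of i] by (simp add: spX)
    qed
    have "1 = (\<Sum>i<Suc n. emeasure (K1 i) (space ?S)) + emeasure (R1 (Suc n)) (space ?S)"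
      using sum1[OF sets.top, of "Suc n"] L1.emeasure_space_1 p1(3) by simp
    also have "\<dots> \<le> (\<Sum>i<Suc n. emeasure (X i) (agree_from M n)) + ennreal (t n)"
      using full small[of n] by (intro add_mono sum_mono) auto
    also have "\<dots> \<le> emeasure \<xi> (agree_from M n) + ennreal (t n)"
      unfolding ex[OF ag] by (intro add_mono sum_le_suminf) auto
    also have "\<dots> = ennreal (measure \<xi> (agree_from M n) + t n)"
      using tn by (simp add: P.emeasure_eq_measure)
    finally have "ennreal 1 \<le> ennreal (measure \<xi> (agree_from M n) + t n)" by (simp only: ennreal_1)
    moreover have "0 \<le> measure \<xi> (agree_from M n) + t n" using tn[of n] by simp
    ultimately show ?thesis using ennreal_le_iff by fastforce
  qed
  have "(\<lambda>n. measure \<xi> (agree_from M n)) \<longlonglongrightarrow> 1"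
  proof (rule tendsto_sandwich[OF always_eventually always_eventually _ tendsto_const])
    show "(\<lambda>n. 1 - t n) \<longlonglongrightarrow> 1" using tendsto_diff[OF tendsto_const lim, of 1] by (simp add: t_def)
    show "\<forall>n. 1 - t n \<le> measure \<xi> (agree_from M n)" using lower by blast
    show "\<forall>n. measure \<xi> (agree_from M n) \<le> 1" by simp
  qed
  with coup show ?thesis by (rule that)
qed

subsection \<open>Equivalence of the conditions\<close>

context stationary_kernel
begin

lemma convergence_imp_asymptotically_equivalent:
  assumes "AE x in \<mu>. (\<lambda>n. tv_dist M (nstep M P n x) \<mu>) \<longlonglongrightarrow> 0"
  shows "AE p in \<mu> \<Otimes>\<^sub>M \<mu>. asymptotically_equivalent M P (fst p) (snd p)"
  using dist_n_tendsto_0[OF assms] AE_space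
proof eventually_elim
  fix p assume lim: "(\<lambda>n. dist_n n p) \<longlonglongrightarrow> 0" and "p \<in> space (\<mu> \<Otimes>\<^sub>M \<mu>)"
  then have p: "fst p \<in> space M" "snd p \<in> space M" by (auto simp: space_mu2)
  show "asymptotically_equivalent M P (fst p) (snd p)"
    unfolding asymptotically_equivalent_def
  proof (intro allI impI)
    fix \<epsilon> :: real assume "\<epsilon> > 0"
    then have "eventually (\<lambda>n. dist_n n p < \<epsilon>) sequentially" by (rule order_tendstoD(2)[OF lim])
    then have "eventually (\<lambda>n. n \<ge> 1 \<and> dist_n n p < \<epsilon>) sequentially"
      using eventually_ge_at_top[of 1] by eventually_elim simp
    then obtain n where n: "n \<ge> 1" "dist_n n p < \<epsilon>" unfolding eventually_sequentially by blast
    have "tv_dist M (nstep M P n (fst p)) (nstep M P n (snd p)) \<le> \<epsilon>" using n(2) by (simp add: dist_n_def)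
    then obtain A where "A \<in> sets M" "measure (nstep M P n (fst p)) A \<ge> 1 - \<epsilon>" "measure (nstep M P n (snd p)) A \<ge> 1 - \<epsilon>"
      "absolutely_continuous (restrict_space (nstep M P n (fst p)) A) (restrict_space (nstep M P n (snd p)) A)"
      "absolutely_continuous (restrict_space (nstep M P n (snd p)) A) (restrict_space (nstep M P n (fst p)) A)"
      by (rule tv_dist_equivalent_set[OF nstep_in[OF p(1)] nstep_in[OF p(2)]])
    then show "\<exists>n\<ge>1. \<exists>A\<in>sets M. 1 - \<epsilon> \<le> measure (nstep M P n (fst p)) A \<and> 1 - \<epsilon> \<le> measure (nstep M P n (snd p)) A \<and>
      absolutely_continuous (restrict_space (nstep M P n (fst p)) A) (restrict_space (nstep M P n (snd p)) A) \<and>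
      absolutely_continuous (restrict_space (nstep M P n (snd p)) A) (restrict_space (nstep M P n (fst p)) A)"
      using n(1) by blast
  qed
qed

lemma asymptotically_equivalent_non_singular:
  assumes xy: "x \<in> space M" "y \<in> space M" and "asymptotically_equivalent M P x y"
  shows "\<exists>n\<ge>1. non_singular M (nstep M P n x) (nstep M P n y)"
proof -
  \<comment> \<open>With 1/2 for epsilon both masses of \<open>A\<close> are positive; any value
    below 1 has this effect.\<close>
  obtain n A where n: "n \<ge> 1" and A: "A \<in> sets M"
    and m: "measure (nstep M P n x) A \<ge> 1 - 1 / 2" "measure (nstep M P n y) A \<ge> 1 - 1 / 2"
    and ac: "absolutely_continuous (restrict_space (nstep M P n x) A) (restrict_space (nstep M P n y) A)"
    using assms(3)[unfolded asymptotically_equivalent_def, rule_format, of "1 / 2"] by auto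
  have "non_singular M (nstep M P n x) (nstep M P n y)"
    using m by (intro equivalent_set_non_singular[OF nstep_in[OF xy(1)] nstep_in[OF xy(2)] A _ _ ac]) auto
  then show ?thesis using n by blast
qed

text \<open>Coincidence from some time \<open>n\<close> on has positive probability. A set
  separating the laws at time \<open>n\<close> would almost surely contain one of the two states and
  exclude the other.\<close>

lemma successfully_coupled_non_singular:
  assumes x: "x \<in> space M" and y: "y \<in> space M" and sc: "successfully_coupled TYPE('w) M P x y"
  shows "\<exists>n. non_singular M (nstep M P n x) (nstep M P n y)"
proof -
  obtain \<Omega> :: "'w measure" and X Y where c: "rv_coupling \<Omega> X Y (chain_law M P x) (chain_law M P y)"
    and lim: "(\<lambda>n. measure \<Omega> {\<omega> \<in> space \<Omega>. \<forall>k\<ge>n. X \<omega> k = Y \<omega> k}) \<longlonglongrightarrow> 1"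
    using sc unfolding successfully_coupled_def by blast
  let ?Lx = "chain_law M P x" and ?Ly = "chain_law M P y"
  have X: "X \<in> \<Omega> \<rightarrow>\<^sub>M ?Lx" and Y: "Y \<in> \<Omega> \<rightarrow>\<^sub>M ?Ly"
    and d: "distr (distr \<Omega> (?Lx \<Otimes>\<^sub>M ?Ly) (\<lambda>\<omega>. (X \<omega>, Y \<omega>))) ?Lx fst = ?Lx"
      "distr (distr \<Omega> (?Lx \<Otimes>\<^sub>M ?Ly) (\<lambda>\<omega>. (X \<omega>, Y \<omega>))) ?Ly snd = ?Ly"
    using c by (auto simp: rv_coupling_def couplings_def)
  have XY: "(\<lambda>\<omega>. (X \<omega>, Y \<omega>)) \<in> \<Omega> \<rightarrow>\<^sub>M ?Lx \<Otimes>\<^sub>M ?Ly" by (rule measurable_Pair[OF X Y])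
  have dX: "distr \<Omega> ?Lx X = ?Lx" and dY: "distr \<Omega> ?Ly Y = ?Ly"
    using d distr_distr[OF measurable_fst XY] distr_distr[OF measurable_snd XY] by (simp_all add: comp_def)
  have "eventually (\<lambda>n. measure \<Omega> {\<omega> \<in> space \<Omega>. \<forall>k\<ge>n. X \<omega> k = Y \<omega> k} > 0) sequentially"
    by (rule order_tendstoD(1)[OF lim]) simp
  then obtain n where n: "measure \<Omega> {\<omega> \<in> space \<Omega>. \<forall>k\<ge>n. X \<omega> k = Y \<omega> k} > 0"
    by (auto simp: eventually_sequentially)
  define E where "E = {\<omega> \<in> space \<Omega>. \<forall>k\<ge>n. X \<omega> k = Y \<omega> k}"
  have Epos: "emeasure \<Omega> E > 0" using n by (auto simp: E_def measure_def zero_less_iff_neq_zero)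
  have "non_singular M (nstep M P n x) (nstep M P n y)"
    unfolding non_singular_def
  proof (rule notI, elim bexE conjE)
    fix A assume A: "A \<in> sets M" "emeasure (nstep M P n x) A = 0" "emeasure (nstep M P n y) (space M - A) = 0"
    define C where "C B = {\<omega> \<in> space (path_space M). \<omega> n \<in> B}" for B
    have C: "C B \<in> sets (path_space M)" if "B \<in> sets M" for B
    proof -
      have "C B = (\<lambda>\<omega>. \<omega> n) -` B \<inter> space (path_space M)" by (auto simp: C_def)
      then show ?thesis using measurable_sets[OF path_component_measurable that] by simp
    qed
    note px = prob_algebraD[OF chain_law_prob[OF x]] and py = prob_algebraD[OF chain_law_prob[OF y]]
    have CA: "C A \<in> sets ?Lx" "C (space M - A) \<in> sets ?Ly" using C A(1) px py by auto
    have "emeasure \<Omega> (X -` C A \<inter> space \<Omega>) = emeasure (distr \<Omega> ?Lx X) (C A)"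
      by (rule emeasure_distr[OF X CA(1), symmetric])
    also have "\<dots> = 0" unfolding dX C_def using emeasure_chain_law_component[OF x A(1)] A(2) by simp
    finally have "X -` C A \<inter> space \<Omega> \<in> null_sets \<Omega>" using measurable_sets[OF X CA(1)] by (simp add: null_sets_def)
    moreover have "emeasure \<Omega> (Y -` C (space M - A) \<inter> space \<Omega>) = emeasure (distr \<Omega> ?Ly Y) (C (space M - A))"
      by (rule emeasure_distr[OF Y CA(2), symmetric])
    then have "emeasure \<Omega> (Y -` C (space M - A) \<inter> space \<Omega>) = 0"
      unfolding dY C_def using emeasure_chain_law_component[OF y, of "space M - A"] A by simp
    then have "Y -` C (space M - A) \<inter> space \<Omega> \<in> null_sets \<Omega>" using measurable_sets[OF Y CA(2)] by (simp add: null_sets_def)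
    ultimately have null: "(X -` C A \<inter> space \<Omega>) \<union> (Y -` C (space M - A) \<inter> space \<Omega>) \<in> null_sets \<Omega>"
      by (rule null_sets.Un)
    have sub: "E \<subseteq> (X -` C A \<inter> space \<Omega>) \<union> (Y -` C (space M - A) \<inter> space \<Omega>)"
    proof
      fix \<omega> assume w: "\<omega> \<in> E"
      then have "\<omega> \<in> space \<Omega>" "X \<omega> n = Y \<omega> n" by (auto simp: E_def)
      moreover have "X \<omega> \<in> space (path_space M)" "Y \<omega> \<in> space (path_space M)"
        using measurable_space[OF X \<open>\<omega> \<in> space \<Omega>\<close>] measurable_space[OF Y \<open>\<omega> \<in> space \<Omega>\<close>] px(3) py(3) by auto
      ultimately show "\<omega> \<in> (X -` C A \<inter> space \<Omega>) \<union> (Y -` C (space M - A) \<inter> space \<Omega>)"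
        by (auto simp: C_def space_path_space)
    qed
    \<comment> \<open>Monotonicity asks for measurability of the larger set only, so the coincidence
      event may be any subset.\<close>
    have "emeasure \<Omega> E \<le> emeasure \<Omega> ((X -` C A \<inter> space \<Omega>) \<union> (Y -` C (space M - A) \<inter> space \<Omega>))"
      using null sub by (intro emeasure_mono) auto
    then show False using null Epos by auto
  qed
  then show ?thesis by blast
qed

text \<open>The shifted path laws are images of the n-step laws under the kernel
  \<open>chain_law M P\<close>, so their distance tends to zero with \<open>dist_n\<close>. The
  coupling lives on pairs of paths with the two projections, which explains the type of sample
  points.\<close>

lemma convergence_imp_successfully_coupled:
  assumes borel: "is_borel_space M"
    and conv: "AE x in \<mu>. (\<lambda>n. tv_dist M (nstep M P n x) \<mu>) \<longlonglongrightarrow> 0"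
  shows "AE p in \<mu> \<Otimes>\<^sub>M \<mu>. successfully_coupled TYPE((nat \<Rightarrow> 'a) \<times> (nat \<Rightarrow> 'a)) M P (fst p) (snd p)"
  using dist_n_tendsto_0[OF conv] AE_space
proof eventually_elim
  fix p assume lim: "(\<lambda>n. dist_n n p) \<longlonglongrightarrow> 0" and "p \<in> space (\<mu> \<Otimes>\<^sub>M \<mu>)"
  then have p: "fst p \<in> space M" "snd p \<in> space M" by (auto simp: space_mu2)
  let ?S = "path_space M" and ?L1 = "chain_law M P (fst p)" and ?L2 = "chain_law M P (snd p)"
  note L = chain_law_prob[OF p(1)] chain_law_prob[OF p(2)]
  note p1 = prob_algebraD[OF L(1)] and p2 = prob_algebraD[OF L(2)]
  define t where "t n = tv_dist ?S (distr ?L1 ?S (\<lambda>\<omega> i. \<omega> (i + n))) (distr ?L2 ?S (\<lambda>\<omega> i. \<omega> (i + n)))" for n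
  have dp: "distr L ?S (\<lambda>\<omega> i. \<omega> (i + n)) \<in> space (prob_algebra ?S)" if "L \<in> space (prob_algebra ?S)" for L n
    by (rule measurable_space[OF measurable_distr_prob_space[OF shift_measurable] that])
  have upper: "t n \<le> dist_n n p" for n
    unfolding t_def chain_law_shift[OF p(1)] chain_law_shift[OF p(2)] dist_n_def
    by (rule tv_dist_bind_le[OF nstep_in[OF p(1)] nstep_in[OF p(2)] chain_law_measurable])
  have lower: "0 \<le> t n" for n
    unfolding t_def by (rule tv_dist_nonneg[OF dp[OF L(1)] dp[OF L(2)]])
  have "t \<longlonglongrightarrow> 0"
    by (rule tendsto_sandwich[OF always_eventually always_eventually tendsto_const lim]) (use upper lower in auto)
  then obtain \<xi> where c: "\<xi> \<in> couplings ?L1 ?L2" and xi: "(\<lambda>n. measure \<xi> (agree_from M n)) \<longlonglongrightarrow> 1"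
    unfolding t_def[abs_def] by (rule successful_coupling[OF borel diagonal_sets L])
  note cD = couplingsD[OF c L] and cp = prob_algebraD[OF couplingsD(1)[OF c L]]
  have s12: "sets (?L1 \<Otimes>\<^sub>M ?L2) = sets (?S \<Otimes>\<^sub>M ?S)" using p1 p2 by (intro sets_pair_measure_cong)
  have "fst \<in> \<xi> \<rightarrow>\<^sub>M ?L1" "snd \<in> \<xi> \<rightarrow>\<^sub>M ?L2"
    unfolding measurable_cong_sets[OF cp(2) p1(2)] measurable_cong_sets[OF cp(2) p2(2)] by auto
  moreover have "distr \<xi> (?L1 \<Otimes>\<^sub>M ?L2) (\<lambda>\<omega>. (fst \<omega>, snd \<omega>)) = \<xi>"
    unfolding prod.collapse using s12 cp(2) by (intro distr_id2) simp
  ultimately have rv: "rv_coupling \<xi> fst snd ?L1 ?L2"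
    unfolding rv_coupling_def using cp(1) c by simp
  have ag: "{\<omega> \<in> space \<xi>. \<forall>k\<ge>n. fst \<omega> k = snd \<omega> k} = agree_from M n" for n
    unfolding agree_from_def cp(3) ..
  show "successfully_coupled TYPE((nat \<Rightarrow> 'a) \<times> (nat \<Rightarrow> 'a)) M P (fst p) (snd p)"
    unfolding successfully_coupled_def
  proof (intro exI conjI)
    show "rv_coupling \<xi> fst snd ?L1 ?L2" by (rule rv)
    show "(\<lambda>n. measure \<xi> {\<omega> \<in> space \<xi>. \<forall>k\<ge>n. fst \<omega> k = snd \<omega> k}) \<longlonglongrightarrow> 1"
      unfolding ag by (rule xi)
  qed
qed

end

text \<open>Convergence is the hub to which every condition is compared. The type variable for
  sample points is free where a successful coupling is assumed, so any sample space is covered;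
  where one is produced, its type is that of pairs of paths.\<close>

theorem theorem2p18:
  fixes M :: "'a measure" and P :: "'a \<Rightarrow> 'a measure" and \<mu> :: "'a measure"
  assumes "countably_generated M"
    and "diagonal M \<in> sets (M \<Otimes>\<^sub>M M)"
    and "P \<in> M \<rightarrow>\<^sub>M prob_algebra M"
    and "invariant_prob M P \<mu>"
  defines "P3 \<equiv> AE x in \<mu>. (\<lambda>n. tv_dist M (nstep M P n x) \<mu>) \<longlonglongrightarrow> 0"
    and "A3 \<equiv> AE (x, y) in \<mu> \<Otimes>\<^sub>M \<mu>. \<exists>n\<ge>1. non_singular M (nstep M P n x) (nstep M P n y)"
    and "A3' \<equiv> AE (x, y) in \<mu> \<Otimes>\<^sub>M \<mu>. asymptotically_equivalent M P x y"
    and "B3 \<equiv> aperiodic M P \<mu> \<and> weakly_irreducible M P \<mu>"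
    and "C3 \<equiv> AE (x, y) in \<mu> \<Otimes>\<^sub>M \<mu>. \<exists>k. \<exists>\<zeta> \<in> couplings (nstep M P k x) (nstep M P k y).
                emeasure \<zeta> (diagonal M) > 0"
    and "G3 \<equiv> AE (x, y) in \<mu> \<Otimes>\<^sub>M \<mu>. \<exists>k\<ge>1.
                \<exists>\<zeta> \<in> generalized_couplings (nstep M P k x) (nstep M P k y).
                emeasure \<zeta> (diagonal M) > 0"
  shows "(A3 \<longleftrightarrow> P3) \<and> (A3' \<longleftrightarrow> P3) \<and> (B3 \<longleftrightarrow> P3) \<and> (C3 \<longleftrightarrow> P3) \<and> (G3 \<longleftrightarrow> P3) \<and>
    ((AE (x, y) in \<mu> \<Otimes>\<^sub>M \<mu>. successfully_coupled TYPE('w) M P x y) \<longrightarrow> P3) \<and>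
    (is_borel_space M \<longrightarrow> P3 \<longrightarrow>
       (AE (x, y) in \<mu> \<Otimes>\<^sub>M \<mu>.
          successfully_coupled TYPE((nat \<Rightarrow> 'a) \<times> (nat \<Rightarrow> 'a)) M P x y))"
proof -
  interpret stationary_kernel M P \<mu>
    using assms(1-4) by unfold_locales
  note defs = P3_def A3_def A3'_def B3_def C3_def G3_def case_prod_beta'
  have to_P3: P3
    if "AE p in \<mu> \<Otimes>\<^sub>M \<mu>. Q p"
      "\<And>x y. x \<in> space M \<Longrightarrow> y \<in> space M \<Longrightarrow> Q (x, y) \<Longrightarrow> \<exists>n. non_singular M (nstep M P n x) (nstep M P n y)" for Q
  proof -
    have "AE p in \<mu> \<Otimes>\<^sub>M \<mu>. \<exists>n. non_singular M (nstep M P n (fst p)) (nstep M P n (snd p))"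
      using that(1) AE_space by eventually_elim (use that(2) in \<open>auto simp: space_mu2\<close>)
    then show P3 unfolding P3_def by (rule non_singular_imp_convergence)
  qed
  have P3_A3': A3' if P3
    unfolding defs by (rule convergence_imp_asymptotically_equivalent) (use that in \<open>simp add: P3_def\<close>)
  have A3'_A3: A3 if A3'
    using that unfolding defs
  proof (rule AE_mp[OF _ AE_I2], intro impI)
    fix p assume "p \<in> space (\<mu> \<Otimes>\<^sub>M \<mu>)" "asymptotically_equivalent M P (fst p) (snd p)"
    then show "\<exists>n\<ge>1. non_singular M (nstep M P n (fst p)) (nstep M P n (snd p))"
      by (intro asymptotically_equivalent_non_singular) (auto simp: space_mu2)
  qed
  have couple: "\<exists>\<zeta>\<in>couplings (nstep M P n x) (nstep M P n y). emeasure \<zeta> (diagonal M) > 0"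
    if "x \<in> space M" "y \<in> space M" "non_singular M (nstep M P n x) (nstep M P n y)" for x y n
    using non_singular_coupling[OF nstep_in[OF that(1)] nstep_in[OF that(2)] diagonal_sets that(3)] by blast
  have A3_C3: C3 if A3
    using that unfolding defs
  proof (rule AE_mp[OF _ AE_I2], intro impI)
    fix p assume "p \<in> space (\<mu> \<Otimes>\<^sub>M \<mu>)" and ns: "\<exists>n\<ge>1. non_singular M (nstep M P n (fst p)) (nstep M P n (snd p))"
    then have p: "fst p \<in> space M" "snd p \<in> space M" by (auto simp: space_mu2)
    show "\<exists>k. \<exists>\<zeta>\<in>couplings (nstep M P k (fst p)) (nstep M P k (snd p)). emeasure \<zeta> (diagonal M) > 0"
      using couple[OF p] ns by blast
  qed
  have A3_G3: G3 if A3
    using that unfolding defs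
  proof (rule AE_mp[OF _ AE_I2], intro impI)
    fix p assume "p \<in> space (\<mu> \<Otimes>\<^sub>M \<mu>)" and ns: "\<exists>n\<ge>1. non_singular M (nstep M P n (fst p)) (nstep M P n (snd p))"
    then have p: "fst p \<in> space M" "snd p \<in> space M" by (auto simp: space_mu2)
    show "\<exists>k\<ge>1. \<exists>\<zeta>\<in>generalized_couplings (nstep M P k (fst p)) (nstep M P k (snd p)). emeasure \<zeta> (diagonal M) > 0"
      using couple[OF p] ns couplings_subset_generalized_couplings by blast
  qed
  have A3_P3: P3 if A3
    by (rule to_P3[OF that[unfolded A3_def]]) auto
  have C3_P3: P3 if C3
    by (rule to_P3[OF that[unfolded C3_def]]) (use couplings_non_singular[OF nstep_in nstep_in] in blast)
  have G3_P3: P3 if G3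
    by (rule to_P3[OF that[unfolded G3_def]]) (use generalized_couplings_non_singular[OF nstep_in nstep_in] in blast)
  have B3: "B3 \<longleftrightarrow> P3"
    unfolding defs
    using aperiodic_irreducible_imp_convergence convergence_imp_aperiodic convergence_imp_weakly_irreducible by blast
  have coupled: "(AE (x, y) in \<mu> \<Otimes>\<^sub>M \<mu>. successfully_coupled TYPE('w) M P x y) \<longrightarrow> P3"
    by (rule impI, erule to_P3) (use successfully_coupled_non_singular in auto)
  have "is_borel_space M \<longrightarrow> P3 \<longrightarrow>
       (AE (x, y) in \<mu> \<Otimes>\<^sub>M \<mu>. successfully_coupled TYPE((nat \<Rightarrow> 'a) \<times> (nat \<Rightarrow> 'a)) M P x y)"
    unfolding defs using convergence_imp_successfully_coupled by blast
  then show ?thesis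
    using P3_A3' A3'_A3 A3_C3 A3_G3 A3_P3 C3_P3 G3_P3 B3 coupled by blast
qed

end
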